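(* The cost functional $\mathcal J$ is Fréchet differentiable and its gradient at each $\mathcal W\in\mathcal U_{\mathrm{ad}}$ is given by $$\mathcal J'(\mathcal W)=\left(\varphi(t,x,\mathcal W),\ \varphi(t,0,\mathcal W)\right)\in\mathbb L^2_T,$$ where $(\varphi(t,\cdot,\mathcal W),\varphi(t,0,\mathcal W),\varphi(t,l,\mathcal W))$ is the mild solution of the adjoint system $$\begin{cases}\varphi_{tt}(t,x)-\varphi_{xx}(t,x)=0 & \text{in }(0,T)\times(0,l),\\ \varphi_{tt}(t,0)-\varphi_x(t,0)=0 & \text{in }(0,T),\\ \varphi_{tt}(t,l)+\varphi_x(t,l)=0 & \text{in }(0,T),\\ (\varphi(T,\cdot),\varphi(T,0),\varphi(T,l))=(0,0,0),\\ (\varphi_t(T,\cdot),\varphi_t(T,0),\varphi_t(T,l))=-\left(Y(T,\cdot,\mathcal W)-Y_T^\delta\right).\end{cases}$$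
   Context: Fix $T>0$, $l>0$. All spaces are real. Let $\mathbb L^2:=L^2(0,l)\times\mathbb R^2$ with $\langle (y,a,b),(z,c,d)\rangle_{\mathbb L^2}=\langle y,z\rangle_{L^2(0,l)}+ac+bd$, and $\mathbb L^2_T:=L^2((0,T)\times(0,l))\times L^2(0,T)$ with $\langle (y,y_1),(z,z_1)\rangle_{\mathbb L^2_T}=\langle y,z\rangle_{L^2((0,T)\times(0,l))}+\langle y_1,z_1\rangle_{L^2(0,T)}$. For $k=1,2$ let $\mathbb H^k:=\{(u,u(0),u(l)) : u\in H^k(0,l)\}$ with the product norm of $H^k(0,l)\times\mathbb R^2$, and let $\mathcal H_{\mathrm{en}}:=\mathbb H^1\times\mathbb L^2$. Direct problem: for fixed initial data $(Y_0,Y_1)=((y_0,a,b),(y_1,c,d))\in\mathcal H_{\mathrm{en}}$ and a source $\mathcal W=(F,G)\in\mathbb L^2_T$, $Y(t,\cdot,\mathcal W)=(y(t,\cdot),y(t,0),y(t,l))$ denotes the mild solution of $$\begin{cases} y_{tt}-y_{xx}=F(t,x) & \text{in }(0,T)\times(0,l),\\ y_{tt}(t,0)-y_x(t,0)=G(t) & \text{in }(0,T),\\ y_{tt}(t,l)+y_x(t,l)=0 & \text{in }(0,T),\\ (y(0,\cdot),y(0,0),y(0,l))=(y_0,a,b),\quad (y_t(0,\cdot),y_t(0,0),y_t(0,l))=(y_1,c,d).\end{cases}$$ Mild solutions: the operator $\mathcal A=\begin{pmatrix}0&I\\ \mathcal B&0\end{pmatrix}$ with $D(\mathcal A)=\mathbb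 H^2\times\mathbb H^1$ and $\mathcal B(u,u(0),u(l))=(u_{xx},u_x(0),-u_x(l))$, $D(\mathcal B)=\mathbb H^2$, generates a strongly continuous group $(e^{t\mathcal A})_{t\in\mathbb R}$ on $\mathcal H_{\mathrm{en}}$. The mild solution is given by $(Y(t),Y_t(t))=e^{t\mathcal A}(Y_0,Y_1)+\int_0^t e^{(t-s)\mathcal A}(0,0,0,F(s,\cdot),G(s),0)\,ds$; it satisfies $Y\in C([0,T];\mathbb H^1)\cap C^1([0,T];\mathbb L^2)$. Problems with terminal data at $t=T$ are understood in the same way, using the group backward in time. Admissible set: given real constants $F_*\le F^*$, $G_*\le G^*$, $\mathcal U_{\mathrm{ad}}:=\{(F,G)\in\mathbb L^2_T : F_*\le F(t,x)\le F^* \text{ for a.e. }(t,x),\ G_*\le G(t)\le G^*\text{ for a.e. }t\}$. Cost functional: given a (noisy) datum $Y_T^\delta\in\mathbb L^2$, $\mathcal J(\mathcal W):=\frac12\|Y(T,\cdot,\mathcal W)-Y_T^\delta\|_{\mathbb L^2}^2$ for $\mathcal W\in\mathcal U_{\mathrm{ad}}$. That $\mathcal J$ is Fréchet differentiable at $\mathcal W$ with gradient $\mathcal J'(\mathcal W)\in\mathbb L^2_T$ means $\mathcal J(\mathcal W+\delta\mathcal W)-\mathcal J(\mathcal W)=\langle\mathcal J'(\mathcal W),\delta\mathcal W\rangle_{\mathbb L^2_T}+o(\|\delta\mathcal W\|_{\mathbb L^2_T})$ as $\delta\mathcal W\to0$ in $\mathbb L^2_T$ with $\mathcal W+\delta\mathcal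 W\in\mathcal U_{\mathrm{ad}}$. *)

theory Defs
  imports "HOL-Analysis.Analysis"
begin

text \<open>
  The library has no \<open>L\<^sup>2\<close> type.  \<open>'a L2\<close> is the Hilbert space of square-integrable functions on
  the whole Euclidean space \<open>'a\<close> modulo equality almost everywhere; completeness and separability
  are needed for the Bochner integral.
\<close>

definition sq_integrable :: "('a::euclidean_space \<Rightarrow> real) \<Rightarrow> bool" where
  "sq_integrable f \<longleftrightarrow> f \<in> borel_measurable lborel \<and> integrable lborel (\<lambda>x. (f x)\<^sup>2)"

lemma sq_integrable_measurable: "sq_integrable f \<Longrightarrow> f \<in> borel_measurable lborel"
  by (simp add: sq_integrable_def)

lemma sq_integrable_zero [simp]: "sq_integrable (\<lambda>_. 0)"
  by (simp add: sq_integrable_def)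

lemma sq_integrable_mult:
  assumes "sq_integrable f" "sq_integrable g"
  shows "integrable lborel (\<lambda>x. f x * g x)"
proof (rule Bochner_Integration.integrable_bound)
  show "integrable lborel (\<lambda>x. (f x)\<^sup>2 + (g x)\<^sup>2)"
    using assms by (simp add: sq_integrable_def)
  show "(\<lambda>x. f x * g x) \<in> borel_measurable lborel"
    using assms by (auto simp: sq_integrable_def)
  show "AE x in lborel. norm (f x * g x) \<le> norm ((f x)\<^sup>2 + (g x)\<^sup>2)"
  proof (rule AE_I2)
    fix x
    have "2 * (\<bar>f x\<bar> * \<bar>g x\<bar>) \<le> (f x)\<^sup>2 + (g x)\<^sup>2"
      using sum_squares_bound[of "\<bar>f x\<bar>" "\<bar>g x\<bar>"] by simp
    moreover have "0 \<le> \<bar>f x\<bar> * \<bar>g x\<bar>" by simp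
    ultimately have "\<bar>f x\<bar> * \<bar>g x\<bar> \<le> (f x)\<^sup>2 + (g x)\<^sup>2" by linarith
    then show "norm (f x * g x) \<le> norm ((f x)\<^sup>2 + (g x)\<^sup>2)"
      by (simp add: abs_mult)
  qed
qed

lemma sq_integrable_add:
  assumes "sq_integrable f" "sq_integrable g"
  shows "sq_integrable (\<lambda>x. f x + g x)"
proof -
  have "integrable lborel (\<lambda>x. (f x)\<^sup>2 + (g x)\<^sup>2 + 2 * (f x * g x))"
    using assms sq_integrable_mult[OF assms] by (simp add: sq_integrable_def)
  then have "integrable lborel (\<lambda>x. (f x + g x)\<^sup>2)"
    by (simp add: power2_sum mult.assoc)
  with assms show ?thesis by (auto simp: sq_integrable_def)
qed

lemma sq_integrable_cmult:
  assumes "sq_integrable f"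
  shows "sq_integrable (\<lambda>x. c * f x)"
  using assms by (auto simp: sq_integrable_def power_mult_distrib)

lemma sq_integrable_uminus: "sq_integrable f \<Longrightarrow> sq_integrable (\<lambda>x. - f x)"
  by (auto simp: sq_integrable_def)

lemma sq_integrable_diff:
  "sq_integrable f \<Longrightarrow> sq_integrable g \<Longrightarrow> sq_integrable (\<lambda>x. f x - g x)"
  using sq_integrable_add[of f "\<lambda>x. - g x"] sq_integrable_uminus[of g] by simp

quotient_type (overloaded) 'a L2 = "'a::euclidean_space \<Rightarrow> real" / partial:
  "\<lambda>f g. sq_integrable f \<and> sq_integrable g \<and> (AE x in lborel. f x = g x)"
proof (rule part_equivpI)
  show "\<exists>f::'a \<Rightarrow> real. sq_integrable f \<and> sq_integrable f \<and> (AE x in lborel. f x = f x)"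
    by (rule exI[of _ "\<lambda>_. 0"]) simp
  show "symp (\<lambda>f g::'a \<Rightarrow> real. sq_integrable f \<and> sq_integrable g \<and> (AE x in lborel. f x = g x))"
    by (auto simp: symp_def elim: AE_mp)
  show "transp (\<lambda>f g::'a \<Rightarrow> real. sq_integrable f \<and> sq_integrable g \<and> (AE x in lborel. f x = g x))"
    by (rule transpI) (auto elim: AE_mp)
qed

definition to_L2 :: "('a::euclidean_space \<Rightarrow> real) \<Rightarrow> 'a L2" where
  "to_L2 f = abs_L2 (if sq_integrable f then f else (\<lambda>_. 0))"

lemma sq_integrable_rep [simp]: "sq_integrable (rep_L2 u)"
  using Quotient_rep_reflp[OF Quotient_L2, of u] by simp

lemma rep_L2_measurable [measurable]: "rep_L2 u \<in> borel_measurable lborel"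
  by (rule sq_integrable_measurable) simp

lemma rep_to_L2: "sq_integrable f \<Longrightarrow> AE x in lborel. rep_L2 (to_L2 f) x = f x"
  using Quotient_rep_abs[OF Quotient_L2, of f] by (simp add: to_L2_def)

lemma L2_eqI: "AE x in lborel. rep_L2 u x = rep_L2 v x \<Longrightarrow> u = v"
  using Quotient_rel_rep[OF Quotient_L2, of u v] by simp

lemma to_L2_rep [simp]: "to_L2 (rep_L2 u) = u"
  by (simp add: to_L2_def Quotient_abs_rep[OF Quotient_L2])

instantiation L2 :: (euclidean_space) real_inner
begin

definition zero_L2 :: "'a L2" where "0 = to_L2 (\<lambda>_. 0)"
definition plus_L2 :: "'a L2 \<Rightarrow> 'a L2 \<Rightarrow> 'a L2"
  where "u + v = to_L2 (\<lambda>x. rep_L2 u x + rep_L2 v x)"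
definition uminus_L2 :: "'a L2 \<Rightarrow> 'a L2"
  where "- u = to_L2 (\<lambda>x. - rep_L2 u x)"
definition minus_L2 :: "'a L2 \<Rightarrow> 'a L2 \<Rightarrow> 'a L2"
  where "u - v = to_L2 (\<lambda>x. rep_L2 u x - rep_L2 v x)"
definition scaleR_L2 :: "real \<Rightarrow> 'a L2 \<Rightarrow> 'a L2"
  where "c *\<^sub>R u = to_L2 (\<lambda>x. c * rep_L2 u x)"
definition inner_L2 :: "'a L2 \<Rightarrow> 'a L2 \<Rightarrow> real"
  where "(u::'a L2) \<bullet> v = (LINT x|lborel. rep_L2 u x * rep_L2 v x)"
definition norm_L2 :: "'a L2 \<Rightarrow> real" where "norm (u::'a L2) = sqrt (u \<bullet> u)"
definition sgn_L2 :: "'a L2 \<Rightarrow> 'a L2" where "sgn (u::'a L2) = inverse (norm u) *\<^sub>R u"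
definition dist_L2 :: "'a L2 \<Rightarrow> 'a L2 \<Rightarrow> real" where "dist (u::'a L2) v = norm (u - v)"
definition uniformity_L2 :: "('a L2 \<times> 'a L2) filter"
  where "(uniformity::('a L2 \<times> 'a L2) filter) = (INF e\<in>{0<..}. principal {(u::'a L2, v). dist u v < e})"
definition open_L2 :: "'a L2 set \<Rightarrow> bool"
  where "open U \<longleftrightarrow> (\<forall>x\<in>U::'a L2 set. eventually (\<lambda>(x', y). x' = x \<longrightarrow> y \<in> U) uniformity)"

lemma rep_zero: "AE x in lborel. rep_L2 (0::'a L2) x = 0"
  unfolding zero_L2_def by (rule rep_to_L2) simp

lemma rep_plus: "AE x in lborel. rep_L2 (u + v :: 'a L2) x = rep_L2 u x + rep_L2 v x"
  unfolding plus_L2_def by (rule rep_to_L2) (simp add: sq_integrable_add)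

lemma rep_uminus: "AE x in lborel. rep_L2 (- u :: 'a L2) x = - rep_L2 u x"
  unfolding uminus_L2_def by (rule rep_to_L2) (simp add: sq_integrable_uminus)

lemma rep_minus: "AE x in lborel. rep_L2 (u - v :: 'a L2) x = rep_L2 u x - rep_L2 v x"
  unfolding minus_L2_def by (rule rep_to_L2) (simp add: sq_integrable_diff)

lemma rep_scaleR: "AE x in lborel. rep_L2 (c *\<^sub>R u :: 'a L2) x = c * rep_L2 u x"
  unfolding scaleR_L2_def by (rule rep_to_L2) (simp add: sq_integrable_cmult)

instance
proof
  fix u v w :: "'a L2" and c d :: real
  show "u + v + w = u + (v + w)"
    by (rule L2_eqI, use rep_plus[of "u + v" w] rep_plus[of u v] rep_plus[of u "v + w"] rep_plus[of v w] in eventually_elim, simp)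
  show "u + v = v + u"
    by (rule L2_eqI, use rep_plus[of u v] rep_plus[of v u] in eventually_elim, simp)
  show "0 + u = u"
    by (rule L2_eqI, use rep_plus[of 0 u] rep_zero in eventually_elim, simp)
  show "- u + u = 0"
    by (rule L2_eqI, use rep_plus[of "-u" u] rep_uminus[of u] rep_zero in eventually_elim, simp)
  show "u - v = u + - v"
    by (rule L2_eqI, use rep_minus[of u v] rep_plus[of u "- v"] rep_uminus[of v] in eventually_elim, simp)
  show "c *\<^sub>R (u + v) = c *\<^sub>R u + c *\<^sub>R v"
    by (rule L2_eqI, use rep_scaleR[of c "u + v"] rep_plus[of u v] rep_plus[of "c *\<^sub>R u" "c *\<^sub>R v"]
      rep_scaleR[of c u] rep_scaleR[of c v] in eventually_elim, simp add: algebra_simps)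
  show "(c + d) *\<^sub>R u = c *\<^sub>R u + d *\<^sub>R u"
    by (rule L2_eqI, use rep_scaleR[of "c + d" u] rep_plus[of "c *\<^sub>R u" "d *\<^sub>R u"]
      rep_scaleR[of c u] rep_scaleR[of d u] in eventually_elim, simp add: algebra_simps)
  show "c *\<^sub>R d *\<^sub>R u = (c * d) *\<^sub>R u"
    by (rule L2_eqI, use rep_scaleR[of c "d *\<^sub>R u"] rep_scaleR[of d u] rep_scaleR[of "c * d" u] in eventually_elim, simp)
  show "1 *\<^sub>R u = u"
    by (rule L2_eqI, use rep_scaleR[of 1 u] in eventually_elim, simp)
  show "sgn u = scaleR (inverse (norm u)) u" by (rule sgn_L2_def)
  show "dist u v = norm (u - v)" by (rule dist_L2_def)
  show "(uniformity :: ('a L2 \<times> 'a L2) filter) = (INF e\<in>{0<..}. principal {(x, y). dist x y < e})"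
    by (rule uniformity_L2_def)
  show "open U = (\<forall>x\<in>U. \<forall>\<^sub>F (x', y) in uniformity. x' = x \<longrightarrow> y \<in> U)" for U :: "'a L2 set"
    by (rule open_L2_def)
  show "u \<bullet> v = v \<bullet> u"
    by (simp add: inner_L2_def mult.commute)
  have "(u + v) \<bullet> w = (LINT x|lborel. rep_L2 u x * rep_L2 w x + rep_L2 v x * rep_L2 w x)"
    unfolding inner_L2_def
  proof (rule integral_cong_AE)
    show "AE x in lborel. rep_L2 (u + v) x * rep_L2 w x = rep_L2 u x * rep_L2 w x + rep_L2 v x * rep_L2 w x"
      using rep_plus[of u v] by eventually_elim (simp add: algebra_simps)
  qed measurable
  then show "(u + v) \<bullet> w = u \<bullet> w + v \<bullet> w"
    by (simp add: inner_L2_def sq_integrable_mult)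
  have "(c *\<^sub>R u) \<bullet> v = (LINT x|lborel. c * (rep_L2 u x * rep_L2 v x))"
    unfolding inner_L2_def
  proof (rule integral_cong_AE)
    show "AE x in lborel. rep_L2 (c *\<^sub>R u) x * rep_L2 v x = c * (rep_L2 u x * rep_L2 v x)"
      using rep_scaleR[of c u] by eventually_elim simp
  qed measurable
  then show "(c *\<^sub>R u) \<bullet> v = c * (u \<bullet> v)"
    by (simp add: inner_L2_def)
  show "0 \<le> u \<bullet> u"
    unfolding inner_L2_def by (rule integral_nonneg_AE) simp
  have "u \<bullet> u = 0 \<longleftrightarrow> (AE x in lborel. rep_L2 u x * rep_L2 u x = 0)"
    unfolding inner_L2_def
    by (rule integral_nonneg_eq_0_iff_AE) (simp_all add: sq_integrable_mult)
  also have "\<dots> \<longleftrightarrow> u = 0"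
  proof
    assume *: "AE x in lborel. rep_L2 u x * rep_L2 u x = 0"
    show "u = 0"
      by (rule L2_eqI, use * rep_zero in eventually_elim, simp)
  next
    assume "u = 0"
    then show "AE x in lborel. rep_L2 u x * rep_L2 u x = 0"
      using rep_zero by simp
  qed
  finally show "u \<bullet> u = 0 \<longleftrightarrow> u = 0" .
  show "norm u = sqrt (u \<bullet> u)" by (rule norm_L2_def)
qed

end

lemma norm_L2_square: "(norm u)\<^sup>2 = (LINT x|lborel. (rep_L2 u x)\<^sup>2)"
  unfolding power2_norm_eq_inner inner_L2_def by (simp add: power2_eq_square)

lemma norm_to_L2_diff:
  assumes "sq_integrable f"
  shows "(norm (to_L2 f - u))\<^sup>2 = (LINT x|lborel. (f x - rep_L2 u x)\<^sup>2)"
  unfolding norm_L2_square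
proof (rule integral_cong_AE)
  show "AE x in lborel. (rep_L2 (to_L2 f - u) x)\<^sup>2 = (f x - rep_L2 u x)\<^sup>2"
    using rep_minus[of "to_L2 f" u] rep_to_L2[OF assms] by eventually_elim simp
qed (use assms in \<open>auto dest: sq_integrable_measurable\<close>)

lemma to_L2_add:
  assumes "sq_integrable f" "sq_integrable g"
  shows "to_L2 (\<lambda>x. f x + g x) = to_L2 f + to_L2 g"
  by (rule L2_eqI, use rep_to_L2[OF assms(1)] rep_to_L2[OF assms(2)] rep_to_L2[OF sq_integrable_add[OF assms]]
    rep_plus[of "to_L2 f" "to_L2 g"] in eventually_elim, simp)

lemma to_L2_cmult:
  assumes "sq_integrable f"
  shows "to_L2 (\<lambda>x. c * f x) = c *\<^sub>R to_L2 f"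
  by (rule L2_eqI, use rep_to_L2[OF assms(1)] rep_to_L2[OF sq_integrable_cmult[OF assms]]
    rep_scaleR[of c "to_L2 f"] in eventually_elim, simp)

lemma L2_limit_AE_summable:
  fixes d :: "nat \<Rightarrow> 'a::euclidean_space L2"
  assumes d: "\<And>k. norm (d k) \<le> (1/4) ^ k"
  shows "AE x in lborel. summable (\<lambda>k. rep_L2 (d k) x)"
proof -
  let ?f = "\<lambda>k x. ennreal (4 ^ k * (rep_L2 (d k) x)\<^sup>2)"
  have le: "(\<integral>\<^sup>+x. ?f k x \<partial>lborel) \<le> ennreal ((1/4) ^ k)" for k
  proof -
    have i: "integrable lborel (\<lambda>x. 4 ^ k * (rep_L2 (d k) x)\<^sup>2)"
      using sq_integrable_rep[of "d k"] by (simp add: sq_integrable_def)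
    have "(\<integral>\<^sup>+x. ?f k x \<partial>lborel) = ennreal (LINT x|lborel. 4 ^ k * (rep_L2 (d k) x)\<^sup>2)"
      by (rule nn_integral_eq_integral[OF i]) simp
    also have "(LINT x|lborel. 4 ^ k * (rep_L2 (d k) x)\<^sup>2) = 4 ^ k * (norm (d k))\<^sup>2"
      by (simp add: norm_L2_square)
    also have "ennreal \<dots> \<le> ennreal ((1/4) ^ k)"
    proof (rule ennreal_leI)
      have "(norm (d k))\<^sup>2 \<le> ((1/4) ^ k)\<^sup>2"
        by (rule power_mono[OF d]) simp
      then have "4 ^ k * (norm (d k))\<^sup>2 \<le> 4 ^ k * ((1/4) ^ k)\<^sup>2" by simp
      also have "\<dots> = (1/4) ^ k"
        by (simp add: power2_eq_square power_one_over field_simps)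
      finally show "4 ^ k * (norm (d k))\<^sup>2 \<le> (1/4) ^ k" .
    qed
    finally show ?thesis .
  qed
  have "(\<integral>\<^sup>+x. (\<Sum>k. ?f k x) \<partial>lborel) = (\<Sum>k. \<integral>\<^sup>+x. ?f k x \<partial>lborel)"
    by (rule nn_integral_suminf) measurable
  also have "\<dots> \<le> (\<Sum>k. ennreal ((1/4) ^ k))"
    by (rule suminf_le) (auto intro: le)
  also have "\<dots> = ennreal (\<Sum>k. (1/4) ^ k)"
    by (rule suminf_ennreal2) (auto intro!: summable_geometric)
  also have "\<dots> < \<infinity>" by simp
  finally have "(\<integral>\<^sup>+x. (\<Sum>k. ?f k x) \<partial>lborel) \<noteq> \<infinity>"
    by (rule less_imp_neq)
  then have "AE x in lborel. (\<Sum>k. ?f k x) \<noteq> \<infinity>"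
    by (rule nn_integral_PInf_AE[rotated]) measurable
  then show ?thesis
  proof eventually_elim
    fix x assume fin: "(\<Sum>k. ?f k x) \<noteq> \<infinity>"
    define s where "s = (\<Sum>k. ?f k x)"
    have "s \<noteq> \<infinity>" using fin unfolding s_def .
    then obtain C where C: "s = ennreal C" "0 \<le> C"
      by (cases s) auto
    have "4 ^ k * (rep_L2 (d k) x)\<^sup>2 \<le> C" for k
    proof -
      have "sum (\<lambda>k. ?f k x) {k} \<le> s"
        unfolding s_def by (rule sum_le_suminf) (auto intro: summableI)
      then have "?f k x \<le> ennreal C" unfolding C(1) by simp
      then show ?thesis using C(2) by (subst (asm) ennreal_le_iff)
    qed
    moreover have "(2 ^ k * rep_L2 (d k) x)\<^sup>2 = 4 ^ k * (rep_L2 (d k) x)\<^sup>2" for k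
    proof -
      have "((2::real) ^ k)\<^sup>2 = (2 * 2) ^ k" by (simp only: power2_eq_square power_mult_distrib)
      then show ?thesis by (simp add: power_mult_distrib)
    qed
    ultimately have "(2 ^ k * rep_L2 (d k) x)\<^sup>2 \<le> (sqrt C)\<^sup>2" for k
      using C(2) by simp
    then have b: "\<bar>2 ^ k * rep_L2 (d k) x\<bar> \<le> sqrt C" for k
      using C(2) abs_le_square_iff[of "2 ^ k * rep_L2 (d k) x" "sqrt C"] by simp
    show "summable (\<lambda>k. rep_L2 (d k) x)"
    proof (rule summable_comparison_test)
      show "summable (\<lambda>k. sqrt C * (1/2) ^ k)"
        by (intro summable_mult summable_geometric) simp
      show "\<exists>N. \<forall>n\<ge>N. norm (rep_L2 (d n) x) \<le> sqrt C * (1/2) ^ n"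
        using b by (auto simp: abs_mult power_one_over field_simps)
    qed
  qed
qed

instance L2 :: (euclidean_space) banach
proof
  fix X :: "nat \<Rightarrow> 'a L2"
  assume X: "Cauchy X"
  have "\<exists>M. \<forall>m\<ge>M. \<forall>n\<ge>M. dist (X m) (X n) < (1/4) ^ k" for k :: nat
    using X by (simp add: Cauchy_def)
  then obtain M where M: "\<And>k m n. m \<ge> M k \<Longrightarrow> n \<ge> M k \<Longrightarrow> dist (X m) (X n) < (1/4) ^ k"
    by metis
  define r where "r k = k + Max (M ` {..k})" for k
  have r_ge: "r k \<ge> M j" if "j \<le> k" for j k
    unfolding r_def using that by (intro trans_le_add2 Max_ge) auto
  have r_sm: "strict_mono r"
    unfolding strict_mono_Suc_iff
  proof
    fix n
    have "Max (M ` {..n}) \<le> Max (M ` {..Suc n})" by (rule Max_mono) auto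
    then show "r n < r (Suc n)" unfolding r_def by linarith
  qed
  define d where "d k = X (r (Suc k)) - X (r k)" for k
  have "norm (d k) \<le> (1/4) ^ k" for k
    using M[of k "r (Suc k)" "r k"] r_ge[of k k] r_ge[of k "Suc k"]
    by (simp add: d_def dist_norm)
  then have sm: "AE x in lborel. summable (\<lambda>k. rep_L2 (d k) x)"
    by (rule L2_limit_AE_summable)
  define g where "g k = rep_L2 (X (r k))" for k
  have g_meas [measurable]: "g k \<in> borel_measurable lborel" for k
    unfolding g_def by measurable
  have "AE x in lborel. \<forall>k. rep_L2 (d k) x = g (Suc k) x - g k x"
    unfolding AE_all_countable d_def g_def using rep_minus by blast
  with sm have conv: "AE x in lborel. convergent (\<lambda>k. g k x)"
  proof eventually_elim
    fix x
    assume "summable (\<lambda>k. rep_L2 (d k) x)" "\<forall>k. rep_L2 (d k) x = g (Suc k) x - g k x"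
    then have "summable (\<lambda>k. g (Suc k) x - g k x)" by simp
    then have "convergent (\<lambda>n. \<Sum>k<n. g (Suc k) x - g k x)"
      by (simp add: summable_iff_convergent)
    then have "convergent (\<lambda>n. g n x - g 0 x)"
      by (simp only: sum_lessThan_telescope[of "\<lambda>k. g k x"])
    then have "convergent (\<lambda>n. g n x - g 0 x + g 0 x)"
      by (intro convergent_add convergent_const)
    then show "convergent (\<lambda>k. g k x)" by simp
  qed
  define f where "f x = lim (\<lambda>k. g k x)" for x
  have f_meas [measurable]: "f \<in> borel_measurable lborel"
    unfolding f_def by measurable
  have key: "(\<integral>\<^sup>+x. ennreal ((f x - g n x)\<^sup>2) \<partial>lborel) \<le> ennreal (((1/4) ^ n)\<^sup>2)" for n
  proof -
    have "(\<integral>\<^sup>+x. ennreal ((f x - g n x)\<^sup>2) \<partial>lborel)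
        = (\<integral>\<^sup>+x. liminf (\<lambda>m. ennreal ((g m x - g n x)\<^sup>2)) \<partial>lborel)"
    proof (rule nn_integral_cong_AE)
      show "AE x in lborel. ennreal ((f x - g n x)\<^sup>2) = liminf (\<lambda>m. ennreal ((g m x - g n x)\<^sup>2))"
        using conv
      proof eventually_elim
        fix x assume "convergent (\<lambda>k. g k x)"
        then have "(\<lambda>k. g k x) \<longlonglongrightarrow> f x" by (simp add: f_def convergent_LIMSEQ_iff)
        then have "(\<lambda>m. ennreal ((g m x - g n x)\<^sup>2)) \<longlonglongrightarrow> ennreal ((f x - g n x)\<^sup>2)"
          by (intro tendsto_intros)
        then show "ennreal ((f x - g n x)\<^sup>2) = liminf (\<lambda>m. ennreal ((g m x - g n x)\<^sup>2))"
          by (intro lim_imp_Liminf[symmetric]) simp_all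
      qed
    qed
    also have "\<dots> \<le> liminf (\<lambda>m. \<integral>\<^sup>+x. ennreal ((g m x - g n x)\<^sup>2) \<partial>lborel)"
      by (rule nn_integral_liminf) measurable
    also have "\<dots> \<le> liminf (\<lambda>m. ennreal (((1/4) ^ n)\<^sup>2))"
    proof (rule Liminf_mono)
      show "\<forall>\<^sub>F m in sequentially. (\<integral>\<^sup>+x. ennreal ((g m x - g n x)\<^sup>2) \<partial>lborel) \<le> ennreal (((1/4) ^ n)\<^sup>2)"
        unfolding eventually_sequentially
      proof (intro exI[of _ n] allI impI)
        fix m assume "n \<le> m"
        have i: "integrable lborel (\<lambda>x. (g m x - g n x)\<^sup>2)"
          using sq_integrable_diff[OF sq_integrable_rep sq_integrable_rep, of "X (r m)" "X (r n)"]
          unfolding g_def sq_integrable_def by blast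
        have "(\<integral>\<^sup>+x. ennreal ((g m x - g n x)\<^sup>2) \<partial>lborel) = ennreal ((norm (X (r m) - X (r n)))\<^sup>2)"
          using nn_integral_eq_integral[OF i] norm_to_L2_diff[of "g m" "X (r n)"]
          by (simp add: g_def)
        also have "\<dots> \<le> ennreal (((1/4) ^ n)\<^sup>2)"
          using M[of n "r m" "r n"] r_ge[of n n] r_ge[of n m] \<open>n \<le> m\<close>
          by (intro ennreal_leI power_mono) (simp_all add: dist_norm)
        finally show "(\<integral>\<^sup>+x. ennreal ((g m x - g n x)\<^sup>2) \<partial>lborel) \<le> ennreal (((1/4) ^ n)\<^sup>2)" .
      qed
    qed
    also have "\<dots> = ennreal (((1/4) ^ n)\<^sup>2)" by (rule Liminf_const) simp
    finally show ?thesis .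
  qed
  have sqd: "sq_integrable (\<lambda>x. f x - g n x)" for n
  proof -
    have "(\<integral>\<^sup>+x. ennreal (norm ((f x - g n x)\<^sup>2)) \<partial>lborel) < \<infinity>"
      using key[of n] by (auto intro: le_less_trans)
    then have "integrable lborel (\<lambda>x. (f x - g n x)\<^sup>2)"
      by (intro integrableI_bounded) auto
    then show ?thesis by (simp add: sq_integrable_def)
  qed
  have "sq_integrable (\<lambda>x. (f x - g 0 x) + g 0 x)"
    by (rule sq_integrable_add[OF sqd]) (simp add: g_def)
  then have sqf: "sq_integrable f" by simp
  have bound: "norm (X (r n) - to_L2 f) \<le> (1/4) ^ n" for n
  proof -
    have "ennreal ((norm (to_L2 f - X (r n)))\<^sup>2) = (\<integral>\<^sup>+x. ennreal ((f x - g n x)\<^sup>2) \<partial>lborel)"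
      using nn_integral_eq_integral[of lborel "\<lambda>x. (f x - g n x)\<^sup>2"] sqd[of n]
      by (simp add: norm_to_L2_diff[OF sqf] sq_integrable_def g_def)
    also have "\<dots> \<le> ennreal (((1/4) ^ n)\<^sup>2)" by (rule key)
    finally have "(norm (to_L2 f - X (r n)))\<^sup>2 \<le> ((1/4) ^ n)\<^sup>2"
      by (simp add: ennreal_le_iff)
    then have "norm (to_L2 f - X (r n)) \<le> (1/4) ^ n"
      by (rule power2_le_imp_le) simp
    then show ?thesis by (simp add: norm_minus_commute)
  qed
  have "(\<lambda>n. X (r n) - to_L2 f) \<longlonglongrightarrow> 0"
  proof (rule Lim_null_comparison)
    show "\<forall>\<^sub>F n in sequentially. norm (X (r n) - to_L2 f) \<le> (1/4) ^ n"
      using bound by simp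
    show "(\<lambda>n. (1/4) ^ n :: real) \<longlonglongrightarrow> 0"
      by (rule LIMSEQ_power_zero) simp
  qed
  then have "(X \<circ> r) \<longlonglongrightarrow> to_L2 f"
    by (simp add: LIM_zero_iff o_def)
  with X r_sm have "X \<longlonglongrightarrow> to_L2 f"
    using Cauchy_converges_subseq by blast
  then show "convergent X" by (rule convergentI)
qed

lemma to_L2_dominated_convergence:
  fixes f :: "'a::euclidean_space \<Rightarrow> real"
  assumes w: "sq_integrable w"
    and [measurable]: "\<And>m. s m \<in> borel_measurable lborel" "f \<in> borel_measurable lborel"
    and lim: "\<And>x. (\<lambda>m. s m x) \<longlonglongrightarrow> f x"
    and bd: "\<And>m x. \<bar>s m x\<bar> \<le> w x"
  shows "(\<lambda>m. to_L2 (s m)) \<longlonglongrightarrow> to_L2 f"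
proof -
  have bdf: "\<bar>f x\<bar> \<le> w x" for x
    by (rule LIMSEQ_le_const2[OF tendsto_rabs[OF lim]]) (use bd in auto)
  have w2: "integrable lborel (\<lambda>x. (w x)\<^sup>2)" using w by (simp add: sq_integrable_def)
  have dom: "sq_integrable h" if "h \<in> borel_measurable lborel" "\<And>x. \<bar>h x\<bar> \<le> w x" for h
    unfolding sq_integrable_def
  proof (intro conjI that(1) Bochner_Integration.integrable_bound[OF w2])
    show "AE x in lborel. norm ((h x)\<^sup>2) \<le> norm ((w x)\<^sup>2)"
      using that(2) by (intro AE_I2) (metis abs_le_square_iff abs_ge_self order_trans power2_abs real_norm_def abs_power2)
  qed (use that(1) in measurable)
  have ss: "sq_integrable (s m)" for m by (rule dom) (auto intro: bd)
  have sf: "sq_integrable f" by (rule dom) (auto intro: bdf)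
  have "(\<lambda>m. LINT x|lborel. (s m x - f x)\<^sup>2) \<longlonglongrightarrow> (LINT x::'a|lborel. 0)"
  proof (rule integral_dominated_convergence)
    show "integrable lborel (\<lambda>x. 4 * (w x)\<^sup>2)" using w2 by simp
    show "AE x in lborel. (\<lambda>m. (s m x - f x)\<^sup>2) \<longlonglongrightarrow> 0"
    proof (rule AE_I2)
      fix x
      have "(\<lambda>m. (s m x - f x)\<^sup>2) \<longlonglongrightarrow> (f x - f x)\<^sup>2"
        by (intro tendsto_intros lim)
      then show "(\<lambda>m. (s m x - f x)\<^sup>2) \<longlonglongrightarrow> 0" by simp
    qed
    show "AE x in lborel. norm ((s m x - f x)\<^sup>2) \<le> 4 * (w x)\<^sup>2" for m
    proof (rule AE_I2)
      fix x
      have "\<bar>s m x - f x\<bar> \<le> \<bar>2 * w x\<bar>" using bd[of m x] bdf[of x] by linarith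
      then have "(s m x - f x)\<^sup>2 \<le> (2 * w x)\<^sup>2" by (rule abs_le_square_iff[THEN iffD1])
      then show "norm ((s m x - f x)\<^sup>2) \<le> 4 * (w x)\<^sup>2" by (simp add: power_mult_distrib)
    qed
  qed measurable
  moreover have "(LINT x|lborel. (s m x - f x)\<^sup>2) = (norm (to_L2 (s m) - to_L2 f))\<^sup>2" for m
    unfolding norm_to_L2_diff[OF ss]
  proof (rule integral_cong_AE)
    show "AE x in lborel. (s m x - f x)\<^sup>2 = (s m x - rep_L2 (to_L2 f) x)\<^sup>2"
      using rep_to_L2[OF sf] by eventually_elim simp
  qed measurable
  ultimately have "(\<lambda>m. sqrt ((norm (to_L2 (s m) - to_L2 f))\<^sup>2)) \<longlonglongrightarrow> sqrt 0"
    by (intro tendsto_real_sqrt) simp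
  then have "(\<lambda>m. to_L2 (s m) - to_L2 f) \<longlonglongrightarrow> 0"
    by (simp add: tendsto_norm_zero_iff)
  then show ?thesis by (simp add: LIM_zero_iff)
qed

lemma sq_integrable_indicator:
  assumes [measurable]: "A \<in> sets borel" and A: "A \<subseteq> cball (0::'a::euclidean_space) r"
  shows "sq_integrable (indicator A)"
proof -
  have "emeasure lborel A \<le> emeasure lborel (cball (0::'a) r)"
    using A by (intro emeasure_mono) auto
  also have "\<dots> < \<infinity>" by (rule emeasure_lborel_cball_finite)
  finally have "integrable lborel (indicator A :: 'a \<Rightarrow> real)" by simp
  moreover have "(\<lambda>x. (indicator A x :: real)\<^sup>2) = indicator A"
    by (auto simp: indicator_def)
  ultimately show ?thesis by (simp add: sq_integrable_def)
qed

lemma subspace_closure: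
  fixes S :: "'a::real_normed_vector set"
  assumes "subspace S"
  shows "subspace (closure S)"
  unfolding subspace_def
proof (intro conjI ballI allI)
  show "0 \<in> closure S" using subspace_0[OF assms] closure_subset by blast
next
  fix x y assume "x \<in> closure S" "y \<in> closure S"
  then obtain f g where "\<forall>n. f n \<in> S" "f \<longlonglongrightarrow> x" "\<forall>n. g n \<in> S" "g \<longlonglongrightarrow> y"
    unfolding closure_sequential by blast
  then show "x + y \<in> closure S" unfolding closure_sequential
    by (intro exI[of _ "\<lambda>n. f n + g n"]) (auto intro: subspace_add[OF assms] tendsto_add)
next
  fix c x assume "x \<in> closure S"
  then obtain f where "\<forall>n. f n \<in> S" "f \<longlonglongrightarrow> x"
    unfolding closure_sequential by blast
  then show "c *\<^sub>R x \<in> closure S" unfolding closure_sequential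
    by (intro exI[of _ "\<lambda>n. c *\<^sub>R f n"]) (auto intro: subspace_scale[OF assms] tendsto_intros)
qed

lemma L2_total_sequence:
  "\<exists>D::'a::euclidean_space L2 set. countable D \<and> D \<noteq> {} \<and> closure (span D) = UNIV"
proof -
  obtain B :: "'a set set" where B: "countable B" "topological_basis B"
    using ex_countable_basis by blast
  define E where "E = Inter ` {b. finite b \<and> b \<subseteq> B}"
  have cE: "countable E"
    unfolding E_def using B(1) by (intro countable_image countable_Collect_finite_subset)
  have EI: "Int_stable E"
  proof (rule Int_stableI)
    fix a b assume "a \<in> E" "b \<in> E"
    then obtain s t where "finite s" "s \<subseteq> B" "a = \<Inter>s" "finite t" "t \<subseteq> B" "b = \<Inter>t"
      by (auto simp: E_def)
    then have "a \<inter> b = \<Inter>(s \<union> t)" "finite (s \<union> t)" "s \<union> t \<subseteq> B" by auto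
    then show "a \<inter> b \<in> E" unfolding E_def by blast
  qed
  have opB: "b \<in> B \<Longrightarrow> open b" for b using B(2) topological_basis_open by blast
  have opE: "e \<in> E \<Longrightarrow> open e" for e unfolding E_def by (auto intro: opB)
  have BE: "B \<subseteq> E"
  proof
    fix b assume "b \<in> B"
    then have "b = \<Inter>{b}" "finite {b}" "{b} \<subseteq> B" by auto
    then show "b \<in> E" unfolding E_def by blast
  qed
  have UE: "UNIV \<in> E" unfolding E_def by (rule image_eqI[of _ _ "{}"]) auto
  have bor: "sets (borel :: 'a measure) = sigma_sets UNIV E"
  proof
    have "sets (borel::'a measure) = sigma_sets UNIV B"
      unfolding borel_eq_countable_basis[OF B] by (rule sets_measure_of) simp
    also have "\<dots> \<subseteq> sigma_sets UNIV E" by (rule sigma_sets_mono') (rule BE)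
    finally show "sets (borel::'a measure) \<subseteq> sigma_sets UNIV E" .
    show "sigma_sets UNIV E \<subseteq> sets (borel::'a measure)"
    proof -
      have "E \<subseteq> sets (borel::'a measure)" using opE by auto
      then show ?thesis using sets.sigma_sets_subset[of E "borel::'a measure"] by simp
    qed
  qed
  define K where "K n = cball (0::'a) (real n)" for n
  define D where "D = (\<lambda>(n, e). to_L2 (indicator (e \<inter> K n) :: 'a \<Rightarrow> real)) ` (UNIV \<times> E)"
  define V where "V = closure (span D)"
  have subV: "subspace V" unfolding V_def by (intro subspace_closure subspace_span)
  have clV: "closed V" unfolding V_def by simp
  have DV: "D \<subseteq> V" unfolding V_def using span_superset closure_subset by blast
  have Kb [measurable]: "K n \<in> sets borel" for n by (simp add: K_def)
  have sqK: "sq_integrable (indicator (A \<inter> K n))" if "A \<in> sets borel" for A n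
    using that by (intro sq_integrable_indicator[of _ "real n"]) (auto simp: K_def)
  have ind: "to_L2 (indicator (A \<inter> K n)) \<in> V" if "A \<in> sets borel" for A n
  proof -
    have "A \<in> sigma_sets UNIV E" using that by (simp add: bor)
    moreover have "E \<subseteq> Pow UNIV" by simp
    moreover note EI
    ultimately have "Int_stable E" "E \<subseteq> Pow UNIV" "A \<in> sigma_sets UNIV E" by auto
    then show ?thesis
    proof (induction rule: sigma_sets_induct_disjoint)
      case (basic A)
      then show ?case using DV by (auto simp: D_def)
    next
      case empty
      have "indicator ({} \<inter> K n) = (\<lambda>_::'a. 0::real)" by auto
      then show ?case using subspace_0[OF subV] by (simp add: zero_L2_def)
    next
      case (compl A)
      then have A [measurable]: "A \<in> sets borel" by (simp add: bor)
      have "indicator ((UNIV - A) \<inter> K n) = (\<lambda>x::'a. indicator (UNIV \<inter> K n) x + (-1) * indicator (A \<inter> K n) x :: real)"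
        by (auto simp: indicator_def fun_eq_iff)
      then have "to_L2 (indicator ((UNIV - A) \<inter> K n) :: 'a \<Rightarrow> real)
          = to_L2 (indicator (UNIV \<inter> K n)) + (-1) *\<^sub>R to_L2 (indicator (A \<inter> K n))"
        using to_L2_add[OF sqK[of UNIV n] sq_integrable_cmult[OF sqK[OF A, of n], of "-1"]]
          to_L2_cmult[OF sqK[OF A, of n], of "-1"] by simp
      moreover have "to_L2 (indicator (UNIV \<inter> K n)) \<in> V"
        using DV UE unfolding D_def by blast
      ultimately show ?case
        using compl.IH subV by (simp add: subspace_add subspace_scale subspace_diff)
    next
      case (union A)
      then have A [measurable]: "\<And>i. A i \<in> sets borel" by (simp add: bor image_subset_iff)
      define s where "s m = (\<lambda>x. \<Sum>i<m. indicator (A i \<inter> K n) x :: real)" for m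
      have s: "s m = indicator ((\<Union>i<m. A i) \<inter> K n)" for m
      proof (induction m)
        case (Suc m)
        have "A m \<inter> A i = {}" if "i < m" for i
          using union.hyps(1) that by (simp add: disjoint_family_on_def)
        then have "A m \<inter> (\<Union>i<m. A i) = {}" by blast
        then have "indicator ((\<Union>i<m. A i) \<inter> K n) x + indicator (A m \<inter> K n) x
            = (indicator ((\<Union>i<Suc m. A i) \<inter> K n) x :: real)" for x
          by (auto simp only: lessThan_Suc UN_insert split: split_indicator)
        moreover have "s (Suc m) = (\<lambda>x. s m x + indicator (A m \<inter> K n) x)"
          by (simp add: s_def)
        ultimately show ?case using Suc by (simp only:)
      qed (auto simp: s_def fun_eq_iff)
      have sV: "to_L2 (s m) \<in> V \<and> sq_integrable (s m)" for m
      proof (induction m)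
        case 0
        then show ?case using subspace_0[OF subV] by (simp add: s_def zero_L2_def)
      next
        case (Suc m)
        have "s (Suc m) = (\<lambda>x. s m x + indicator (A m \<inter> K n) x)" by (auto simp: s_def)
        then show ?case
          using Suc to_L2_add[of "s m" "indicator (A m \<inter> K n)"] sqK[OF A, of m n] union.IH[of m] subV
          by (simp add: sq_integrable_add subspace_add)
      qed
      have "(\<lambda>m. to_L2 (s m)) \<longlonglongrightarrow> to_L2 (indicator ((\<Union>i. A i) \<inter> K n))"
      proof (rule to_L2_dominated_convergence[OF sqK[of UNIV n]])
        show "(\<lambda>m. s m x) \<longlonglongrightarrow> indicator ((\<Union>i. A i) \<inter> K n) x" for x
        proof -
          have "(\<lambda>m. indicator (\<Union>i<m. A i \<inter> K n) x :: real) \<longlonglongrightarrow> indicator (\<Union>i. A i \<inter> K n) x"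
            by (rule LIMSEQ_indicator_UN)
          moreover have "(\<Union>i<m. A i \<inter> K n) = (\<Union>i<m. A i) \<inter> K n" for m by blast
          moreover have "(\<Union>i. A i \<inter> K n) = (\<Union>i. A i) \<inter> K n" by blast
          ultimately show ?thesis unfolding s by (simp only:)
        qed
        show "\<bar>s m x\<bar> \<le> indicator (UNIV \<inter> K n) x" for m x
          unfolding s by (auto simp: indicator_def)
        show "s m \<in> borel_measurable lborel" for m unfolding s by measurable
        show "indicator ((\<Union>i. A i) \<inter> K n) \<in> borel_measurable lborel" by measurable
      qed simp
      then show ?case by (rule closed_sequentially[OF clV, rotated]) (use sV in blast)
    qed
  qed
  have simpleV: "to_L2 (\<lambda>x. s x * indicator (K n) x) \<in> V"
    if s: "simple_function lborel s" for s :: "'a \<Rightarrow> real" and n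
  proof -
    have fin: "finite (range s)" using s by (simp add: simple_function_def)
    have m: "s -` {y} \<in> sets borel" if "y \<in> range s" for y
      using s that by (auto simp: simple_function_def)
    have "to_L2 (\<lambda>x. \<Sum>y\<in>R. y * indicator (s -` {y} \<inter> K n) x) \<in> V
       \<and> sq_integrable (\<lambda>x. \<Sum>y\<in>R. y * indicator (s -` {y} \<inter> K n) x)"
      if "finite R" "R \<subseteq> range s" for R
      using that
    proof (induction R)
      case empty
      then show ?case using subspace_0[OF subV] by (simp add: zero_L2_def)
    next
      case (insert y R)
      have sq: "sq_integrable (indicator (s -` {y} \<inter> K n))"
        using insert.prems by (intro sqK m) auto
      let ?g = "\<lambda>x. \<Sum>y\<in>R. y * indicator (s -` {y} \<inter> K n) x"
      have g: "to_L2 ?g \<in> V" "sq_integrable ?g" using insert.IH insert.prems by auto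
      have "(\<lambda>x. \<Sum>y\<in>insert y R. y * indicator (s -` {y} \<inter> K n) x)
          = (\<lambda>x. y * indicator (s -` {y} \<inter> K n) x + ?g x)"
        by (rule ext) (rule sum.insert[OF insert.hyps])
      moreover have "to_L2 (\<lambda>x. y * indicator (s -` {y} \<inter> K n) x + ?g x)
          = y *\<^sub>R to_L2 (indicator (s -` {y} \<inter> K n)) + to_L2 ?g"
        by (simp only: to_L2_add[OF sq_integrable_cmult[OF sq] g(2)] to_L2_cmult[OF sq])
      moreover have "to_L2 (indicator (s -` {y} \<inter> K n)) \<in> V"
        using insert.prems by (intro ind m) auto
      ultimately show ?case
        using sq_integrable_add[OF sq_integrable_cmult[OF sq] g(2)]
          subspace_add[OF subV subspace_scale[OF subV] g(1)] by (simp only: simp_thms)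
    qed
    from this[OF fin subset_refl]
    have "to_L2 (\<lambda>x. \<Sum>y\<in>range s. y * indicator (s -` {y} \<inter> K n) x) \<in> V" ..
    moreover have "(\<Sum>y\<in>range s. y * indicator (s -` {y} \<inter> K n) x) = s x * indicator (K n) x" for x
    proof -
      have "(\<Sum>y\<in>range s. y * indicator (s -` {y} \<inter> K n) x)
          = (\<Sum>y\<in>range s. if y = s x then s x * indicator (K n) x else 0)"
        by (rule sum.cong) (auto simp: indicator_def)
      then show ?thesis using fin by simp
    qed
    ultimately show ?thesis by simp
  qed
  have "u \<in> V" for u
  proof -
    obtain s where s: "\<And>i. simple_function lborel (s i)"
      "\<And>x. (\<lambda>i. s i x) \<longlonglongrightarrow> rep_L2 u x" "\<And>i x. \<bar>s i x\<bar> \<le> 2 * \<bar>rep_L2 u x\<bar>"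
      using borel_measurable_implies_sequence_metric[OF rep_L2_measurable[of u], of 0]
      by (auto simp: dist_real_def)
    have "(\<lambda>n. to_L2 (\<lambda>x. s n x * indicator (K n) x)) \<longlonglongrightarrow> to_L2 (rep_L2 u)"
    proof (rule to_L2_dominated_convergence)
      have "sq_integrable (\<lambda>x. \<bar>rep_L2 u x\<bar>)"
        using sq_integrable_rep[of u] by (auto simp: sq_integrable_def)
      then show "sq_integrable (\<lambda>x. 2 * \<bar>rep_L2 u x\<bar>)" by (rule sq_integrable_cmult)
      show "(\<lambda>x. s n x * indicator (K n) x) \<in> borel_measurable lborel" for n
        using borel_measurable_simple_function[OF s(1)[of n]] by measurable
      show "(\<lambda>n. s n x * indicator (K n) x) \<longlonglongrightarrow> rep_L2 u x" for x
      proof -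
        obtain N where N: "norm x \<le> real N" using real_arch_simple by blast
        then have "\<forall>\<^sub>F n in sequentially. s n x = s n x * indicator (K n) x"
          unfolding eventually_sequentially K_def by (intro exI[of _ N]) (auto simp: indicator_def)
        then show ?thesis by (rule Lim_transform_eventually[OF s(2)])
      qed
      show "\<bar>s n x * indicator (K n) x\<bar> \<le> 2 * \<bar>rep_L2 u x\<bar>" for n x
        using s(3)[of n x] by (auto simp: indicator_def)
    qed simp
    then have "(\<lambda>n. to_L2 (\<lambda>x. s n x * indicator (K n) x)) \<longlonglongrightarrow> u" by simp
    then show ?thesis by (rule closed_sequentially[OF clV, rotated]) (rule simpleV[OF s(1)])
  qed
  then have "closure (span D) = UNIV" by (auto simp: V_def)
  moreover have "countable D" unfolding D_def using cE by (intro countable_image countable_SIGMA) auto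
  moreover have "D \<noteq> {}" unfolding D_def using UE by auto
  ultimately show ?thesis by blast
qed

instance L2 :: (euclidean_space) second_countable_topology
proof
  obtain D :: "'a L2 set" where D: "countable D" "D \<noteq> {}" "closure (span D) = UNIV"
    using L2_total_sequence by blast
  define comb where "comb xs = (\<Sum>(q, d)\<leftarrow>xs. real_of_rat q *\<^sub>R d)" for xs :: "(rat \<times> 'a L2) list"
  define Q where "Q = comb ` lists (UNIV \<times> D)"
  have cQ: "countable Q" unfolding Q_def using D(1)
    by (intro countable_image countable_lists countable_SIGMA) auto
  have Qadd: "x + y \<in> Q" if "x \<in> Q" "y \<in> Q" for x y
  proof -
    from that obtain xs ys where "x = comb xs" "y = comb ys" "xs \<in> lists (UNIV \<times> D)" "ys \<in> lists (UNIV \<times> D)"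
      unfolding Q_def by blast
    then have "x + y = comb (xs @ ys)" "xs @ ys \<in> lists (UNIV \<times> D)" by (auto simp: comb_def)
    then show ?thesis unfolding Q_def by blast
  qed
  have Qscale: "real_of_rat r *\<^sub>R x \<in> Q" if "x \<in> Q" for r x
  proof -
    from that obtain xs where xs: "x = comb xs" "xs \<in> lists (UNIV \<times> D)"
      unfolding Q_def by blast
    have "real_of_rat r *\<^sub>R comb zs = comb (map (\<lambda>(q, d). (r * q, d)) zs)" for zs
      by (induction zs) (auto simp: comb_def scaleR_add_right of_rat_mult)
    moreover have "map (\<lambda>(q, d). (r * q, d)) xs \<in> lists (UNIV \<times> D)" using xs(2) by auto
    ultimately show ?thesis unfolding Q_def xs(1) by blast
  qed
  have "subspace (closure Q)"
    unfolding subspace_def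
  proof (intro conjI ballI allI)
    have "comb [] \<in> Q" unfolding Q_def by (rule imageI) simp
    then show "0 \<in> closure Q" using closure_subset by (auto simp: comb_def)
  next
    fix x y assume "x \<in> closure Q" "y \<in> closure Q"
    then obtain f g where "\<forall>n. f n \<in> Q" "f \<longlonglongrightarrow> x" "\<forall>n. g n \<in> Q" "g \<longlonglongrightarrow> y"
      unfolding closure_sequential by blast
    then show "x + y \<in> closure Q" unfolding closure_sequential
      by (intro exI[of _ "\<lambda>n. f n + g n"]) (auto intro: Qadd tendsto_add)
  next
    fix c x assume "x \<in> closure Q"
    then obtain f where f: "\<forall>n. f n \<in> Q" "f \<longlonglongrightarrow> x"
      unfolding closure_sequential by blast
    have "\<exists>q. \<bar>real_of_rat q - c\<bar> < 1 / real (Suc n)" for n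
    proof -
      obtain q where "c < real_of_rat q" "real_of_rat q < c + 1 / real (Suc n)"
        using of_rat_dense[of c "c + 1 / real (Suc n)"] by auto
      then have "\<bar>real_of_rat q - c\<bar> < 1 / real (Suc n)" by linarith
      then show ?thesis ..
    qed
    then obtain q where q: "\<And>n. \<bar>real_of_rat (q n) - c\<bar> < 1 / real (Suc n)" by metis
    have "(\<lambda>n. real_of_rat (q n) - c) \<longlonglongrightarrow> 0"
    proof (rule Lim_null_comparison)
      show "\<forall>\<^sub>F n in sequentially. norm (real_of_rat (q n) - c) \<le> 1 / real (Suc n)"
        using q by (auto intro!: always_eventually less_imp_le)
      show "(\<lambda>n. 1 / real (Suc n)) \<longlonglongrightarrow> 0" by (rule LIMSEQ_Suc[OF lim_1_over_n])
    qed
    then have "(\<lambda>n. real_of_rat (q n)) \<longlonglongrightarrow> c" by (simp add: LIM_zero_iff)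
    with f(2) have "(\<lambda>n. real_of_rat (q n) *\<^sub>R f n) \<longlonglongrightarrow> c *\<^sub>R x" by (intro tendsto_scaleR)
    moreover have "\<forall>n. real_of_rat (q n) *\<^sub>R f n \<in> Q" using f(1) Qscale by blast
    ultimately show "c *\<^sub>R x \<in> closure Q" unfolding closure_sequential
      by (intro exI[of _ "\<lambda>n. real_of_rat (q n) *\<^sub>R f n"]) simp
  qed
  moreover have "D \<subseteq> closure Q"
  proof
    fix d assume "d \<in> D"
    then have "comb [(1, d)] \<in> Q" unfolding Q_def by (intro imageI) auto
    then show "d \<in> closure Q" using closure_subset by (auto simp: comb_def)
  qed
  ultimately have "span D \<subseteq> closure Q" by (intro span_minimal)
  then have clQ: "closure Q = UNIV"
    using D(3) closure_minimal[of "span D" "closure Q"] by auto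
  define B where "B = (\<lambda>(q, n). ball q (1 / real (Suc n))) ` (Q \<times> UNIV)"
  have "countable B" unfolding B_def using cQ by (intro countable_image countable_SIGMA) auto
  moreover have "topological_basis B"
  proof (rule topological_basisI)
    show "open b" if "b \<in> B" for b using that by (auto simp: B_def)
    fix U and x :: "'a L2" assume "open U" "x \<in> U"
    then obtain e where e: "e > 0" "ball x e \<subseteq> U" by (meson openE)
    then obtain n where n: "1 / real (Suc n) < e / 2" using nat_approx_posE[of "e / 2"] by auto
    have "x \<in> closure Q" by (simp add: clQ)
    then obtain q where q: "q \<in> Q" "dist q x < 1 / real (Suc n)"
      unfolding closure_approachable by (metis of_nat_0_less_iff zero_less_Suc zero_less_divide_1_iff)
    have "ball q (1 / real (Suc n)) \<subseteq> ball x e"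
    proof
      fix y assume "y \<in> ball q (1 / real (Suc n))"
      then have "dist q y < 1 / real (Suc n)" by simp
      then have "dist x y < e" using q(2) n dist_triangle[of x y q] by (simp add: dist_commute)
      then show "y \<in> ball x e" by simp
    qed
    then have "ball q (1 / real (Suc n)) \<subseteq> U" using e by blast
    moreover have "ball q (1 / real (Suc n)) \<in> B" unfolding B_def using q(1) by force
    moreover have "x \<in> ball q (1 / real (Suc n))" using q(2) by simp
    ultimately show "\<exists>b\<in>B. x \<in> b \<and> b \<subseteq> U" by blast
  qed
  ultimately show "\<exists>B::'a L2 set set. countable B \<and> open = generate_topology B"
    by (blast intro: topological_basis_imp_subbasis)
qed

text \<open>
  Functions on a domain \<open>\<Omega>\<close> are extended by zero: \<open>L2_on \<Omega>\<close> is the isometric copy of \<open>L\<^sup>2(\<Omega>)\<close> in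
  \<open>'a L2\<close>.  Norms and inner products below are those of \<open>'a L2\<close>, of \<open>real\<close> and of product types,
  which are exactly the Hilbert space structures of \<open>L\<^sup>2(0,l) \<times> \<real>\<^sup>2\<close> and
  \<open>L\<^sup>2((0,T) \<times> (0,l)) \<times> L\<^sup>2(0,T)\<close>.
\<close>

definition L2_on :: "'a::euclidean_space set \<Rightarrow> 'a L2 set" where
  "L2_on \<Omega> = {u. AE x in lborel. x \<notin> \<Omega> \<longrightarrow> rep_L2 u x = 0}"

type_synonym triple = "real L2 \<times> real \<times> real"
type_synonym state = "triple \<times> triple"
type_synonym source = "(real \<times> real) L2 \<times> real L2"

definition LL2 :: "real \<Rightarrow> triple set" where
  "LL2 l = L2_on {0<..<l} \<times> UNIV"

definition LL2T :: "real \<Rightarrow> real \<Rightarrow> source set" where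
  "LL2T T l = L2_on ({0<..<T} \<times> {0<..<l}) \<times> L2_on {0<..<T}"

definition test_function :: "real \<Rightarrow> (real \<Rightarrow> real) \<Rightarrow> bool" where
  "test_function l \<psi> \<longleftrightarrow>
     \<psi> C1_differentiable_on UNIV \<and> (\<exists>a b. 0 < a \<and> b < l \<and> (\<forall>x. x \<notin> {a..b} \<longrightarrow> \<psi> x = 0))"

definition has_weak_deriv :: "real \<Rightarrow> real L2 \<Rightarrow> real L2 \<Rightarrow> bool" where
  "has_weak_deriv l u g \<longleftrightarrow> u \<in> L2_on {0<..<l} \<and> g \<in> L2_on {0<..<l} \<and>
     (\<forall>\<psi>. test_function l \<psi> \<longrightarrow>
        (LINT x:{0<..<l}|lborel. rep_L2 u x * deriv \<psi> x) = - (LINT x:{0<..<l}|lborel. rep_L2 g x * \<psi> x))"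

definition weak_deriv :: "real \<Rightarrow> real L2 \<Rightarrow> real L2" where
  "weak_deriv l u = (THE g. has_weak_deriv l u g)"

definition H1 :: "real \<Rightarrow> real L2 set" where
  "H1 l = {u. \<exists>g. has_weak_deriv l u g}"

definition H2 :: "real \<Rightarrow> real L2 set" where
  "H2 l = {u \<in> H1 l. weak_deriv l u \<in> H1 l}"

text \<open>
  Point values of \<open>u \<in> H\<^sup>1(0,l)\<close> are those of its continuous representative on \<open>[0,l]\<close>; only values
  at points of \<open>[0,l]\<close> are determined.
\<close>

definition cont_rep :: "real \<Rightarrow> real L2 \<Rightarrow> real \<Rightarrow> real" where
  "cont_rep l u = (SOME c. continuous_on {0..l} c \<and>
     (AE x in lborel. x \<in> {0<..<l} \<longrightarrow> rep_L2 u x = c x))"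

definition with_traces :: "real \<Rightarrow> real L2 \<Rightarrow> triple" where
  "with_traces l u = (u, cont_rep l u 0, cont_rep l u l)"

definition HH1 :: "real \<Rightarrow> triple set" where "HH1 l = with_traces l ` H1 l"
definition HH2 :: "real \<Rightarrow> triple set" where "HH2 l = with_traces l ` H2 l"

definition energy_space :: "real \<Rightarrow> state set" where
  "energy_space l = HH1 l \<times> LL2 l"

text \<open>
  The topology of the energy space is not that of the type \<open>state\<close>: the norm of \<open>H\<^sup>1(0,l)\<close> also
  involves \<open>u\<^sub>x\<close>.  Adjoining \<open>u\<^sub>x\<close> embeds that space linearly and isometrically onto a closed subspace
  of a Banach space type, with left inverse \<open>fst\<close>.
\<close>

definition energy_embed :: "real \<Rightarrow> state \<Rightarrow> state \<times> real L2" where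
  "energy_embed l X = (X, weak_deriv l (fst (fst X)))"

definition energy_norm :: "real \<Rightarrow> state \<Rightarrow> real" where
  "energy_norm l X = norm (energy_embed l X)"

text \<open>Bochner integral in the energy space, oriented if \<open>b < a\<close>.\<close>

definition energy_integral :: "real \<Rightarrow> real \<Rightarrow> real \<Rightarrow> (real \<Rightarrow> state) \<Rightarrow> state" where
  "energy_integral l a b f = fst (LBINT s=a..b. energy_embed l (f s))"

definition B_op :: "real \<Rightarrow> triple \<Rightarrow> triple" where
  "B_op l = (\<lambda>(u, a, b). (weak_deriv l (weak_deriv l u),
      cont_rep l (weak_deriv l u) 0, - cont_rep l (weak_deriv l u) l))"

definition A_op :: "real \<Rightarrow> state \<Rightarrow> state" where
  "A_op l = (\<lambda>(U, V). (V, B_op l U))"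

definition A_dom :: "real \<Rightarrow> state set" where
  "A_dom l = HH2 l \<times> HH1 l"

text \<open>Strongly continuous groups on a subspace \<open>H\<close> carrying its own norm \<open>N\<close>.\<close>

definition C0_group_on :: "'a::real_vector set \<Rightarrow> ('a \<Rightarrow> real) \<Rightarrow> (real \<Rightarrow> 'a \<Rightarrow> 'a) \<Rightarrow> bool" where
  "C0_group_on H N S \<longleftrightarrow>
     (\<forall>t. \<forall>x\<in>H. S t x \<in> H) \<and>
     (\<forall>t. \<forall>x\<in>H. \<forall>y\<in>H. S t (x + y) = S t x + S t y) \<and>
     (\<forall>t c. \<forall>x\<in>H. S t (c *\<^sub>R x) = c *\<^sub>R S t x) \<and>
     (\<forall>t. \<exists>K. \<forall>x\<in>H. N (S t x) \<le> K * N x) \<and>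
     (\<forall>x\<in>H. S 0 x = x) \<and>
     (\<forall>s t. \<forall>x\<in>H. S (s + t) x = S s (S t x)) \<and>
     (\<forall>x\<in>H. ((\<lambda>t. N (S t x - x)) \<longlongrightarrow> 0) (at 0))"

definition generates_C0_group_on ::
    "'a::real_vector set \<Rightarrow> ('a \<Rightarrow> real) \<Rightarrow> 'a set \<Rightarrow> ('a \<Rightarrow> 'a) \<Rightarrow> (real \<Rightarrow> 'a \<Rightarrow> 'a) \<Rightarrow> bool" where
  "generates_C0_group_on H N D A S \<longleftrightarrow> C0_group_on H N S \<and>
     {(x, y). x \<in> H \<and> y \<in> H \<and> ((\<lambda>h. N ((1 / h) *\<^sub>R (S h x - x) - y)) \<longlongrightarrow> 0) (at 0)}
       = {(x, A x) | x. x \<in> D}"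

text \<open>
  \<open>S\<close> is the group \<open>t \<mapsto> exp(tA)\<close>.  As a \<open>C\<^sub>0\<close>-group is determined by its generator, this fixes \<open>S\<close> on the energy space.
\<close>

definition wave_group :: "real \<Rightarrow> (real \<Rightarrow> state \<Rightarrow> state) \<Rightarrow> bool" where
  "wave_group l S \<longleftrightarrow>
     generates_C0_group_on (energy_space l) (energy_norm l) (A_dom l) (A_op l) S"

text \<open>
  \<open>F(s,\<sqdot>) \<in> L\<^sup>2(0,l)\<close>, which is meaningful for almost every \<open>s\<close>.  The cut-off to \<open>(0,l)\<close> matters
  only for \<open>s\<close> in a null set; it keeps the source term in the energy space for every \<open>s\<close>, whatever
  representative of \<open>F\<close> is chosen.
\<close>

definition slice :: "real \<Rightarrow> (real \<times> real) L2 \<Rightarrow> real \<Rightarrow> real L2" where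
  "slice l F s = to_L2 (\<lambda>x. indicator {0<..<l} x * rep_L2 F (s, x))"

definition source_term :: "real \<Rightarrow> source \<Rightarrow> real \<Rightarrow> state" where
  "source_term l = (\<lambda>(F, G) s. ((0, 0, 0), (slice l F s, rep_L2 G s, 0)))"

text \<open>
  The mild solution \<open>t \<mapsto> (Y(t), Y\<^sub>t(t))\<close> with data \<open>X\<close> prescribed at time \<open>\<tau>\<close>: \<open>\<tau> = 0\<close> for the direct
  problem, \<open>\<tau> = T\<close> for problems with terminal data.
\<close>

definition mild_solution ::
    "real \<Rightarrow> (real \<Rightarrow> state \<Rightarrow> state) \<Rightarrow> real \<Rightarrow> state \<Rightarrow> source \<Rightarrow> real \<Rightarrow> state" where
  "mild_solution l S \<tau> X W t =
     S (t - \<tau>) X + energy_integral l \<tau> t (\<lambda>s. S (t - s) (source_term l W s))"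

definition U_ad :: "real \<Rightarrow> real \<Rightarrow> real \<Rightarrow> real \<Rightarrow> real \<Rightarrow> real \<Rightarrow> source set" where
  "U_ad T l Fmin Fmax Gmin Gmax = {(F, G) \<in> LL2T T l.
     (AE p in lborel. p \<in> {0<..<T} \<times> {0<..<l} \<longrightarrow> Fmin \<le> rep_L2 F p \<and> rep_L2 F p \<le> Fmax) \<and>
     (AE t in lborel. t \<in> {0<..<T} \<longrightarrow> Gmin \<le> rep_L2 G t \<and> rep_L2 G t \<le> Gmax)}"

definition final_state ::
    "real \<Rightarrow> real \<Rightarrow> (real \<Rightarrow> state \<Rightarrow> state) \<Rightarrow> state \<Rightarrow> source \<Rightarrow> triple" where
  "final_state T l S X0 W = fst (mild_solution l S 0 X0 W T)"

definition cost ::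
    "real \<Rightarrow> real \<Rightarrow> (real \<Rightarrow> state \<Rightarrow> state) \<Rightarrow> state \<Rightarrow> triple \<Rightarrow> source \<Rightarrow> real" where
  "cost T l S X0 Yd W = 1 / 2 * (norm (final_state T l S X0 W - Yd))\<^sup>2"

definition adjoint_state ::
    "real \<Rightarrow> real \<Rightarrow> (real \<Rightarrow> state \<Rightarrow> state) \<Rightarrow> state \<Rightarrow> triple \<Rightarrow> source \<Rightarrow> real \<Rightarrow> state" where
  "adjoint_state T l S X0 Yd W =
     mild_solution l S T ((0, 0, 0), - (final_state T l S X0 W - Yd)) 0"

text \<open>The function \<open>\<phi>(t,x)\<close>; pointwise values make sense because \<open>\<phi>(t,\<sqdot>) \<in> H\<^sup>1(0,l)\<close>.\<close>

definition adjoint_fun ::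
    "real \<Rightarrow> real \<Rightarrow> (real \<Rightarrow> state \<Rightarrow> state) \<Rightarrow> state \<Rightarrow> triple \<Rightarrow> source \<Rightarrow> real \<Rightarrow> real \<Rightarrow> real" where
  "adjoint_fun T l S X0 Yd W t = cont_rep l (fst (fst (adjoint_state T l S X0 Yd W t)))"

definition zero_ext :: "'a set \<Rightarrow> ('a \<Rightarrow> real) \<Rightarrow> 'a \<Rightarrow> real" where
  "zero_ext \<Omega> f x = (if x \<in> \<Omega> then f x else 0)"

end

theory Submission
  imports Defs
begin

text \<open>
  The final state depends affinely on the source, \<open>Y(T) = c + \<Lambda> W\<close> with \<open>\<Lambda>\<close> bounded, so
  \<open>\<J>\<close> is quadratic with derivative \<open>\<delta>W \<mapsto> \<langle>Y(T) - Y\<^sub>T\<^sup>\<delta>, \<Lambda> \<delta>W\<rangle>\<close>, and only the adjoint of \<open>\<Lambda>\<close> has to be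
  identified.  Integration by parts with the boundary terms collected by the traces gives
  \<open>\<langle>\<B> U, V\<rangle> = - \<langle>u\<^sub>x, v\<^sub>x\<rangle>\<close>.  Hence the group leaves the symplectic form
  \<open>\<langle>U, V'\<rangle> - \<langle>U', V\<rangle>\<close> and the energy \<open>\<parallel>U'\<parallel>\<^sup>2 + \<parallel>u\<^sub>x\<parallel>\<^sup>2\<close> invariant, first on the domain of the generator.
  Initial data \<open>(0, V)\<close> with \<open>V \<in> \<H>\<^sup>1\<close> lie in that domain, and they are dense among the data
  \<open>(0, V)\<close> with \<open>V \<in> \<L>\<^sup>2\<close>, the only ones in Duhamel's formula.  Conservation of energy therefore bounds
  \<open>\<Lambda>\<close>, and invariance of the symplectic form turns \<open>\<langle>Z, \<Lambda> W\<rangle>\<close> into the integral of the solution with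
  terminal data \<open>(0, -Z)\<close> against the source.
\<close>

subsection \<open>Primitives of square-integrable functions\<close>

text \<open>\<open>S\<close> is known only through the group laws and its generator, so every
  identity about it comes from differentiating orbits in time, which requires data in
  \<open>A_dom\<close>. Moreover \<open>wave_group\<close> bounds each single \<open>S t\<close>,
  whereas Duhamel's integral calls for a bound that is locally uniform in t; conservation of energy
  supplies it. The Sobolev spaces are handled in coordinates: u in \<open>H1 l\<close> is a +
  int_0^x g with a = u(0) and g = u_x. In these coordinates both traces, the weak derivative and the
  energy norm are explicit, and integration by parts becomes Fubini on a square. The price is the
  converse, that every u with a weak derivative has this form; it rests on du Bois-Reymond's lemma
  and hence on the density of C^1 functions in L^2(0,l). The same density, with both end values
  approximated independently of the function, yields the density of \<open>HH1 l\<close> in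
  \<open>LL2 l\<close>.\<close>

lemma sq_integrable_bounded_support:
  fixes f :: "'a::euclidean_space \<Rightarrow> real"
  assumes [measurable]: "f \<in> borel_measurable borel" "A \<in> sets borel" and "bounded A"
    and 0: "\<And>x. x \<notin> A \<Longrightarrow> f x = 0" and C: "\<And>x. x \<in> A \<Longrightarrow> \<bar>f x\<bar> \<le> C"
  shows "sq_integrable f"
proof -
  obtain r where "A \<subseteq> cball 0 r" using \<open>bounded A\<close> bounded_subset_ballD[of A 0] ball_subset_cball by blast
  then have A: "sq_integrable (indicator A)" by (intro sq_integrable_indicator) auto
  have "integrable lborel (\<lambda>x. C\<^sup>2 * (indicator A x)\<^sup>2)"
    using A by (simp add: sq_integrable_def)
  then have "integrable lborel (\<lambda>x. (f x)\<^sup>2)"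
  proof (rule Bochner_Integration.integrable_bound)
    have "norm ((f x)\<^sup>2) \<le> norm (C\<^sup>2 * (indicator A x)\<^sup>2)" for x
    proof (cases "x \<in> A")
      case True
      with C[OF True] have "(f x)\<^sup>2 \<le> C\<^sup>2" by (simp add: abs_le_square_iff[symmetric])
      with True show ?thesis by simp
    qed (simp add: 0)
    then show "AE x in lborel. norm ((f x)\<^sup>2) \<le> norm (C\<^sup>2 * (indicator A x)\<^sup>2)" by simp
  qed measurable
  then show ?thesis by (simp add: sq_integrable_def)
qed

lemma sq_integrable_indicator_bounded:
  "A \<in> sets borel \<Longrightarrow> bounded A \<Longrightarrow> sq_integrable (indicator A :: 'a::euclidean_space \<Rightarrow> real)"
  by (rule sq_integrable_bounded_support[of _ A 1]) auto

lemma sq_integrable_indicator_continuous: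
  fixes f :: "'a::euclidean_space \<Rightarrow> real"
  assumes "compact K" "continuous_on K f" and A: "A \<in> sets borel" "A \<subseteq> K"
  shows "sq_integrable (\<lambda>x. indicator A x * f x)"
proof -
  have "compact (f ` K)" using assms by (intro compact_continuous_image)
  then obtain C where C: "\<And>x. x \<in> K \<Longrightarrow> \<bar>f x\<bar> \<le> C"
    by (metis bounded_iff compact_imp_bounded image_eqI real_norm_def)
  have "bounded A" using A \<open>compact K\<close> bounded_subset compact_imp_bounded by blast
  then show ?thesis
    using borel_measurable_continuous_on_indicator[OF A(1) continuous_on_subset[OF assms(2) A(2)]] A C
    by (intro sq_integrable_bounded_support[of _ A C]) auto
qed

section \<open>Inner products, norms and restriction of classes\<close>

lemma inner_to_L2:
  assumes "sq_integrable f"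
  shows "to_L2 f \<bullet> u = (LINT x|lborel. f x * rep_L2 u x)"
  unfolding inner_L2_def
proof (rule integral_cong_AE)
  show "AE x in lborel. rep_L2 (to_L2 f) x * rep_L2 u x = f x * rep_L2 u x"
    using rep_to_L2[OF assms] by eventually_elim simp
qed (use assms in \<open>auto dest: sq_integrable_measurable\<close>)

lemma inner_to_L2_to_L2:
  assumes "sq_integrable f" "sq_integrable g"
  shows "to_L2 f \<bullet> to_L2 g = (LINT x|lborel. f x * g x)"
  unfolding inner_to_L2[OF assms(1)]
proof (rule integral_cong_AE)
  show "AE x in lborel. f x * rep_L2 (to_L2 g) x = f x * g x"
    using rep_to_L2[OF assms(2)] by eventually_elim simp
qed (use assms[THEN sq_integrable_measurable] in measurable)

lemma to_L2_diff:
  assumes "sq_integrable f" "sq_integrable g"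
  shows "to_L2 (\<lambda>x. f x - g x) = to_L2 f - to_L2 g"
  using to_L2_add[OF assms(1) sq_integrable_cmult[OF assms(2), of "-1"]] to_L2_cmult[OF assms(2), of "-1"]
  by simp

lemma to_L2_cong_AE:
  assumes "sq_integrable f" "sq_integrable g" "AE x in lborel. f x = g x"
  shows "to_L2 f = to_L2 g"
  by (rule L2_eqI, use rep_to_L2[OF assms(1)] rep_to_L2[OF assms(2)] assms(3) in eventually_elim, simp)

lemma norm_to_L2: "sq_integrable f \<Longrightarrow> norm (to_L2 f) = sqrt (LINT x|lborel. (f x)\<^sup>2)"
  by (simp add: norm_eq_sqrt_inner inner_to_L2_to_L2 power2_eq_square)

lemma L2_on_to_L2: "sq_integrable f \<Longrightarrow> (\<And>x. x \<notin> A \<Longrightarrow> f x = 0) \<Longrightarrow> to_L2 f \<in> L2_on A"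
  unfolding L2_on_def mem_Collect_eq using rep_to_L2[of f] by (auto elim: eventually_mono)

text \<open>For Borel A this is the orthogonal projection onto \<open>L2_on A\<close>. It turns
  membership in that subspace into a fixed-point equation and extends maps from the subspace to the
  whole type.\<close>

definition restrict_L2 :: "'a::euclidean_space set \<Rightarrow> 'a L2 \<Rightarrow> 'a L2" where
  "restrict_L2 A u = to_L2 (\<lambda>x. indicator A x * rep_L2 u x)"

lemma sq_integrable_indicator_mult:
  assumes "A \<in> sets borel" "sq_integrable f"
  shows "sq_integrable (\<lambda>x. indicator A x * f x)"
proof -
  have [measurable]: "f \<in> borel_measurable borel" "A \<in> sets borel"
    using assms sq_integrable_measurable[of f] by auto
  have "integrable lborel (\<lambda>x. (f x)\<^sup>2)" using assms by (simp add: sq_integrable_def)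
  then have "integrable lborel (\<lambda>x. (indicator A x * f x)\<^sup>2)"
    by (rule Bochner_Integration.integrable_bound) (auto simp: indicator_def)
  then show ?thesis by (simp add: sq_integrable_def)
qed

lemma restrict_L2_in: "A \<in> sets borel \<Longrightarrow> restrict_L2 A u \<in> L2_on A"
  unfolding restrict_L2_def by (intro L2_on_to_L2 sq_integrable_indicator_mult) auto

lemma restrict_L2_id:
  assumes "A \<in> sets borel" "u \<in> L2_on A"
  shows "restrict_L2 A u = u"
proof -
  have "to_L2 (\<lambda>x. indicator A x * rep_L2 u x) = to_L2 (rep_L2 u)"
  proof (rule to_L2_cong_AE)
    show "AE x in lborel. indicator A x * rep_L2 u x = rep_L2 u x"
      using assms(2) unfolding L2_on_def mem_Collect_eq by eventually_elim (auto simp: indicator_def)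
  qed (use assms in \<open>auto intro: sq_integrable_indicator_mult\<close>)
  then show ?thesis by (simp add: restrict_L2_def)
qed

lemma bounded_linear_restrict_L2:
  assumes "A \<in> sets borel"
  shows "bounded_linear (restrict_L2 A)"
proof (rule bounded_linear_intro[of _ 1])
  note sq = sq_integrable_indicator_mult[OF assms sq_integrable_rep]
  fix u v :: "'a L2" and c :: real
  have "restrict_L2 A (u + v) = to_L2 (\<lambda>x. indicator A x * rep_L2 u x + indicator A x * rep_L2 v x)"
    unfolding restrict_L2_def
  proof (rule to_L2_cong_AE)
    show "AE x in lborel. indicator A x * rep_L2 (u + v) x = indicator A x * rep_L2 u x + indicator A x * rep_L2 v x"
      using rep_plus[of u v] by eventually_elim (simp add: algebra_simps)
  qed (intro sq sq_integrable_add)+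
  then show "restrict_L2 A (u + v) = restrict_L2 A u + restrict_L2 A v"
    by (simp add: restrict_L2_def to_L2_add[OF sq sq])
  have "restrict_L2 A (c *\<^sub>R u) = to_L2 (\<lambda>x. c * (indicator A x * rep_L2 u x))"
    unfolding restrict_L2_def
  proof (rule to_L2_cong_AE)
    show "AE x in lborel. indicator A x * rep_L2 (c *\<^sub>R u) x = c * (indicator A x * rep_L2 u x)"
      using rep_scaleR[of c u] by eventually_elim simp
  qed (intro sq sq_integrable_cmult)+
  then show "restrict_L2 A (c *\<^sub>R u) = c *\<^sub>R restrict_L2 A u"
    by (simp add: restrict_L2_def to_L2_cmult[OF sq])
  have "(LINT x|lborel. (indicator A x * rep_L2 u x)\<^sup>2) \<le> (LINT x|lborel. (rep_L2 u x)\<^sup>2)"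
    using sq[of u] sq_integrable_rep[of u] unfolding sq_integrable_def
    by (intro integral_mono) (auto simp: indicator_def)
  then have "norm (restrict_L2 A u) \<le> sqrt ((norm u)\<^sup>2)"
    unfolding restrict_L2_def norm_to_L2[OF sq] norm_L2_square by simp
  then show "norm (restrict_L2 A u) \<le> norm u * 1" by simp
qed

lemma subspace_L2_on: "subspace (L2_on A)"
  unfolding subspace_def L2_on_def
proof (intro conjI ballI allI)
  show "0 \<in> {u. AE x in lborel. x \<notin> A \<longrightarrow> rep_L2 u x = 0}"
    unfolding mem_Collect_eq using rep_zero by eventually_elim simp
next
  fix u v :: "'a L2"
  assume u: "u \<in> {u. AE x in lborel. x \<notin> A \<longrightarrow> rep_L2 u x = 0}" and v: "v \<in> {u. AE x in lborel. x \<notin> A \<longrightarrow> rep_L2 u x = 0}"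
  show "u + v \<in> {u. AE x in lborel. x \<notin> A \<longrightarrow> rep_L2 u x = 0}"
    using u v rep_plus[of u v] unfolding mem_Collect_eq by eventually_elim simp
next
  fix u :: "'a L2" and c :: real
  assume u: "u \<in> {u. AE x in lborel. x \<notin> A \<longrightarrow> rep_L2 u x = 0}"
  show "c *\<^sub>R u \<in> {u. AE x in lborel. x \<notin> A \<longrightarrow> rep_L2 u x = 0}"
    using u rep_scaleR[of c u] unfolding mem_Collect_eq by eventually_elim simp
qed

lemmas L2_on_0 = subspace_0[OF subspace_L2_on]
  and L2_on_add = subspace_add[OF subspace_L2_on]
  and L2_on_scale = subspace_scale[OF subspace_L2_on]
  and L2_on_diff = subspace_diff[OF subspace_L2_on]

text \<open>As an inner product with an indicator, the primitive is visibly linear in g, and jointly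
  continuous in (g, x) because the indicator depends continuously on x in L^2. For x \<le> 0 the
  interval is empty and the value is 0.\<close>

definition primitive :: "real L2 \<Rightarrow> real \<Rightarrow> real" where
  "primitive g x = to_L2 (indicator {0<..<x}) \<bullet> g"

lemma primitive_add: "primitive (g + h) x = primitive g x + primitive h x"
  and primitive_scaleR: "primitive (c *\<^sub>R g) x = c * primitive g x"
  and primitive_zero [simp]: "primitive 0 x = 0"
  by (simp_all add: primitive_def inner_add_right)

lemma primitive_eq: "primitive g x = (LINT y|lborel. indicator {0<..<x} y * rep_L2 g y)"
  unfolding primitive_def by (rule inner_to_L2) (simp add: sq_integrable_indicator_bounded)

lemma primitive_at_0 [simp]: "primitive g 0 = 0"
  by (simp add: primitive_eq)

text \<open>The indicators differ at most between x and y; the square root of that length makes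
  primitives Hoelder continuous with exponent 1/2.\<close>

lemma norm_indicator_diff_le:
  fixes x y :: real
  shows "norm (to_L2 (indicator {0<..<x} :: real \<Rightarrow> real) - to_L2 (indicator {0<..<y})) \<le> sqrt \<bar>x - y\<bar>"
proof -
  have sq: "sq_integrable (indicator {0<..<x} :: real \<Rightarrow> real)" for x
    by (simp add: sq_integrable_indicator_bounded)
  have "(LINT z|lborel. (indicator {0<..<x} z - indicator {0<..<y} z :: real)\<^sup>2)
      \<le> (LINT z|lborel. indicator {min x y..max x y} z)"
  proof (rule integral_mono)
    show "integrable lborel (\<lambda>z. (indicator {0<..<x} z - indicator {0<..<y} z :: real)\<^sup>2)"
      using sq_integrable_diff[OF sq sq] by (simp add: sq_integrable_def)
    show "integrable lborel (indicator {min x y..max x y} :: real \<Rightarrow> real)"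
      by (simp add: integrable_real_indicator emeasure_lborel_Icc_eq)
  qed (auto simp: indicator_def)
  also have "\<dots> = \<bar>x - y\<bar>" by (auto simp: min_def max_def)
  finally show ?thesis
    unfolding to_L2_diff[OF sq sq, symmetric] norm_to_L2[OF sq_integrable_diff[OF sq sq]] by simp
qed

lemma primitive_diff_le: "\<bar>primitive g x - primitive g y\<bar> \<le> sqrt \<bar>x - y\<bar> * norm g"
proof -
  have "primitive g x - primitive g y = (to_L2 (indicator {0<..<x}) - to_L2 (indicator {0<..<y})) \<bullet> g"
    by (simp add: primitive_def inner_diff_left)
  also have "\<bar>\<dots>\<bar> \<le> norm (to_L2 (indicator {0<..<x} :: real \<Rightarrow> real) - to_L2 (indicator {0<..<y})) * norm g"
    by (rule Cauchy_Schwarz_ineq2)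
  also have "\<dots> \<le> sqrt \<bar>x - y\<bar> * norm g"
    by (intro mult_right_mono norm_indicator_diff_le) simp
  finally show ?thesis .
qed

lemma continuous_on_primitive [continuous_intros]: "continuous_on A (primitive g)"
proof -
  have "isCont (primitive g) x" for x
    unfolding isCont_def
  proof (rule Lim_transform_bound[where g = "\<lambda>y. sqrt \<bar>y - x\<bar> * norm g", THEN LIM_zero_cancel])
    show "\<forall>\<^sub>F y in at x. norm (primitive g y - primitive g x) \<le> norm (sqrt \<bar>y - x\<bar> * norm g)"
      using primitive_diff_le[of g _ x] by (simp add: abs_mult)
    have "((\<lambda>y. sqrt \<bar>y - x\<bar> * norm g) \<longlongrightarrow> sqrt \<bar>x - x\<bar> * norm g) (at x)"
      by (intro tendsto_intros)
    then show "((\<lambda>y. sqrt \<bar>y - x\<bar> * norm g) \<longlongrightarrow> 0) (at x)" by simp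
  qed
  then show ?thesis by (simp add: continuous_at_imp_continuous_on)
qed

lemma integrable_indicator_rep: "bounded A \<Longrightarrow> A \<in> sets borel \<Longrightarrow> integrable lborel (\<lambda>x. indicator A x * rep_L2 g x)"
  by (intro sq_integrable_mult sq_integrable_indicator_bounded) auto

text \<open>Fubini on the square (0,l) x (0,l): the product g(x) h(y) integrates to the right-hand
  side over the whole square, and to one summand of the left-hand side over each of the triangles y
  < x and x < y.\<close>

lemma primitive_by_parts:
  assumes "0 < l"
  shows "(LINT x|lborel. indicator {0<..<l} x * (rep_L2 g x * primitive h x))
       + (LINT x|lborel. indicator {0<..<l} x * (rep_L2 h x * primitive g x)) = primitive g l * primitive h l"
proof -
  define f where "f g x = indicator {0<..<l} x * rep_L2 g x" for g x
  have f_int: "integrable lborel (f g)" for g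
    unfolding f_def by (rule integrable_indicator_rep) auto
  have [measurable]: "f g \<in> borel_measurable borel" for g unfolding f_def by measurable
  have ig: "(LINT x|lborel. f g x) = primitive g l" for g by (simp add: f_def primitive_eq)
  define k where "k g h = (\<lambda>(x, y). f g x * f h y * indicator {y<..} x)" for g h
  have [measurable]: "k g h \<in> borel_measurable (lborel \<Otimes>\<^sub>M lborel)" for g h
  proof -
    have "k g h = (\<lambda>z. f g (fst z) * f h (snd z) * indicator {z. snd z < fst z} z)"
      by (auto simp: k_def fun_eq_iff indicator_def)
    then show ?thesis by simp
  qed
  have half: "(LINT y|lborel. k g h (x, y)) = indicator {0<..<l} x * (rep_L2 g x * primitive h x)" for g h x
  proof (cases "x \<in> {0<..<l}")
    case True
    have "(LINT y|lborel. k g h (x, y)) = (LINT y|lborel. rep_L2 g x * (indicator {0<..<x} y * rep_L2 h y))"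
      using True by (intro Bochner_Integration.integral_cong) (auto simp: k_def f_def indicator_def)
    then show ?thesis using True by (simp add: primitive_eq)
  next
    case False
    then show ?thesis by (simp add: k_def f_def)
  qed
  have k_int: "integrable (lborel \<Otimes>\<^sub>M lborel) (k g h)" for g h
  proof (rule lborel_pair.Fubini_integrable)
    show "AE x in lborel. integrable lborel (\<lambda>y. k g h (x, y))"
    proof (rule AE_I2, rule Bochner_Integration.integrable_bound)
      fix x show "integrable lborel (\<lambda>y. f g x * f h y)" using f_int by simp
      show "AE y in lborel. norm (k g h (x, y)) \<le> norm (f g x * f h y)"
        by (auto simp: k_def indicator_def)
      show "(\<lambda>y. k g h (x, y)) \<in> borel_measurable lborel" by measurable
    qed
    show "integrable lborel (\<lambda>x. LINT y|lborel. norm (k g h (x, y)))"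
    proof (rule Bochner_Integration.integrable_bound)
      show "integrable lborel (\<lambda>x. norm (f g x) * (LINT y|lborel. norm (f h y)))"
        using f_int by (intro integrable_mult_left integrable_norm)
      show "(\<lambda>x. LINT y|lborel. norm (k g h (x, y))) \<in> borel_measurable lborel" by measurable
      show "AE x in lborel. norm (LINT y|lborel. norm (k g h (x, y))) \<le> norm (norm (f g x) * (LINT y|lborel. norm (f h y)))"
      proof (rule AE_I2)
        fix x
        have "(LINT y|lborel. norm (k g h (x, y))) \<le> (LINT y|lborel. norm (f g x) * norm (f h y))"
        proof (rule integral_mono)
          have "integrable lborel (\<lambda>y. f g x * f h y)" using f_int by simp
          then show "integrable lborel (\<lambda>y. norm (k g h (x, y)))"
            by (rule Bochner_Integration.integrable_bound) (auto simp: k_def indicator_def)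
          show "integrable lborel (\<lambda>y. norm (f g x) * norm (f h y))"
            using f_int by (intro integrable_mult_right integrable_norm)
        qed (auto simp: k_def indicator_def abs_mult)
        moreover have "0 \<le> (LINT y|lborel. norm (k g h (x, y)))" by simp
        ultimately show "norm (LINT y|lborel. norm (k g h (x, y))) \<le> norm (norm (f g x) * (LINT y|lborel. norm (f h y)))"
          by simp
      qed
    qed
  qed measurable
  have "(LINT x|lborel. indicator {0<..<l} x * (rep_L2 h x * primitive g x)) = (LINT y|lborel. LINT x|lborel. k h g (y, x))"
    by (simp add: half)
  also have "\<dots> = (LINT x|lborel. LINT y|lborel. k h g (y, x))"
    using k_int[of h g] by (intro lborel_pair.Fubini_integral[symmetric]) (simp add: case_prod_beta')
  finally have "(LINT x|lborel. indicator {0<..<l} x * (rep_L2 g x * primitive h x))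
       + (LINT x|lborel. indicator {0<..<l} x * (rep_L2 h x * primitive g x))
     = (LINT x|lborel. LINT y|lborel. k g h (x, y)) + (LINT x|lborel. LINT y|lborel. k h g (y, x))"
    by (simp add: half)
  also have "\<dots> = (LINT x|lborel. (LINT y|lborel. k g h (x, y)) + (LINT y|lborel. k h g (y, x)))"
    using lborel_pair.integrable_fst'[OF k_int[of g h]] lborel_pair.integrable_snd[of "\<lambda>x y. k h g (x, y)"] k_int[of h g]
    by (intro Bochner_Integration.integral_add[symmetric]) (simp_all add: case_prod_beta')
  also have "\<dots> = (LINT x|lborel. f g x * primitive h l)"
  proof (rule Bochner_Integration.integral_cong)
    fix x
    have i: "integrable lborel (\<lambda>y. k g h (x, y))" "integrable lborel (\<lambda>y. k h g (y, x))"
      by (rule Bochner_Integration.integrable_bound[of _ "\<lambda>y. f g x * f h y"],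
          use f_int in \<open>auto simp: k_def indicator_def mult.commute\<close>)+
    have "(LINT y|lborel. k g h (x, y)) + (LINT y|lborel. k h g (y, x)) = (LINT y|lborel. k g h (x, y) + k h g (y, x))"
      using i by simp
    also have "\<dots> = (LINT y|lborel. f g x * f h y)"
    proof (rule integral_cong_AE)
      \<comment> \<open>The two open triangles miss only the diagonal, which meets each line in a
        single point.\<close>
      show "AE y in lborel. k g h (x, y) + k h g (y, x) = f g x * f h y"
        using AE_lborel_singleton[of x] by eventually_elim (auto simp: k_def indicator_def)
    qed measurable
    finally show "(LINT y|lborel. k g h (x, y)) + (LINT y|lborel. k h g (y, x)) = f g x * primitive h l"
      by (simp add: ig)
  qed simp
  finally show ?thesis by (simp add: ig)
qed

subsection \<open>Density of smooth functions\<close>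

lemma primitive_derivative:
  assumes f: "\<And>x. (f has_real_derivative f' x) (at x)" and f': "continuous_on UNIV f'"
    and x: "0 \<le> x" "x \<le> l"
  shows "primitive (to_L2 (\<lambda>x. indicator {0<..<l} x * f' x)) x = f x - f 0"
proof -
  have sq: "sq_integrable (\<lambda>x. indicator {0<..<l} x * f' x)"
    by (rule sq_integrable_indicator_continuous[of "{0..l}"]) (use f' in \<open>auto intro: continuous_on_subset\<close>)
  have [measurable]: "f' \<in> borel_measurable borel"
    using f' by (rule borel_measurable_continuous_onI)
  have "primitive (to_L2 (\<lambda>x. indicator {0<..<l} x * f' x)) x
      = (LINT y|lborel. indicator {0<..<x} y * (indicator {0<..<l} y * f' y))"
    unfolding primitive_def by (intro inner_to_L2_to_L2 sq) (simp add: sq_integrable_indicator_bounded)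
  also have "\<dots> = (LINT y|lborel. f' y * indicator {0..x} y)"
  proof (rule integral_cong_AE)
    show "AE y in lborel. indicator {0<..<x} y * (indicator {0<..<l} y * f' y) = f' y * indicator {0..x} y"
      using AE_lborel_singleton[of 0] AE_lborel_singleton[of x]
      by eventually_elim (use x in \<open>auto simp: indicator_def\<close>)
  qed measurable
  also have "\<dots> = f x - f 0"
    using f f' x by (intro integral_FTC_Icc_real) (auto simp: continuous_on_eq_continuous_at)
  finally show ?thesis .
qed

lemma norm_to_L2_le:
  assumes "sq_integrable f" "0 \<le> l" "0 \<le> C"
    and "\<And>x. x \<notin> {0<..<l} \<Longrightarrow> f x = 0" and "\<And>x. x \<in> {0<..<l} \<Longrightarrow> \<bar>f x\<bar> \<le> C"
  shows "norm (to_L2 f) \<le> C * sqrt l"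
proof -
  have "(LINT x|lborel. (f x)\<^sup>2) \<le> (LINT x|lborel. C\<^sup>2 * indicator {0<..<l} x)"
  proof (rule integral_mono)
    show "(f x)\<^sup>2 \<le> C\<^sup>2 * indicator {0<..<l} x" for x
    proof (cases "x \<in> {0<..<l}")
      case True
      with assms(5)[of x] show ?thesis by (simp add: abs_le_square_iff[symmetric])
    qed (simp add: assms(4))
  qed (use assms(1,2) in \<open>auto simp: sq_integrable_def\<close>)
  also have "\<dots> = C\<^sup>2 * l" using assms(2) by simp
  finally show ?thesis
    unfolding norm_to_L2[OF assms(1)] using assms(3) by (auto simp: real_sqrt_mult dest: real_sqrt_le_mono)
qed

text \<open>Lebesgue measurability agrees with \<open>measurable_on\<close>, which by definition
  means a pointwise limit of continuous functions off a negligible set.\<close>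

lemma continuous_approximants:
  fixes f :: "real \<Rightarrow> real"
  assumes "f \<in> borel_measurable borel"
  obtains g where "\<And>n. continuous_on UNIV (g n)" "AE x in lborel. (\<lambda>n. g n x) \<longlonglongrightarrow> f x"
proof -
  have "f measurable_on UNIV"
    using assms by (intro lebesgue_measurable_imp_measurable_on_real) (auto simp: measurable_completion)
  then obtain N g where N: "negligible N" and g: "\<And>n. continuous_on UNIV (g n)"
    "\<And>x. x \<notin> N \<Longrightarrow> (\<lambda>n. g n x) \<longlonglongrightarrow> f x"
    unfolding measurable_on_def by auto
  have "AE x in lebesgue. (\<lambda>n. g n x) \<longlonglongrightarrow> f x"
    using N g(2) AE_not_in[of N lebesgue] by (auto simp: negligible_iff_null_sets elim: eventually_mono)
  then have "AE x in lborel. (\<lambda>n. g n x) \<longlonglongrightarrow> f x"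
    by (simp add: AE_completion_iff)
  with g(1) that show ?thesis by blast
qed

text \<open>Multiplying by the indicator of the complement of a null set makes the convergence hold
  everywhere and leaves all classes unchanged.\<close>

lemma to_L2_dominated_convergence_AE:
  fixes f :: "'a::euclidean_space \<Rightarrow> real"
  assumes w: "sq_integrable w"
    and [measurable]: "\<And>m. s m \<in> borel_measurable lborel" "f \<in> borel_measurable lborel"
    and lim: "AE x in lborel. (\<lambda>m. s m x) \<longlonglongrightarrow> f x"
    and bd: "\<And>m x. \<bar>s m x\<bar> \<le> w x"
  shows "(\<lambda>m. to_L2 (s m)) \<longlonglongrightarrow> to_L2 f"
proof -
  obtain N where N: "{x. \<not> (\<lambda>m. s m x) \<longlonglongrightarrow> f x} \<subseteq> N" "N \<in> null_sets lborel"
    using lim by (auto elim!: AE_E simp: null_sets_def)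
  then have [measurable]: "N \<in> sets borel" by (auto simp: null_sets_def)
  have nN: "AE x in lborel. x \<notin> N" by (rule AE_not_in[OF N(2)])
  have w0: "0 \<le> w x" for x using bd[of 0 x] by linarith
  have lim': "(\<lambda>m. indicator (- N) x * s m x) \<longlonglongrightarrow> indicator (- N) x * f x" for x
    using N(1) by (cases "x \<in> N") auto
  have bd': "\<bar>indicator (- N) x * s m x\<bar> \<le> w x" for m x
    using bd[of m x] w0[of x] by (auto simp: indicator_def)
  have bf: "\<bar>indicator (- N) x * f x\<bar> \<le> w x" for x
    by (rule LIMSEQ_le_const2[OF tendsto_rabs[OF lim']]) (use bd' in auto)
  have dom: "sq_integrable h" if [measurable]: "h \<in> borel_measurable lborel" and "\<And>x. x \<notin> N \<Longrightarrow> \<bar>h x\<bar> \<le> w x" for h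
  proof -
    have "integrable lborel (\<lambda>x. (w x)\<^sup>2)" using w by (simp add: sq_integrable_def)
    then have "integrable lborel (\<lambda>x. (h x)\<^sup>2)"
    proof (rule Bochner_Integration.integrable_bound)
      show "AE x in lborel. norm ((h x)\<^sup>2) \<le> norm ((w x)\<^sup>2)"
        using nN by eventually_elim (use that(2) in \<open>fastforce simp: abs_le_square_iff[symmetric]\<close>)
    qed measurable
    then show ?thesis by (simp add: sq_integrable_def)
  qed
  have sqs: "sq_integrable (s m)" for m by (rule dom) (auto intro: bd)
  have sqf: "sq_integrable f" 
  proof (rule dom)
    show "\<bar>f x\<bar> \<le> w x" if "x \<notin> N" for x using bf[of x] that by simp
  qed measurable
  have cN: "- N \<in> sets borel" by measurable
  have eq: "to_L2 (\<lambda>x. indicator (- N) x * h x) = to_L2 h" if "sq_integrable h" for h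
  proof (rule to_L2_cong_AE)
    show "AE x in lborel. indicator (- N) x * h x = h x" using nN by eventually_elim simp
  qed (use that cN in \<open>auto intro: sq_integrable_indicator_mult\<close>)
  have "(\<lambda>m. to_L2 (\<lambda>x. indicator (- N) x * s m x)) \<longlonglongrightarrow> to_L2 (\<lambda>x. indicator (- N) x * f x)"
    by (rule to_L2_dominated_convergence[OF w _ _ lim' bd']) measurable
  then show ?thesis by (simp add: eq sqs sqf)
qed

text \<open>End values can be prescribed freely because they are corrected in boundary layers of
  width 1/n, whose effect vanishes in L^2. Clipping at height M supplies the dominating function
  that the continuous approximants of v do not provide by themselves.\<close>

lemma continuous_dense_L2:
  fixes a b l :: real
  assumes l: "0 < l" and v: "v \<in> L2_on {0<..<l}" and e: "0 < e"
  obtains c where "continuous_on UNIV c" "c 0 = a" "c l = b"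
    "norm (to_L2 (\<lambda>x. indicator {0<..<l} x * c x) - v) < e"
proof -
  define clip where "clip M x = max (- M) (min M x)" for M x :: real
  have clip_le: "\<bar>clip M x\<bar> \<le> M" if "0 \<le> M" for M x using that by (auto simp: clip_def)
  have clip_cont: "continuous_on UNIV (clip M)" for M
    unfolding clip_def by (intro continuous_intros)
  have [measurable]: "clip M \<in> borel_measurable borel" for M
    by (rule borel_measurable_continuous_onI[OF clip_cont])
  have "(\<lambda>n. to_L2 (\<lambda>x. indicator {0<..<l} x * clip (real n) (rep_L2 v x))) \<longlonglongrightarrow> to_L2 (\<lambda>x. indicator {0<..<l} x * rep_L2 v x)"
  proof (rule to_L2_dominated_convergence)
    show "sq_integrable (\<lambda>x. \<bar>rep_L2 v x\<bar>)"
      using sq_integrable_rep[of v] by (auto simp: sq_integrable_def)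
    show "\<bar>indicator {0<..<l} x * clip (real n) (rep_L2 v x)\<bar> \<le> \<bar>rep_L2 v x\<bar>" for n x
      by (auto simp: clip_def indicator_def)
    show "(\<lambda>n. indicator {0<..<l} x * clip (real n) (rep_L2 v x)) \<longlonglongrightarrow> indicator {0<..<l} x * rep_L2 v x" for x
    proof (rule tendsto_mult_left, rule tendsto_eventually)
      obtain N where "\<bar>rep_L2 v x\<bar> \<le> real N" using real_arch_simple by blast
      then show "\<forall>\<^sub>F n in sequentially. clip (real n) (rep_L2 v x) = rep_L2 v x"
        unfolding eventually_sequentially by (intro exI[of _ N]) (auto simp: clip_def)
    qed
  qed measurable
  moreover have "to_L2 (\<lambda>x. indicator {0<..<l} x * rep_L2 v x) = v"
    using restrict_L2_id[OF _ v] by (simp add: restrict_L2_def)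
  ultimately obtain M :: nat where M: "norm (to_L2 (\<lambda>x. indicator {0<..<l} x * clip (real M) (rep_L2 v x)) - v) < e / 2"
    using e by (force dest!: LIMSEQ_D[where r = "e / 2"])
  obtain g where g: "\<And>n. continuous_on UNIV (g n)" "AE x in lborel. (\<lambda>n. g n x) \<longlonglongrightarrow> rep_L2 v x"
    using continuous_approximants[of "rep_L2 v"] by auto
  \<comment> \<open>A cut-off that is 0 at z and 1 from distance 1/n on.\<close>
  define h where "h n z x = min 1 (real n * \<bar>x - z\<bar>)" for n z x
  have h: "0 \<le> h n z x" "h n z x \<le> 1" "h n z z = 0" for n z x by (auto simp: h_def)
  define c where "c n x = clip (real M) (g n x) * (h n 0 x * h n l x) + a * (1 - h n 0 x) + b * (1 - h n l x)" for n x
  have c_cont: "continuous_on UNIV (c n)" for n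
    unfolding c_def h_def
    by (intro continuous_intros continuous_on_compose2[OF clip_cont] g) auto
  have [measurable]: "c n \<in> borel_measurable borel" for n
    by (rule borel_measurable_continuous_onI[OF c_cont])
  have "(\<lambda>n. to_L2 (\<lambda>x. indicator {0<..<l} x * c n x)) \<longlonglongrightarrow> to_L2 (\<lambda>x. indicator {0<..<l} x * clip (real M) (rep_L2 v x))"
  proof (rule to_L2_dominated_convergence_AE)
    show "sq_integrable (\<lambda>x. (M + \<bar>a\<bar> + \<bar>b\<bar>) * indicator {0<..<l} x)"
      by (intro sq_integrable_cmult sq_integrable_indicator_bounded) auto
    show "\<bar>indicator {0<..<l} x * c n x\<bar> \<le> (M + \<bar>a\<bar> + \<bar>b\<bar>) * indicator {0<..<l} x" for n x
    proof -
      have "\<bar>clip (real M) (g n x)\<bar> * (h n 0 x * h n l x) \<le> real M * (1 * 1)"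
        by (intro mult_mono clip_le h) (auto intro!: mult_nonneg_nonneg h)
      moreover have "\<bar>a\<bar> * (1 - h n 0 x) \<le> \<bar>a\<bar> * 1" "\<bar>b\<bar> * (1 - h n l x) \<le> \<bar>b\<bar> * 1"
        by (intro mult_left_mono; use h in auto)+
      moreover have "\<bar>c n x\<bar> \<le> \<bar>clip (real M) (g n x)\<bar> * (h n 0 x * h n l x) + \<bar>a\<bar> * (1 - h n 0 x) + \<bar>b\<bar> * (1 - h n l x)"
        unfolding c_def by (rule order_trans[OF abs_triangle_ineq add_mono[OF order_trans[OF abs_triangle_ineq]]])
          (auto simp: abs_mult h)
      ultimately have "\<bar>c n x\<bar> \<le> M + \<bar>a\<bar> + \<bar>b\<bar>" by linarith
      then show ?thesis by (auto simp: indicator_def)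
    qed
    show "AE x in lborel. (\<lambda>n. indicator {0<..<l} x * c n x) \<longlonglongrightarrow> indicator {0<..<l} x * clip (real M) (rep_L2 v x)"
      using g(2)
    proof eventually_elim
      case (elim x)
      show ?case
      proof (cases "x \<in> {0<..<l}")
        case True
        obtain N1 N2 where N: "1 / x \<le> real N1" "1 / (l - x) \<le> real N2" using real_arch_simple by metis
        have "(\<lambda>n. clip (real M) (g n x)) \<longlonglongrightarrow> clip (real M) (rep_L2 v x)"
          unfolding clip_def by (intro tendsto_intros elim)
        moreover have "\<forall>\<^sub>F n in sequentially. clip (real M) (g n x) = c n x"
          unfolding eventually_sequentially
        proof (intro exI[of _ "max N1 N2"] allI impI)
          fix n assume "max N1 N2 \<le> n"
          then have "1 / x \<le> real n" "1 / (l - x) \<le> real n" using N by linarith+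
          then have "h n 0 x = 1" "h n l x = 1" using True by (auto simp: h_def field_simps)
          then show "clip (real M) (g n x) = c n x" by (simp add: c_def)
        qed
        ultimately have "(\<lambda>n. c n x) \<longlonglongrightarrow> clip (real M) (rep_L2 v x)"
          by (rule Lim_transform_eventually)
        then show ?thesis using True by simp
      qed simp
    qed
  qed measurable
  then obtain N where N: "\<And>n. n \<ge> N \<Longrightarrow> norm (to_L2 (\<lambda>x. indicator {0<..<l} x * c n x) - to_L2 (\<lambda>x. indicator {0<..<l} x * clip (real M) (rep_L2 v x))) < e / 2"
    using e by (force dest!: LIMSEQ_D[where r = "e / 2"])
  \<comment> \<open>For n \<ge> 1/l neither boundary layer reaches the opposite end, so the end
    values are exactly a and b.\<close>
  obtain N' where N': "1 / l \<le> real N'" using real_arch_simple by blast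
  define n where "n = max N N'"
  have "1 / l \<le> real n" using N' by (simp add: n_def)
  then have "h n 0 l = 1" "h n l 0 = 1" using l by (auto simp: h_def field_simps)
  then have "c n 0 = a" "c n l = b" using h(3) by (auto simp: c_def)
  moreover have "norm (to_L2 (\<lambda>x. indicator {0<..<l} x * c n x) - v) < e"
    using N[of n] M by (intro norm_diff_triangle_less[where y = "to_L2 (\<lambda>x. indicator {0<..<l} x * clip (real M) (rep_L2 v x))" and ?e1.0 = "e / 2" and ?e2.0 = "e / 2", simplified])
       (auto simp: n_def)
  ultimately show thesis using c_cont that by blast
qed

text \<open>Weierstrass: a polynomial uniformly within d of the function from
  \<open>continuous_dense_L2\<close> is within d at both ends and within d * sqrt l in L^2(0,l). The
  independence of a, b and v is what makes \<open>HH1 l\<close> dense in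
  \<open>LL2 l\<close>.\<close>

lemma C1_dense_L2:
  fixes a b l :: real
  assumes l: "0 < l" and v: "v \<in> L2_on {0<..<l}" and e: "0 < e"
  obtains p p' where "\<And>x. (p has_real_derivative p' x) (at x)" "continuous_on UNIV p'"
    "\<bar>p 0 - a\<bar> < e" "\<bar>p l - b\<bar> < e" "norm (to_L2 (\<lambda>x. indicator {0<..<l} x * p x) - v) < e"
proof -
  obtain c where c: "continuous_on UNIV c" "c 0 = a" "c l = b"
    "norm (to_L2 (\<lambda>x. indicator {0<..<l} x * c x) - v) < e / 2"
    using continuous_dense_L2[OF l v, of "e / 2" a b] e by auto
  define d where "d = min (e / 2) (e / (2 * sqrt l))"
  have d: "0 < d" "d \<le> e / 2" "d * sqrt l \<le> e / 2"
    using e l by (auto simp: d_def min_def field_simps)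
  obtain p where p: "real_polynomial_function p" "\<And>x. x \<in> {0..l} \<Longrightarrow> \<bar>c x - p x\<bar> < d"
    using Stone_Weierstrass_real_polynomial_function[of "{0..l}" c d] c(1) d(1)
    by (auto intro: continuous_on_subset)
  obtain p' where p': "real_polynomial_function p'" "\<And>x. (p has_real_derivative p' x) (at x)"
    using has_real_derivative_polynomial_function[OF p(1)] by blast
  have pc: "continuous_on UNIV p" "continuous_on UNIV p'"
    using p' p(1) by (auto intro!: continuous_at_imp_continuous_on continuous_real_polymonial_function)
  have sq: "sq_integrable (\<lambda>x. indicator {0<..<l} x * f x)" if "continuous_on UNIV f" for f
    by (rule sq_integrable_indicator_continuous[of "{0..l}"]) (use that in \<open>auto intro: continuous_on_subset\<close>)
  have "to_L2 (\<lambda>x. indicator {0<..<l} x * p x) - to_L2 (\<lambda>x. indicator {0<..<l} x * c x)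
      = to_L2 (\<lambda>x. indicator {0<..<l} x * p x - indicator {0<..<l} x * c x)"
    by (intro to_L2_diff[symmetric] sq pc c)
  also have "norm \<dots> \<le> d * sqrt l"
    using p(2) d l by (intro norm_to_L2_le sq_integrable_diff sq pc c) (auto simp: abs_minus_commute less_imp_le)
  finally have "norm (to_L2 (\<lambda>x. indicator {0<..<l} x * p x) - to_L2 (\<lambda>x. indicator {0<..<l} x * c x)) \<le> e / 2"
    using d by linarith
  then have "norm (to_L2 (\<lambda>x. indicator {0<..<l} x * p x) - v) < e"
    using c(4) norm_diff_triangle_ineq[of "to_L2 (\<lambda>x. indicator {0<..<l} x * p x)" "to_L2 (\<lambda>x. indicator {0<..<l} x * c x)" "to_L2 (\<lambda>x. indicator {0<..<l} x * c x)" v]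
      norm_triangle_lt[of "to_L2 (\<lambda>x. indicator {0<..<l} x * p x) - to_L2 (\<lambda>x. indicator {0<..<l} x * c x)" "to_L2 (\<lambda>x. indicator {0<..<l} x * c x) - v" e]
    by simp
  moreover have "\<bar>p 0 - a\<bar> < e" "\<bar>p l - b\<bar> < e"
    using p(2)[of 0] p(2)[of l] c(2,3) d e l by auto
  ultimately show thesis using that[of p p'] p' pc by blast
qed

text \<open>Otherwise a C^1 function with class q closer to v than \<open>norm v\<close> would give
  (norm v)^2 = <v, v - q> < (norm v)^2.\<close>

lemma L2_on_eq_0I:
  assumes l: "0 < l" and v: "v \<in> L2_on {0<..<l}"
    and orth: "\<And>p p'. (\<And>x. (p has_real_derivative p' x) (at x)) \<Longrightarrow> continuous_on UNIV p' \<Longrightarrow>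
      v \<bullet> to_L2 (\<lambda>x. indicator {0<..<l} x * p x) = 0"
  shows "v = 0"
proof (rule ccontr)
  assume "v \<noteq> 0"
  then have v0: "0 < norm v" by simp
  obtain p p' where p: "\<And>x. (p has_real_derivative p' x) (at x)" "continuous_on UNIV p'"
    "norm (to_L2 (\<lambda>x. indicator {0<..<l} x * p x) - v) < norm v"
    by (rule C1_dense_L2[OF l v v0, of 0 0]) blast
  define q where "q = to_L2 (\<lambda>x. indicator {0<..<l} x * p x)"
  have "(norm v)\<^sup>2 = v \<bullet> (v - q)"
    using orth[OF p(1,2)] by (simp add: q_def inner_diff_right power2_norm_eq_inner)
  also have "\<dots> \<le> norm v * norm (v - q)" by (rule norm_cauchy_schwarz)
  also have "\<dots> < norm v * norm v"
    using p(3) \<open>v \<noteq> 0\<close> by (simp add: q_def norm_minus_commute)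
  finally show False by (simp add: power2_eq_square)
qed

subsection \<open>Weak derivatives and traces\<close>

text \<open>An antiderivative of q is constant on each side of the support. The vanishing integral
  makes the two constants equal, so subtracting that constant leaves compact support inside
  (0,l).\<close>

lemma test_function_antiderivative:
  assumes q: "continuous_on UNIV q" and ab: "0 < \<alpha>" "\<alpha> \<le> \<beta>" "\<beta> < l"
    and q0: "\<And>x. x \<notin> {\<alpha>..\<beta>} \<Longrightarrow> q x = 0" and int0: "(LINT x|lborel. indicator {0<..<l} x * q x) = 0"
  obtains \<psi> where "test_function l \<psi>" "deriv \<psi> = q"
proof -
  obtain F where F: "\<And>x. (F has_vector_derivative q x) (at x)"
    using einterval_antiderivative[of "-\<infinity>" \<infinity> q] q by (auto simp: continuous_on_eq_continuous_at)
  have F': "(F has_real_derivative q x) (at x within A)" for x A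
    using F[of x] by (simp add: has_real_derivative_iff_has_vector_derivative has_vector_derivative_at_within)
  have "\<exists>c. \<forall>x\<in>{..<\<alpha>}. F x = c"
    using F' q0 by (intro has_field_derivative_zero_constant) (auto, metis linorder_not_less)
  then have left: "F x = F 0" if "x < \<alpha>" for x using that ab by fastforce
  have "\<exists>c. \<forall>x\<in>{\<beta><..}. F x = c"
    using F' q0 by (intro has_field_derivative_zero_constant) (auto, metis linorder_not_less)
  then have right: "F x = F l" if "\<beta> < x" for x using that ab by fastforce
  have [measurable]: "q \<in> borel_measurable borel" using q by (rule borel_measurable_continuous_onI)
  have "F l - F 0 = (LINT x|lborel. q x * indicator {0..l} x)"
    using F' q ab by (intro integral_FTC_Icc_real[symmetric]) (auto simp: continuous_on_eq_continuous_at)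
  also have "\<dots> = (LINT x|lborel. indicator {0<..<l} x * q x)"
  proof (rule integral_cong_AE)
    show "AE x in lborel. q x * indicator {0..l} x = indicator {0<..<l} x * q x"
      using AE_lborel_singleton[of 0] AE_lborel_singleton[of l]
      by eventually_elim (auto simp: indicator_def)
  qed measurable
  finally have eq: "F l = F 0" using int0 by simp
  define \<psi> where "\<psi> x = F x - F 0" for x
  have d: "(\<psi> has_real_derivative q x) (at x)" for x
    unfolding \<psi>_def using F'[of x UNIV] by (auto intro!: derivative_eq_intros)
  have "\<psi> C1_differentiable_on UNIV"
    unfolding C1_differentiable_on_def
    by (intro exI[of _ q] conjI ballI q) (use d in \<open>simp add: has_real_derivative_iff_has_vector_derivative\<close>)
  moreover have "\<psi> x = 0" if "x \<notin> {\<alpha>..\<beta>}" for x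
    using that left[of x] right[of x] eq by (cases "x < \<alpha>") (auto simp: \<psi>_def)
  ultimately have "test_function l \<psi>" unfolding test_function_def using ab by blast
  moreover have "deriv \<psi> = q" using d by (auto intro!: DERIV_imp_deriv)
  ultimately show thesis by (rule that)
qed

lemma sq_integrable_indicator_continuous_Ioo:
  fixes f :: "real \<Rightarrow> real"
  shows "continuous_on {0..l} f \<Longrightarrow> sq_integrable (\<lambda>x. indicator {0<..<l} x * f x)"
  by (rule sq_integrable_indicator_continuous[of "{0..l}"]) auto

text \<open>Test functions are the antiderivatives of \<open>\<theta>\<^sub>n (p - c\<^sub>n)\<close>, where the cut-offs \<open>\<theta>\<^sub>n\<close> increase to \<open>1\<close> on \<open>(0,l)\<close>
  and \<open>c\<^sub>n\<close> makes the integral vanish; in the limit \<open>w\<close> minus its mean is orthogonal to every \<open>p\<close>.\<close>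

lemma du_bois_reymond:
  assumes l: "0 < l" and w: "w \<in> L2_on {0<..<l}"
    and test: "\<And>\<psi>. test_function l \<psi> \<Longrightarrow> (LINT x|lborel. indicator {0<..<l} x * (rep_L2 w x * deriv \<psi> x)) = 0"
  obtains k where "w = to_L2 (\<lambda>x. indicator {0<..<l} x * k)"
proof -
  define one where "one = to_L2 (\<lambda>x. indicator {0<..<l} x * (1::real))"
  \<comment> \<open>The mean of w over (0,l).\<close>
  define k where "k = (one \<bullet> w) / l"
  have sq: "sq_integrable (\<lambda>x. indicator {0<..<l} x * f x)" if "continuous_on UNIV f" for f :: "real \<Rightarrow> real"
    using that by (intro sq_integrable_indicator_continuous_Ioo) (auto intro: continuous_on_subset)
  have sq1: "sq_integrable (\<lambda>x. indicator {0<..<l} x * (1::real))" by (rule sq) auto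
  \<comment> \<open>For n > 0, \<theta> n is 0 within distance 1/n of the ends and 1 from distance
    2/n on.\<close>
  define \<theta> where "\<theta> n x = max 0 (min 1 (real n * x - 1)) * max 0 (min 1 (real n * (l - x) - 1))" for n x
  have \<theta>_cont: "continuous_on A (\<theta> n)" for A n unfolding \<theta>_def by (intro continuous_intros)
  have [measurable]: "\<theta> n \<in> borel_measurable borel" for n
    by (rule borel_measurable_continuous_onI[OF \<theta>_cont])
  have \<theta>_bd: "0 \<le> \<theta> n x" "\<theta> n x \<le> 1" for n x
    unfolding \<theta>_def by (auto intro!: mult_le_one)
  have \<theta>_lim: "(\<lambda>n. \<theta> n x) \<longlonglongrightarrow> 1" if x: "x \<in> {0<..<l}" for x
  proof (rule tendsto_eventually)
    obtain N1 N2 where N: "2 / x \<le> real N1" "2 / (l - x) \<le> real N2" using real_arch_simple by metis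
    show "\<forall>\<^sub>F n in sequentially. \<theta> n x = 1"
      unfolding eventually_sequentially
    proof (intro exI[of _ "max N1 N2"] allI impI)
      fix n assume "max N1 N2 \<le> n"
      then have "2 / x \<le> real n" "2 / (l - x) \<le> real n" using N by linarith+
      then have "2 \<le> real n * x" "2 \<le> real n * (l - x)" using x by (auto simp: field_simps)
      then show "\<theta> n x = 1" by (simp add: \<theta>_def)
    qed
  qed
  have orth: "(w - k *\<^sub>R one) \<bullet> to_L2 (\<lambda>x. indicator {0<..<l} x * p x) = 0"
    if p: "continuous_on UNIV p" for p
  proof -
    have [measurable]: "p \<in> borel_measurable borel" using p by (rule borel_measurable_continuous_onI)
    define P where "P = to_L2 (\<lambda>x. indicator {0<..<l} x * p x)"
    define A where "A n f = to_L2 (\<lambda>x. indicator {0<..<l} x * (\<theta> n x * f x))" for n f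
    have sqA: "sq_integrable (\<lambda>x. indicator {0<..<l} x * (\<theta> n x * f x))" if "continuous_on UNIV f" for n f
      using that by (intro sq continuous_intros \<theta>_cont)
    have A: "(\<lambda>n. A n f) \<longlonglongrightarrow> to_L2 (\<lambda>x. indicator {0<..<l} x * f x)" if f: "continuous_on UNIV f" for f
      unfolding A_def
    proof (rule to_L2_dominated_convergence)
      have [measurable]: "f \<in> borel_measurable borel" using f by (rule borel_measurable_continuous_onI)
      show "sq_integrable (\<lambda>x. indicator {0<..<l} x * \<bar>f x\<bar>)" by (intro sq continuous_intros f)
      show "\<bar>indicator {0<..<l} x * (\<theta> n x * f x)\<bar> \<le> indicator {0<..<l} x * \<bar>f x\<bar>" for n x
        using \<theta>_bd[of n x] by (auto simp: indicator_def abs_mult intro: mult_left_le_one_le)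
      show "(\<lambda>n. indicator {0<..<l} x * (\<theta> n x * f x)) \<longlonglongrightarrow> indicator {0<..<l} x * f x" for x
      proof (cases "x \<in> {0<..<l}")
        case True
        have "(\<lambda>n. \<theta> n x * f x) \<longlonglongrightarrow> 1 * f x" by (intro tendsto_intros \<theta>_lim True)
        then show ?thesis using True by simp
      qed simp
      show "(\<lambda>x. indicator {0<..<l} x * (\<theta> n x * f x)) \<in> borel_measurable lborel" for n by measurable
      show "(\<lambda>x. indicator {0<..<l} x * f x) \<in> borel_measurable lborel" by measurable
    qed
    have A1: "(\<lambda>n. A n (\<lambda>_. 1)) \<longlonglongrightarrow> one" and AP: "(\<lambda>n. A n p) \<longlonglongrightarrow> P"
      using A[of "\<lambda>_. 1"] A[OF p] by (auto simp: one_def P_def)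
    have one_one: "one \<bullet> one = l"
    proof -
      have "(\<lambda>x. indicator {0<..<l} x * 1 * (indicator {0<..<l} x * 1)) = (indicator {0<..<l} :: real \<Rightarrow> real)"
        by (auto simp: indicator_def)
      then show ?thesis using l by (simp only: one_def inner_to_L2_to_L2[OF sq1 sq1]) simp
    qed
    have m: "(\<lambda>n. one \<bullet> A n (\<lambda>_. 1)) \<longlonglongrightarrow> l"
      using tendsto_inner[OF tendsto_const A1, of one] by (simp add: one_one)
    \<comment> \<open>This quotient makes the integral of \<theta> n * (p - c n) vanish. Its
      denominator tends to l, hence is eventually positive.\<close>
    define c where "c n = (one \<bullet> A n p) / (one \<bullet> A n (\<lambda>_. 1))" for n
    have c: "c \<longlonglongrightarrow> (one \<bullet> P) / l"
      unfolding c_def using l by (intro tendsto_divide m tendsto_inner tendsto_const AP) auto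
    \<comment> \<open>Besides a positive denominator, n \<ge> 2/l is imposed, so that the interval
      from 1/n to l - 1/n is not empty.\<close>
    have ev: "\<forall>\<^sub>F n in sequentially. w \<bullet> A n p - c n * (w \<bullet> A n (\<lambda>_. 1)) = 0"
    proof -
      obtain N where N: "2 / l \<le> real N" using real_arch_simple by blast
      have "\<forall>\<^sub>F n in sequentially. 0 < one \<bullet> A n (\<lambda>_. 1)"
        using order_tendstoD(1)[OF m l] .
      moreover have "\<forall>\<^sub>F n in sequentially. N \<le> n" by (rule eventually_ge_at_top)
      ultimately show ?thesis
      proof eventually_elim
        case (elim n)
        have n: "2 / l \<le> real n" using elim N by linarith
        then have n0: "0 < real n" using l by (smt (verit) divide_pos_pos)
        define q where "q x = \<theta> n x * p x - c n * (\<theta> n x * 1)" for x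
        have qc: "continuous_on UNIV q" unfolding q_def by (intro continuous_intros \<theta>_cont p)
        have qA: "to_L2 (\<lambda>x. indicator {0<..<l} x * q x) = A n p - c n *\<^sub>R A n (\<lambda>_. 1)"
        proof -
          have "(\<lambda>x. indicator {0<..<l} x * q x) = (\<lambda>x. indicator {0<..<l} x * (\<theta> n x * p x) - c n * (indicator {0<..<l} x * (\<theta> n x * 1)))"
            by (auto simp: q_def algebra_simps)
          then show ?thesis
            using sqA[OF p] sqA[OF continuous_on_const[of _ 1]]
            by (simp only: A_def to_L2_diff sq_integrable_cmult to_L2_cmult)
        qed
        have "q x = 0" if "x \<notin> {1 / n..l - 1 / n}" for x
        proof -
          have "real n * x \<le> 1 \<or> real n * (l - x) \<le> 1"
            using that n0 by (auto simp: not_le field_simps)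
          then have "\<theta> n x = 0" by (auto simp: \<theta>_def)
          then show ?thesis by (simp add: q_def)
        qed
        moreover have "(LINT x|lborel. indicator {0<..<l} x * q x) = 0"
        proof -
          have "(LINT x|lborel. indicator {0<..<l} x * q x) = (LINT x|lborel. (indicator {0<..<l} x * 1) * (indicator {0<..<l} x * q x))"
            by (intro Bochner_Integration.integral_cong) (auto simp: indicator_def)
          also have "\<dots> = one \<bullet> (A n p - c n *\<^sub>R A n (\<lambda>_. 1))"
            unfolding qA[symmetric] one_def by (rule inner_to_L2_to_L2[symmetric, OF sq1 sq[OF qc]])
          also have "\<dots> = 0" using elim by (simp add: c_def inner_diff_right)
          finally show ?thesis .
        qed
        moreover have "1 / real n \<le> l - 1 / real n" "0 < 1 / real n" "l - 1 / real n < l"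
          using n n0 l by (auto simp: field_simps)
        ultimately obtain \<psi> where "test_function l \<psi>" "deriv \<psi> = q"
          using test_function_antiderivative[OF qc] by metis
        then have "0 = (LINT x|lborel. indicator {0<..<l} x * (rep_L2 w x * q x))" using test by metis
        also have "\<dots> = (LINT x|lborel. (indicator {0<..<l} x * q x) * rep_L2 w x)"
          by (simp add: mult_ac)
        also have "\<dots> = w \<bullet> (A n p - c n *\<^sub>R A n (\<lambda>_. 1))"
          unfolding qA[symmetric] inner_commute[of w] by (rule inner_to_L2[symmetric, OF sq[OF qc]])
        finally show ?case by (simp add: inner_diff_right)
      qed
    qed
    have "(\<lambda>n. w \<bullet> A n p - c n * (w \<bullet> A n (\<lambda>_. 1))) \<longlonglongrightarrow> w \<bullet> P - (one \<bullet> P) / l * (w \<bullet> one)"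
      by (intro tendsto_intros tendsto_inner AP A1 c)
    from tendsto_cong[THEN iffD1, OF ev this]
    have "w \<bullet> P = (one \<bullet> P) / l * (w \<bullet> one)" by (simp add: LIMSEQ_const_iff)
    then show ?thesis
      unfolding P_def[symmetric] k_def inner_diff_left inner_scaleR_left by (simp add: inner_commute)
  qed
  have "one \<in> L2_on {0<..<l}" unfolding one_def by (rule L2_on_to_L2[OF sq1]) simp
  then have "w - k *\<^sub>R one \<in> L2_on {0<..<l}" using w by (intro L2_on_diff L2_on_scale)
  then have "w - k *\<^sub>R one = 0"
  proof (rule L2_on_eq_0I[OF l])
    fix p p' :: "real \<Rightarrow> real" assume "\<And>x. (p has_real_derivative p' x) (at x)"
    then have "continuous_on UNIV p" by (meson DERIV_isCont continuous_at_imp_continuous_on)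
    then show "(w - k *\<^sub>R one) \<bullet> to_L2 (\<lambda>x. indicator {0<..<l} x * p x) = 0" by (rule orth)
  qed
  then have "w = to_L2 (\<lambda>x. k * (indicator {0<..<l} x * 1))"
    using to_L2_cmult[OF sq1, of k] by (simp add: one_def)
  then show thesis using that[of k] by (simp add: mult.commute)
qed

text \<open>The part of (0,l) where f differs from 0 is open and null, hence empty; the end points
  lie in the closure.\<close>

lemma continuous_AE_eq_0:
  fixes f :: "real \<Rightarrow> real"
  assumes l: "0 < l" and f: "continuous_on {0..l} f" and ae: "AE x in lborel. x \<in> {0<..<l} \<longrightarrow> f x = 0" and x: "x \<in> {0..l}"
  shows "f x = 0"
proof (rule continuous_constant_on_closure[of "{0<..<l}" f])
  show "continuous_on (closure {0<..<l}) f" "x \<in> closure {0<..<l}" using f l x by auto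
  fix y assume y: "y \<in> {0<..<l}"
  show "f y = 0"
  proof (rule ccontr)
    assume "f y \<noteq> 0"
    define U where "U = {0<..<l} \<inter> f -` (- {0})"
    have "open U" unfolding U_def
      by (rule continuous_open_preimage) (auto intro: continuous_on_subset[OF f])
    moreover have "y \<in> U" using y \<open>f y \<noteq> 0\<close> by (simp add: U_def)
    moreover have "negligible U"
    proof -
      have "AE x in lebesgue. x \<in> {0<..<l} \<longrightarrow> f x = 0" using ae by (simp add: AE_completion)
      then have "AE x in lebesgue. x \<notin> U" by eventually_elim (auto simp: U_def)
      moreover have "U \<in> sets lebesgue" using \<open>open U\<close> by (simp add: borel_open)
      ultimately show ?thesis by (simp add: negligible_iff_null_sets AE_iff_null_sets)
    qed
    ultimately show False using open_not_negligible by blast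
  qed
qed

text \<open>The element of \<open>H\<^sup>1(0,l)\<close> with value \<open>a\<close> at \<open>0\<close> and derivative \<open>g\<close>.\<close>

definition h1_fun :: "real \<Rightarrow> real \<Rightarrow> real L2 \<Rightarrow> real L2" where
  "h1_fun l a g = to_L2 (\<lambda>x. indicator {0<..<l} x * (a + primitive g x))"

lemma sq_integrable_h1_fun: "sq_integrable (\<lambda>x. indicator {0<..<l} x * (a + primitive g x))"
  by (intro sq_integrable_indicator_continuous_Ioo continuous_intros)

lemma h1_fun_L2_on [simp]: "h1_fun l a g \<in> L2_on {0<..<l}"
  unfolding h1_fun_def by (intro L2_on_to_L2 sq_integrable_h1_fun) simp

lemma rep_h1_fun: "AE x in lborel. rep_L2 (h1_fun l a g) x = indicator {0<..<l} x * (a + primitive g x)"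
  unfolding h1_fun_def by (rule rep_to_L2[OF sq_integrable_h1_fun])

lemma h1_fun_add: "h1_fun l (a + b) (g + h) = h1_fun l a g + h1_fun l b h"
proof -
  have "(\<lambda>x. indicator {0<..<l} x * (a + b + primitive (g + h) x))
      = (\<lambda>x. indicator {0<..<l} x * (a + primitive g x) + indicator {0<..<l} x * (b + primitive h x))"
    by (auto simp: primitive_add algebra_simps)
  then show ?thesis by (simp add: h1_fun_def to_L2_add sq_integrable_h1_fun)
qed

lemma h1_fun_scaleR: "h1_fun l (c * a) (c *\<^sub>R g) = c *\<^sub>R h1_fun l a g"
proof -
  have "(\<lambda>x. indicator {0<..<l} x * (c * a + primitive (c *\<^sub>R g) x))
      = (\<lambda>x. c * (indicator {0<..<l} x * (a + primitive g x)))"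
    by (auto simp: primitive_scaleR algebra_simps)
  then show ?thesis by (simp add: h1_fun_def to_L2_cmult sq_integrable_h1_fun)
qed

lemma h1_fun_diff: "h1_fun l (a - b) (g - h) = h1_fun l a g - h1_fun l b h"
  using h1_fun_add[of l a "-1 * b" g "-1 *\<^sub>R h"] h1_fun_scaleR[of l "-1" b h] by simp

lemma inner_h1_fun:
  "h1_fun l a g \<bullet> h = a * primitive h l + (LINT x|lborel. indicator {0<..<l} x * (rep_L2 h x * primitive g x))"
proof -
  have i: "integrable lborel (\<lambda>x. (indicator {0<..<l} x * primitive g x) * rep_L2 h x)"
    using sq_integrable_h1_fun[of l 0 g] by (intro sq_integrable_mult) auto
  have "h1_fun l a g \<bullet> h = (LINT x|lborel. (indicator {0<..<l} x * (a + primitive g x)) * rep_L2 h x)"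
    unfolding h1_fun_def by (rule inner_to_L2[OF sq_integrable_h1_fun])
  also have "\<dots> = (LINT x|lborel. a * (indicator {0<..<l} x * rep_L2 h x) + (indicator {0<..<l} x * primitive g x) * rep_L2 h x)"
    by (simp add: algebra_simps)
  also have "\<dots> = a * primitive h l + (LINT x|lborel. (indicator {0<..<l} x * primitive g x) * rep_L2 h x)"
    using i integrable_indicator_rep[of "{0<..<l}" h] by (simp add: primitive_eq)
  finally show ?thesis by (simp add: mult_ac)
qed

text \<open>With u = a + int g and v = b + int h, the right-hand side is the boundary term u(l) v(l)
  - u(0) v(0).\<close>

lemma h1_fun_by_parts:
  assumes "0 < l"
  shows "h1_fun l a g \<bullet> h + h1_fun l b h \<bullet> g = (a + primitive g l) * (b + primitive h l) - a * b"
  unfolding inner_h1_fun using primitive_by_parts[OF assms, of g h] by (simp add: algebra_simps)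

lemma to_L2_C1_eq_h1_fun:
  assumes f: "\<And>x. (f has_real_derivative f' x) (at x)" and f': "continuous_on UNIV f'"
  shows "to_L2 (\<lambda>x. indicator {0<..<l} x * f x) = h1_fun l (f 0) (to_L2 (\<lambda>x. indicator {0<..<l} x * f' x))"
proof -
  have "(\<lambda>x. indicator {0<..<l} x * f x) = (\<lambda>x. indicator {0<..<l} x * (f 0 + primitive (to_L2 (\<lambda>x. indicator {0<..<l} x * f' x)) x))"
  proof
    fix x show "indicator {0<..<l} x * f x = indicator {0<..<l} x * (f 0 + primitive (to_L2 (\<lambda>x. indicator {0<..<l} x * f' x)) x)"
      using primitive_derivative[OF f f', of x l] by (cases "x \<in> {0<..<l}") auto
  qed
  then show ?thesis by (simp add: h1_fun_def)
qed

text \<open>The continuous representative c + int d vanishes on all of [0,l], and x = 0 gives c = 0.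
  Integrating by parts against a C^1 function p then leaves d orthogonal to p, and density gives d =
  0.\<close>

lemma h1_fun_eq_0:
  assumes l: "0 < l" and d: "d \<in> L2_on {0<..<l}" and eq: "h1_fun l c d = 0"
  shows "d = 0" "c = 0"
proof -
  have ae: "AE x in lborel. x \<in> {0<..<l} \<longrightarrow> c + primitive d x = 0"
    using rep_h1_fun[of l c d] rep_zero unfolding eq by eventually_elim auto
  have z: "c + primitive d x = 0" if "x \<in> {0..l}" for x
    by (rule continuous_AE_eq_0[OF l _ ae that]) (intro continuous_intros)
  show c: "c = 0" using z[of 0] l by simp
  show "d = 0"
  proof (rule L2_on_eq_0I[OF l d])
    fix p p' :: "real \<Rightarrow> real"
    assume p: "\<And>x. (p has_real_derivative p' x) (at x)" "continuous_on UNIV p'"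
    let ?P = "to_L2 (\<lambda>x. indicator {0<..<l} x * p' x)"
    have "h1_fun l 0 d \<bullet> ?P + h1_fun l (p 0) ?P \<bullet> d = (0 + primitive d l) * (p 0 + primitive ?P l) - 0 * p 0"
      by (rule h1_fun_by_parts[OF l])
    then show "d \<bullet> to_L2 (\<lambda>x. indicator {0<..<l} x * p x) = 0"
      using z[of l] l c eq by (simp add: to_L2_C1_eq_h1_fun[OF p] inner_commute)
  qed
qed

lemma h1_fun_inj:
  assumes "0 < l" "g \<in> L2_on {0<..<l}" "h \<in> L2_on {0<..<l}" "h1_fun l a g = h1_fun l b h"
  shows "a = b" "g = h"
proof -
  have "h1_fun l (a - b) (g - h) = 0" using assms(4) by (simp add: h1_fun_diff)
  from h1_fun_eq_0[OF assms(1) L2_on_diff[OF assms(2,3)] this] show "a = b" "g = h" by simp_all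
qed

section \<open>Weak derivatives and traces in the coordinates (a, g)\<close>

lemma test_function_derivative:
  assumes "test_function l \<psi>"
  shows "(\<psi> has_real_derivative deriv \<psi> x) (at x)" "continuous_on UNIV (deriv \<psi>)"
proof -
  obtain D where D: "\<And>x. (\<psi> has_real_derivative D x) (at x)" "continuous_on UNIV D"
    using assms by (auto simp: test_function_def C1_differentiable_on_def has_real_derivative_iff_has_vector_derivative)
  then have "deriv \<psi> = D" by (auto intro: DERIV_imp_deriv)
  with D show "(\<psi> has_real_derivative deriv \<psi> x) (at x)" "continuous_on UNIV (deriv \<psi>)" by simp_all
qed

lemma h1_fun_test:
  assumes l: "0 < l" and \<psi>: "test_function l \<psi>"
  shows "(LINT x|lborel. indicator {0<..<l} x * (rep_L2 (h1_fun l a g) x * deriv \<psi> x))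
    = - (LINT x|lborel. indicator {0<..<l} x * (rep_L2 g x * \<psi> x))"
proof -
  note d = test_function_derivative[OF \<psi>]
  define h where "h = to_L2 (\<lambda>x. indicator {0<..<l} x * deriv \<psi> x)"
  have sq: "sq_integrable (\<lambda>x. indicator {0<..<l} x * deriv \<psi> x)"
    by (rule sq_integrable_indicator_continuous_Ioo) (auto intro: continuous_on_subset[OF d(2)])
  have \<psi>0: "\<psi> 0 = 0" "\<psi> l = 0" using \<psi> l by (auto simp: test_function_def)
  have "continuous_on UNIV \<psi>" using d(1) by (meson DERIV_isCont continuous_at_imp_continuous_on)
  then have sq\<psi>: "sq_integrable (\<lambda>x. indicator {0<..<l} x * \<psi> x)"
    by (intro sq_integrable_indicator_continuous_Ioo) (auto intro: continuous_on_subset)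
  have hl: "primitive h l = 0" using primitive_derivative[OF d, of l l] l \<psi>0 by (simp add: h_def)
  have "(LINT x|lborel. indicator {0<..<l} x * (rep_L2 (h1_fun l a g) x * deriv \<psi> x)) = h1_fun l a g \<bullet> h"
    unfolding h_def inner_commute[of "h1_fun l a g"] inner_to_L2[OF sq] by (simp add: mult_ac)
  also have "\<dots> = - (h1_fun l 0 h \<bullet> g)"
    using h1_fun_by_parts[OF l, of a g h 0] hl by simp
  also have "h1_fun l 0 h = to_L2 (\<lambda>x. indicator {0<..<l} x * \<psi> x)"
    using to_L2_C1_eq_h1_fun[OF d, of l] \<psi>0 by (simp add: h_def)
  also have "\<dots> \<bullet> g = (LINT x|lborel. indicator {0<..<l} x * (rep_L2 g x * \<psi> x))"
    unfolding inner_to_L2[OF sq\<psi>] by (simp add: mult_ac)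
  finally show ?thesis .
qed

text \<open>Subtracting a primitive of g from u leaves a function with weak derivative 0, which is
  constant by \<open>du_bois_reymond\<close>. This is the source of the coordinates (a, g) in which
  \<open>H1\<close>, \<open>weak_deriv\<close> and \<open>cont_rep\<close> are computed
  below.\<close>

lemma has_weak_deriv_iff:
  assumes l: "0 < l"
  shows "has_weak_deriv l u g \<longleftrightarrow> g \<in> L2_on {0<..<l} \<and> (\<exists>a. u = h1_fun l a g)"
proof
  assume "g \<in> L2_on {0<..<l} \<and> (\<exists>a. u = h1_fun l a g)"
  then show "has_weak_deriv l u g"
    using h1_fun_test[OF l] by (auto simp: has_weak_deriv_def set_lebesgue_integral_def)
next
  assume wd: "has_weak_deriv l u g"
  define w where "w = u - h1_fun l 0 g"
  have "w \<in> L2_on {0<..<l}" using wd by (simp add: w_def has_weak_deriv_def L2_on_diff)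
  moreover have "(LINT x|lborel. indicator {0<..<l} x * (rep_L2 w x * deriv \<psi> x)) = 0" if \<psi>: "test_function l \<psi>" for \<psi>
  proof -
    have sq: "sq_integrable (\<lambda>x. indicator {0<..<l} x * deriv \<psi> x)"
      by (rule sq_integrable_indicator_continuous_Ioo)
        (auto intro: continuous_on_subset[OF test_function_derivative(2)[OF \<psi>]])
    have eq: "(LINT x|lborel. indicator {0<..<l} x * (rep_L2 v x * deriv \<psi> x)) = to_L2 (\<lambda>x. indicator {0<..<l} x * deriv \<psi> x) \<bullet> v" for v
      unfolding inner_to_L2[OF sq] by (simp add: mult_ac)
    show ?thesis
      using wd \<psi> h1_fun_test[OF l \<psi>, of 0 g]
      unfolding eq w_def inner_diff_right has_weak_deriv_def set_lebesgue_integral_def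
      by (auto simp: eq)
  qed
  ultimately obtain k where k: "w = to_L2 (\<lambda>x. indicator {0<..<l} x * k)"
    using du_bois_reymond[OF l] by blast
  have "u = h1_fun l k 0 + h1_fun l 0 g" using k by (simp add: w_def h1_fun_def algebra_simps)
  also have "\<dots> = h1_fun l k g" using h1_fun_add[of l k 0 0 g] by simp
  finally show "g \<in> L2_on {0<..<l} \<and> (\<exists>a. u = h1_fun l a g)"
    using wd by (auto simp: has_weak_deriv_def)
qed

lemma weak_deriv_h1_fun:
  assumes "0 < l" "g \<in> L2_on {0<..<l}"
  shows "weak_deriv l (h1_fun l a g) = g"
  unfolding weak_deriv_def using assms h1_fun_inj(2)[OF assms(1)]
  by (intro the_equality) (auto simp: has_weak_deriv_iff)

lemma H1_eq: "0 < l \<Longrightarrow> H1 l = {h1_fun l a g | a g. g \<in> L2_on {0<..<l}}"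
  by (auto simp: H1_def has_weak_deriv_iff)

text \<open>\<open>cont_rep\<close> is an arbitrary choice, but two continuous functions on [0,l]
  that agree almost everywhere in (0,l) agree on [0,l], so its values there are determined.\<close>

lemma cont_rep_h1_fun:
  assumes l: "0 < l" and x: "x \<in> {0..l}"
  shows "cont_rep l (h1_fun l a g) x = a + primitive g x"
proof -
  let ?P = "\<lambda>c. continuous_on {0..l} c \<and> (AE x in lborel. x \<in> {0<..<l} \<longrightarrow> rep_L2 (h1_fun l a g) x = c x)"
  have "AE x in lborel. x \<in> {0<..<l} \<longrightarrow> rep_L2 (h1_fun l a g) x = a + primitive g x"
    using rep_h1_fun[of l a g] by eventually_elim simp
  then have P: "?P (\<lambda>x. a + primitive g x)" by (auto intro!: continuous_intros)
  then have Q: "?P (cont_rep l (h1_fun l a g))"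
    unfolding cont_rep_def by (rule someI[of ?P])
  have "cont_rep l (h1_fun l a g) x - (a + primitive g x) = 0"
  proof (rule continuous_AE_eq_0[OF l _ _ x])
    show "continuous_on {0..l} (\<lambda>x. cont_rep l (h1_fun l a g) x - (a + primitive g x))"
      using P Q by (intro continuous_on_diff) auto
    show "AE x in lborel. x \<in> {0<..<l} \<longrightarrow> cont_rep l (h1_fun l a g) x - (a + primitive g x) = 0"
      using P[THEN conjunct2] Q[THEN conjunct2] by eventually_elim auto
  qed
  then show ?thesis by simp
qed

section \<open>Triples with traces and the operator \<open>B_op\<close>\<close>

definition h1_triple :: "real \<Rightarrow> real \<Rightarrow> real L2 \<Rightarrow> triple" where
  "h1_triple l a g = (h1_fun l a g, a, a + primitive g l)"

lemma with_traces_h1_fun: "0 < l \<Longrightarrow> with_traces l (h1_fun l a g) = h1_triple l a g"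
  by (simp add: with_traces_def h1_triple_def cont_rep_h1_fun)

lemma HH1_eq: "0 < l \<Longrightarrow> HH1 l = {h1_triple l a g | a g. g \<in> L2_on {0<..<l}}"
  by (auto simp: HH1_def H1_eq with_traces_h1_fun image_iff) (metis with_traces_h1_fun)+

lemma h1_triple_add: "h1_triple l (a + b) (g + h) = h1_triple l a g + h1_triple l b h"
  by (simp add: h1_triple_def h1_fun_add primitive_add)

lemma h1_triple_scaleR: "h1_triple l (c * a) (c *\<^sub>R g) = c *\<^sub>R h1_triple l a g"
  by (simp add: h1_triple_def h1_fun_scaleR primitive_scaleR distrib_left)

text \<open>The coordinates are applied twice: a = u(0), c = u_x(0) and k = u_xx, whence u_x(l) = c
  + \<open>primitive k l\<close>.\<close>

lemma HH2_cases:
  assumes "0 < l" "U \<in> HH2 l"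
  obtains a c k where "k \<in> L2_on {0<..<l}" "U = h1_triple l a (h1_fun l c k)"
    "B_op l U = (k, c, - (c + primitive k l))"
proof -
  obtain u where u: "u \<in> H1 l" "weak_deriv l u \<in> H1 l" "U = with_traces l u"
    using assms(2) by (auto simp: HH2_def H2_def)
  obtain a g where g: "g \<in> L2_on {0<..<l}" "u = h1_fun l a g" using u(1) assms(1) by (auto simp: H1_eq)
  obtain c k where k: "k \<in> L2_on {0<..<l}" "g = h1_fun l c k"
    using u(2) assms(1) weak_deriv_h1_fun[OF assms(1) g(1)] by (auto simp: H1_eq g(2))
  show thesis
  proof (rule that[OF k(1)])
    show "U = h1_triple l a (h1_fun l c k)" using u g k assms(1) by (simp add: with_traces_h1_fun)
    show "B_op l U = (k, c, - (c + primitive k l))"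
      using assms(1) k(1)
      by (simp add: B_op_def u(3) with_traces_def g(2) k(2) weak_deriv_h1_fun cont_rep_h1_fun)
  qed
qed

text \<open>The boundary term u_x(l) v(l) - u_x(0) v(0) left by integration by parts cancels against
  the components u_x(0) and -u_x(l) of \<open>B_op l U\<close>, paired with the traces of v.\<close>

lemma inner_B_op:
  assumes l: "0 < l" and U: "U \<in> HH2 l" and V: "V \<in> HH1 l"
  shows "B_op l U \<bullet> V = - (weak_deriv l (fst U) \<bullet> weak_deriv l (fst V))"
proof -
  obtain a c k where k: "k \<in> L2_on {0<..<l}" "U = h1_triple l a (h1_fun l c k)" "B_op l U = (k, c, - (c + primitive k l))"
    using HH2_cases[OF l U] .
  obtain b h where h: "h \<in> L2_on {0<..<l}" "V = h1_triple l b h" using V l by (auto simp: HH1_eq)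
  have "B_op l U \<bullet> V = - (h1_fun l c k \<bullet> h)"
    unfolding k(3) h(2) h1_triple_def
    using h1_fun_by_parts[OF l, of b h k c] by (simp add: inner_prod_def inner_commute algebra_simps)
  then show ?thesis
    using l h(1) by (simp add: k(2) h(2) h1_triple_def weak_deriv_h1_fun)
qed

subsection \<open>The wave group\<close>

lemma subspace_LL2: "subspace (LL2 l)"
  unfolding LL2_def by (intro subspace_Times subspace_L2_on) simp

locale wave =
  fixes l :: real and S :: "real \<Rightarrow> state \<Rightarrow> state"
  assumes l_pos: "0 < l" and S: "wave_group l S"
begin

section \<open>Linear structure of the energy space\<close>

lemma energy_space_iff:
  "X \<in> energy_space l \<longleftrightarrow> (\<exists>a g V. X = (h1_triple l a g, V) \<and> g \<in> L2_on {0<..<l} \<and> V \<in> LL2 l)"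
  unfolding energy_space_def HH1_eq[OF l_pos] mem_Times_iff mem_Collect_eq
  by (metis prod.collapse fst_conv snd_conv)

lemma energy_embed_h1_triple:
  "g \<in> L2_on {0<..<l} \<Longrightarrow> energy_embed l (h1_triple l a g, V) = ((h1_triple l a g, V), g)"
  by (simp add: energy_embed_def h1_triple_def weak_deriv_h1_fun l_pos)

text \<open>\<open>weak_deriv\<close> is a definite description, so the embedding is known to be
  linear only where the derivatives exist; membership in the energy space therefore accompanies
  every use of linearity.\<close>

lemma energy_add:
  assumes "X \<in> energy_space l" "Y \<in> energy_space l"
  shows "X + Y \<in> energy_space l" "energy_embed l (X + Y) = energy_embed l X + energy_embed l Y"
proof -
  obtain a g V b h W where XY: "X = (h1_triple l a g, V)" "g \<in> L2_on {0<..<l}" "V \<in> LL2 l"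
      "Y = (h1_triple l b h, W)" "h \<in> L2_on {0<..<l}" "W \<in> LL2 l"
    using assms by (auto simp: energy_space_iff)
  then have "X + Y = (h1_triple l (a + b) (g + h), V + W)" "g + h \<in> L2_on {0<..<l}" "V + W \<in> LL2 l"
    by (simp_all add: h1_triple_add L2_on_add subspace_add[OF subspace_LL2])
  with XY show "X + Y \<in> energy_space l" "energy_embed l (X + Y) = energy_embed l X + energy_embed l Y"
    by (auto simp: energy_space_iff energy_embed_h1_triple)
qed

lemma energy_scaleR:
  assumes "X \<in> energy_space l"
  shows "c *\<^sub>R X \<in> energy_space l" "energy_embed l (c *\<^sub>R X) = c *\<^sub>R energy_embed l X"
proof -
  obtain a g V where X: "X = (h1_triple l a g, V)" "g \<in> L2_on {0<..<l}" "V \<in> LL2 l"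
    using assms by (auto simp: energy_space_iff)
  then have "c *\<^sub>R X = (h1_triple l (c * a) (c *\<^sub>R g), c *\<^sub>R V)" "c *\<^sub>R g \<in> L2_on {0<..<l}" "c *\<^sub>R V \<in> LL2 l"
    by (simp_all add: h1_triple_scaleR L2_on_scale subspace_scale[OF subspace_LL2])
  with X show "c *\<^sub>R X \<in> energy_space l" "energy_embed l (c *\<^sub>R X) = c *\<^sub>R energy_embed l X"
    by (auto simp: energy_space_iff energy_embed_h1_triple)
qed

lemma energy_diff:
  assumes "X \<in> energy_space l" "Y \<in> energy_space l"
  shows "X - Y \<in> energy_space l" "energy_embed l (X - Y) = energy_embed l X - energy_embed l Y"
  using energy_add[OF assms(1) energy_scaleR(1)[OF assms(2)], of "-1"] energy_scaleR(2)[OF assms(2), of "-1"]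
  by simp_all

lemma h1_triple_0: "h1_triple l 0 0 = 0"
  using h1_triple_scaleR[of l 0 0 0] by simp

text \<open>A kick is a state with displacement 0 and velocity V. Its derivative coordinate
  vanishes, so convergence of kicks in the energy norm is convergence of V in the norm of
  \<open>triple\<close>.\<close>

lemma energy_embed_kick: "energy_embed l (0, V) = ((0, V), 0)"
  using energy_embed_h1_triple[OF L2_on_0, of 0 V] by (simp add: h1_triple_0)

lemma kick_energy_space: "V \<in> LL2 l \<Longrightarrow> (0, V) \<in> energy_space l"
  using h1_triple_0 L2_on_0 by (auto simp: energy_space_iff)

lemma energy_norm_kick: "energy_norm l (0, V) = norm V"
  by (simp add: energy_norm_def energy_embed_kick norm_prod_def)

section \<open>Group laws, generator and orbits\<close>

lemma C0: "C0_group_on (energy_space l) (energy_norm l) S"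
  using S by (simp add: wave_group_def generates_C0_group_on_def)

lemma S_in: "X \<in> energy_space l \<Longrightarrow> S t X \<in> energy_space l"
  and S_add: "X \<in> energy_space l \<Longrightarrow> Y \<in> energy_space l \<Longrightarrow> S t (X + Y) = S t X + S t Y"
  and S_scaleR: "X \<in> energy_space l \<Longrightarrow> S t (c *\<^sub>R X) = c *\<^sub>R S t X"
  and S_0: "X \<in> energy_space l \<Longrightarrow> S 0 X = X"
  and S_group: "X \<in> energy_space l \<Longrightarrow> S (s + t) X = S s (S t X)"
  and S_strong: "X \<in> energy_space l \<Longrightarrow> ((\<lambda>t. energy_norm l (S t X - X)) \<longlongrightarrow> 0) (at 0)"
  using C0 unfolding C0_group_on_def by blast+

lemma S_bound: "\<exists>K. \<forall>X\<in>energy_space l. energy_norm l (S t X) \<le> K * energy_norm l X"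
  using C0 unfolding C0_group_on_def by blast

lemma S_diff: "X \<in> energy_space l \<Longrightarrow> Y \<in> energy_space l \<Longrightarrow> S t (X - Y) = S t X - S t Y"
  using S_add[OF _ energy_scaleR(1), of X Y t "-1"] S_scaleR[of Y t "-1"] by simp

text \<open>The equality of graphs in pointwise form. It is read from right to left to obtain
  difference quotients, and from left to right to prove membership in the domain.\<close>

lemma generator:
  "X \<in> energy_space l \<and> Y \<in> energy_space l \<and> ((\<lambda>h. energy_norm l ((1 / h) *\<^sub>R (S h X - X) - Y)) \<longlongrightarrow> 0) (at 0)
    \<longleftrightarrow> X \<in> A_dom l \<and> Y = A_op l X"
proof -
  have "{(x, y). x \<in> energy_space l \<and> y \<in> energy_space l \<and> ((\<lambda>h. energy_norm l ((1 / h) *\<^sub>R (S h x - x) - y)) \<longlongrightarrow> 0) (at 0)}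
       = {(x, A_op l x) | x. x \<in> A_dom l}"
    using S by (simp add: wave_group_def generates_C0_group_on_def)
  then have "(X, Y) \<in> {(x, y). x \<in> energy_space l \<and> y \<in> energy_space l \<and> ((\<lambda>h. energy_norm l ((1 / h) *\<^sub>R (S h x - x) - y)) \<longlongrightarrow> 0) (at 0)}
     \<longleftrightarrow> (X, Y) \<in> {(x, A_op l x) | x. x \<in> A_dom l}" by (rule arg_cong)
  then show ?thesis by (simp only: mem_Collect_eq case_prod_conv prod.inject) blast
qed

lemma A_dom_energy_space: "X \<in> A_dom l \<Longrightarrow> X \<in> energy_space l"
  and A_op_energy_space: "X \<in> A_dom l \<Longrightarrow> A_op l X \<in> energy_space l"
  using generator[of X "A_op l X"] by blast+

lemma S_tendsto:
  assumes X: "X \<in> energy_space l" "\<And>n. Xs n \<in> energy_space l"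
    and lim: "((\<lambda>n. energy_norm l (Xs n - X)) \<longlongrightarrow> 0) F"
  shows "((\<lambda>n. energy_embed l (S t (Xs n))) \<longlongrightarrow> energy_embed l (S t X)) F"
proof -
  obtain K where K: "\<And>X. X \<in> energy_space l \<Longrightarrow> energy_norm l (S t X) \<le> K * energy_norm l X"
    using S_bound by blast
  have "((\<lambda>n. energy_embed l (S t (Xs n)) - energy_embed l (S t X)) \<longlongrightarrow> 0) F"
  proof (rule Lim_null_comparison)
    show "((\<lambda>n. K * energy_norm l (Xs n - X)) \<longlongrightarrow> 0) F" using tendsto_mult_left[OF lim, of K] by simp
    have "energy_embed l (S t (Xs n)) - energy_embed l (S t X) = energy_embed l (S t (Xs n - X))" for n
      using X by (simp add: S_diff energy_diff S_in)
    then show "\<forall>\<^sub>F n in F. norm (energy_embed l (S t (Xs n)) - energy_embed l (S t X)) \<le> K * energy_norm l (Xs n - X)"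
      using K[OF energy_diff(1)[OF X(2) X(1)]] by (simp add: energy_norm_def)
  qed
  then show ?thesis by (simp add: LIM_zero_iff)
qed

text \<open>In S (t + h) = S t (S h) the outer operator stays fixed, so strong continuity at 0 and
  the bound for this single \<open>S t\<close> suffice.\<close>

lemma orbit_continuous:
  assumes X: "X \<in> energy_space l"
  shows "isCont (\<lambda>t. energy_embed l (S t X)) t"
proof -
  have "((\<lambda>h. energy_embed l (S t (S h X))) \<longlongrightarrow> energy_embed l (S t X)) (at 0)"
    using X by (intro S_tendsto S_in S_strong)
  then show ?thesis
    using X by (simp add: isCont_iff S_group)
qed

text \<open>\<open>S t\<close> commutes with the difference quotients of the orbit and is bounded,
  so the quotients at \<open>S t X\<close> converge to \<open>S t (A_op l X)\<close>;
  \<open>generator\<close> then yields both claims.\<close>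

lemma A_dom_invariant:
  assumes X: "X \<in> A_dom l"
  shows "S t X \<in> A_dom l" "A_op l (S t X) = S t (A_op l X)"
proof -
  note XH = A_dom_energy_space[OF X] and AH = A_op_energy_space[OF X]
  let ?q = "\<lambda>h. (1 / h) *\<^sub>R (S h X - X)"
  have q: "?q h \<in> energy_space l" for h
    using XH by (intro energy_scaleR energy_diff S_in)
  have "((\<lambda>h. energy_norm l (?q h - A_op l X)) \<longlongrightarrow> 0) (at 0)"
    using generator[of X "A_op l X"] X by blast
  then have "((\<lambda>h. energy_embed l (S t (?q h))) \<longlongrightarrow> energy_embed l (S t (A_op l X))) (at 0)"
    using q by (intro S_tendsto AH)
  then have "((\<lambda>h. energy_embed l (S t (?q h)) - energy_embed l (S t (A_op l X))) \<longlongrightarrow> 0) (at 0)"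
    by (simp add: LIM_zero_iff)
  moreover have "energy_embed l (S t (?q h)) - energy_embed l (S t (A_op l X))
      = energy_embed l ((1 / h) *\<^sub>R (S h (S t X) - S t X) - S t (A_op l X))" for h
  proof -
    have "S t (?q h) = (1 / h) *\<^sub>R (S h (S t X) - S t X)"
      using XH by (simp add: S_scaleR energy_diff S_in S_diff S_group[symmetric] add.commute)
    then show ?thesis using q AH by (metis energy_diff(2) S_in)
  qed
  ultimately have "((\<lambda>h. energy_norm l ((1 / h) *\<^sub>R (S h (S t X) - S t X) - S t (A_op l X))) \<longlongrightarrow> 0) (at 0)"
    by (simp add: energy_norm_def tendsto_norm_zero_iff)
  then have "S t X \<in> A_dom l \<and> S t (A_op l X) = A_op l (S t X)"
    using XH AH by (subst generator[symmetric]) (simp add: S_in)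
  then show "S t X \<in> A_dom l" "A_op l (S t X) = S t (A_op l X)" by simp_all
qed

lemma orbit_derivative:
  assumes X: "X \<in> A_dom l"
  shows "((\<lambda>t. energy_embed l (S t X)) has_vector_derivative energy_embed l (A_op l (S t X))) (at t)"
proof -
  note XH = A_dom_energy_space[OF X]
  let ?f = "\<lambda>t. energy_embed l (S t X)" and ?D = "energy_embed l (A_op l (S t X))"
  note Y = A_dom_invariant(1)[OF X, of t]
  note YH = A_dom_energy_space[OF Y] and AH = A_op_energy_space[OF Y]
  have lim: "((\<lambda>h. energy_norm l ((1 / h) *\<^sub>R (S h (S t X) - S t X) - A_op l (S t X))) \<longlongrightarrow> 0) (at 0)"
    using generator[of "S t X" "A_op l (S t X)"] Y by blast
  have eq: "energy_norm l ((1 / h) *\<^sub>R (S h (S t X) - S t X) - A_op l (S t X)) = norm (?f (t + h) - ?f t - h *\<^sub>R ?D) / norm h"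
    if "h \<noteq> 0" for h
  proof -
    have "energy_embed l ((1 / h) *\<^sub>R (S h (S t X) - S t X) - A_op l (S t X)) = (1 / h) *\<^sub>R (?f (t + h) - ?f t) - ?D"
      using YH AH XH by (simp add: energy_diff energy_scaleR S_in S_group[symmetric] add.commute)
    also have "\<dots> = (1 / h) *\<^sub>R (?f (t + h) - ?f t - h *\<^sub>R ?D)"
      using that by (simp add: scaleR_diff_right)
    finally show ?thesis by (simp add: energy_norm_def)
  qed
  have "((\<lambda>h. norm (?f (t + h) - ?f t - h *\<^sub>R ?D) / norm h) \<longlongrightarrow> 0) (at 0)"
    by (rule Lim_transform_eventually[OF lim]) (simp add: eventually_at_filter eq)
  then show ?thesis
    by (simp add: has_vector_derivative_def has_derivative_at bounded_linear_scaleR_left)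
qed

text \<open>All three are continuous linear images of the derivative of the embedded orbit. The time
  derivative of u_x is available because the embedding carries u_x as its last coordinate.\<close>

lemma orbit_component_derivatives:
  assumes X: "X \<in> A_dom l"
  shows "((\<lambda>t. fst (S t X)) has_vector_derivative snd (S t X)) (at t)"
    and "((\<lambda>t. snd (S t X)) has_vector_derivative B_op l (fst (S t X))) (at t)"
    and "((\<lambda>t. weak_deriv l (fst (fst (S t X)))) has_vector_derivative weak_deriv l (fst (snd (S t X)))) (at t)"
proof -
  have A: "A_op l Y = (snd Y, B_op l (fst Y))" for Y by (simp add: A_op_def case_prod_beta)
  note d = orbit_derivative[OF X, of t]
  show "((\<lambda>t. fst (S t X)) has_vector_derivative snd (S t X)) (at t)"
    using bounded_linear.has_vector_derivative[OF bounded_linear_compose[OF bounded_linear_fst bounded_linear_fst] d]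
    by (simp add: energy_embed_def A)
  show "((\<lambda>t. snd (S t X)) has_vector_derivative B_op l (fst (S t X))) (at t)"
    using bounded_linear.has_vector_derivative[OF bounded_linear_compose[OF bounded_linear_snd bounded_linear_fst] d]
    by (simp add: energy_embed_def A)
  show "((\<lambda>t. weak_deriv l (fst (fst (S t X)))) has_vector_derivative weak_deriv l (fst (snd (S t X)))) (at t)"
    using bounded_linear.has_vector_derivative[OF bounded_linear_snd d]
    by (simp add: energy_embed_def A)
qed

section \<open>Conservation laws\<close>

lemma HH2_subset_HH1: "HH2 l \<subseteq> HH1 l"
  by (auto simp: HH1_def HH2_def H2_def)

lemma A_domD:
  assumes "X \<in> A_dom l"
  shows "fst X \<in> HH2 l" "fst X \<in> HH1 l" "snd X \<in> HH1 l"
  using assms HH2_subset_HH1 by (auto simp: A_dom_def)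

text \<open>In the time derivative the products of the two velocities cancel, and the two terms with
  \<open>B_op\<close> agree by its symmetry, both being -<u_x, p_x>.\<close>

lemma symplectic_invariant:
  assumes X: "X \<in> A_dom l" and P: "P \<in> A_dom l"
  shows "fst (S t X) \<bullet> snd (S t P) - snd (S t X) \<bullet> fst (S t P) = fst X \<bullet> snd P - snd X \<bullet> fst P"
proof -
  let ?\<sigma> = "\<lambda>t. fst (S t X) \<bullet> snd (S t P) - snd (S t X) \<bullet> fst (S t P)"
  note dX = orbit_component_derivatives[OF X] and dP = orbit_component_derivatives[OF P]
  have "(?\<sigma> has_vector_derivative 0) (at t)" for t
  proof -
    note X' = A_domD[OF A_dom_invariant(1)[OF X, of t]] and P' = A_domD[OF A_dom_invariant(1)[OF P, of t]]
    have "B_op l (fst (S t X)) \<bullet> fst (S t P) = fst (S t X) \<bullet> B_op l (fst (S t P))"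
      using inner_B_op[OF l_pos X'(1) P'(2)] inner_B_op[OF l_pos P'(1) X'(2)]
      by (simp add: inner_commute)
    moreover have "(?\<sigma> has_vector_derivative
        (fst (S t X) \<bullet> B_op l (fst (S t P)) + snd (S t X) \<bullet> snd (S t P))
        - (snd (S t X) \<bullet> snd (S t P) + B_op l (fst (S t X)) \<bullet> fst (S t P))) (at t)"
      by (intro has_vector_derivative_diff bounded_bilinear.has_vector_derivative[OF bounded_bilinear_inner] dX dP)
    ultimately show ?thesis by simp
  qed
  then have "\<forall>t. (?\<sigma> has_real_derivative 0) (at t)" by (simp add: has_real_derivative_iff_has_vector_derivative)
  then have "?\<sigma> t = ?\<sigma> 0" by (rule DERIV_isconst_all)
  then show ?thesis using X P by (simp add: S_0 A_dom_energy_space)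
qed

text \<open>By \<open>inner_B_op\<close>, half the squared norm of the velocity changes at the rate
  -<u_x, (u_x)_t>, the opposite of the rate for half the squared norm of u_x.\<close>

lemma energy_conserved:
  assumes X: "X \<in> A_dom l"
  shows "(norm (snd (S t X)))\<^sup>2 + (norm (weak_deriv l (fst (fst (S t X)))))\<^sup>2
    = (norm (snd X))\<^sup>2 + (norm (weak_deriv l (fst (fst X))))\<^sup>2"
proof -
  let ?w = "\<lambda>t. weak_deriv l (fst (fst (S t X)))"
  let ?E = "\<lambda>t. snd (S t X) \<bullet> snd (S t X) + ?w t \<bullet> ?w t"
  note dX = orbit_component_derivatives[OF X]
  have "(?E has_vector_derivative 0) (at t)" for t
  proof -
    note X' = A_domD[OF A_dom_invariant(1)[OF X, of t]]
    have "B_op l (fst (S t X)) \<bullet> snd (S t X) = - (?w t \<bullet> weak_deriv l (fst (snd (S t X))))"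
      by (rule inner_B_op[OF l_pos X'(1,3)])
    moreover have "(?E has_vector_derivative
        (snd (S t X) \<bullet> B_op l (fst (S t X)) + B_op l (fst (S t X)) \<bullet> snd (S t X))
        + (?w t \<bullet> weak_deriv l (fst (snd (S t X))) + weak_deriv l (fst (snd (S t X))) \<bullet> ?w t)) (at t)"
      by (intro has_vector_derivative_add bounded_bilinear.has_vector_derivative[OF bounded_bilinear_inner] dX)
    ultimately show ?thesis by (simp add: inner_commute)
  qed
  then have "\<forall>t. (?E has_real_derivative 0) (at t)" by (simp add: has_real_derivative_iff_has_vector_derivative)
  then have "?E t = ?E 0" by (rule DERIV_isconst_all)
  then show ?thesis using X by (simp add: S_0 A_dom_energy_space power2_norm_eq_inner)
qed

section \<open>Kicks: density, growth and adjoint\<close>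

lemma kick_A_dom:
  assumes "V \<in> HH1 l"
  shows "(0, V) \<in> A_dom l"
proof -
  have z: "h1_fun l 0 0 = 0" using h1_fun_scaleR[of l 0 0 0] by simp
  have "0 \<in> H1 l" using H1_eq[OF l_pos] z L2_on_0 by (metis (mono_tags, lifting) mem_Collect_eq)
  then have "0 \<in> H2 l" using weak_deriv_h1_fun[OF l_pos L2_on_0, of 0] z by (simp add: H2_def)
  moreover have "with_traces l 0 = 0" using with_traces_h1_fun[OF l_pos, of 0 0] z h1_triple_0 by simp
  ultimately have "0 \<in> HH2 l" unfolding HH2_def by (metis imageI)
  with assms show ?thesis by (simp add: A_dom_def)
qed

lemma HH1_dense:
  assumes V: "V \<in> LL2 l" and e: "0 < e"
  obtains W where "W \<in> HH1 l" "norm (W - V) < e"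
proof -
  obtain v a b where V': "V = (v, a, b)" "v \<in> L2_on {0<..<l}" using V by (cases V) (auto simp: LL2_def)
  have e3: "0 < e / 3" using e by simp
  obtain p p' where p: "\<And>x. (p has_real_derivative p' x) (at x)" "continuous_on UNIV p'"
    "\<bar>p 0 - a\<bar> < e / 3" "\<bar>p l - b\<bar> < e / 3" "norm (to_L2 (\<lambda>x. indicator {0<..<l} x * p x) - v) < e / 3"
    by (rule C1_dense_L2[OF l_pos V'(2) e3, of a b]) blast
  define g where "g = to_L2 (\<lambda>x. indicator {0<..<l} x * p' x)"
  have sq: "sq_integrable (\<lambda>x. indicator {0<..<l} x * p' x)"
    by (rule sq_integrable_indicator_continuous_Ioo) (auto intro: continuous_on_subset[OF p(2)])
  have g: "g \<in> L2_on {0<..<l}" unfolding g_def by (rule L2_on_to_L2[OF sq]) simp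
  have W: "h1_triple l (p 0) g = (to_L2 (\<lambda>x. indicator {0<..<l} x * p x), p 0, p l)"
    using primitive_derivative[OF p(1,2), of l l] l_pos to_L2_C1_eq_h1_fun[OF p(1,2), of l]
    by (simp add: h1_triple_def g_def)
  have "norm (h1_triple l (p 0) g - V) \<le> norm (to_L2 (\<lambda>x. indicator {0<..<l} x * p x) - v) + (\<bar>p 0 - a\<bar> + \<bar>p l - b\<bar>)"
    unfolding W V'(1) by (simp, intro order_trans[OF norm_Pair_le] add_left_mono order_trans[OF norm_Pair_le]) simp
  also have "\<dots> < e" using p(3-5) by simp
  finally have "norm (h1_triple l (p 0) g - V) < e" .
  moreover have "h1_triple l (p 0) g \<in> HH1 l" unfolding HH1_eq[OF l_pos] using g by blast
  ultimately show thesis using that by blast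
qed

lemma HH1_approximants:
  assumes "V \<in> LL2 l"
  obtains W where "\<And>n. W n \<in> HH1 l" "W \<longlonglongrightarrow> V"
proof -
  have "\<exists>W. W \<in> HH1 l \<and> norm (W - V) < 1 / real (Suc n)" for n
    by (rule HH1_dense[OF assms, of "1 / real (Suc n)"]) (simp, blast)
  then obtain W where W: "\<And>n. W n \<in> HH1 l" "\<And>n. norm (W n - V) < 1 / real (Suc n)" by metis
  have "(\<lambda>n. W n - V) \<longlonglongrightarrow> 0"
    by (rule Lim_null_comparison[OF _ LIMSEQ_Suc[OF lim_1_over_n]]) (use W(2) in \<open>auto intro!: always_eventually less_imp_le\<close>)
  then have "W \<longlonglongrightarrow> V" by (simp add: LIM_zero_iff)
  then show thesis using that W(1) by blast
qed

lemma HH1_LL2: "V \<in> HH1 l \<Longrightarrow> V \<in> LL2 l"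
  using l_pos by (auto simp: HH1_eq h1_triple_def LL2_def)

lemma kick_tendsto:
  assumes V: "V \<in> LL2 l" "\<And>n. W n \<in> LL2 l" and lim: "W \<longlonglongrightarrow> V"
  shows "(\<lambda>n. energy_embed l (S t (0, W n))) \<longlonglongrightarrow> energy_embed l (S t (0, V))"
proof (intro S_tendsto kick_energy_space V)
  have "(\<lambda>n. norm (W n - V)) \<longlonglongrightarrow> 0" using lim by (simp add: LIM_zero_iff tendsto_norm_zero_iff)
  then show "(\<lambda>n. energy_norm l ((0, W n) - (0, V))) \<longlonglongrightarrow> 0" by (simp add: energy_norm_kick)
qed

lemma fst_embed: "fst (energy_embed l X) = X"
  by (simp add: energy_embed_def)

text \<open>The energy is (norm V)^2 for all times and bounds the velocity and u_x, but not the
  displacement: constants have u_x = 0. The displacement starts at 0, so the mean value inequality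
  bounds it by |t| * norm V, and t^2 + 1 \<le> (|t| + 1)^2.\<close>

lemma kick_bound_HH1:
  assumes V: "V \<in> HH1 l"
  shows "energy_norm l (S t (0, V)) \<le> (\<bar>t\<bar> + 1) * norm V"
proof -
  note X = kick_A_dom[OF V]
  have wd0: "weak_deriv l 0 = 0" using energy_embed_kick[of V] by (simp add: energy_embed_def)
  have E: "(norm (snd (S t (0, V))))\<^sup>2 + (norm (weak_deriv l (fst (fst (S t (0, V))))))\<^sup>2 = (norm V)\<^sup>2" for t
    using energy_conserved[OF X, of t] by (simp add: wd0)
  have snd_le: "norm (snd (S t (0, V))) \<le> norm V" for t
  proof (rule power2_le_imp_le)
    show "(norm (snd (S t (0, V))))\<^sup>2 \<le> (norm V)\<^sup>2" unfolding E[of t, symmetric] by simp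
  qed simp
  have "norm (fst (S t (0, V)) - fst (S 0 (0, V))) \<le> norm V * norm (t - 0)"
  proof (rule differentiable_bound[where S = UNIV])
    show "((\<lambda>t. fst (S t (0, V))) has_derivative (\<lambda>h. h *\<^sub>R snd (S t (0, V)))) (at t within UNIV)" for t
      using orbit_component_derivatives(1)[OF X] by (simp add: has_vector_derivative_def)
    show "onorm (\<lambda>h. h *\<^sub>R snd (S t (0, V))) \<le> norm V" for t
      using snd_le[of t] by (intro onorm_le) (simp add: mult.commute[of "norm V"] mult_left_mono)
  qed auto
  then have fst_le: "norm (fst (S t (0, V))) \<le> norm V * \<bar>t\<bar>"
    using X by (simp add: S_0 A_dom_energy_space)
  let ?Y = "S t (0, V)"
  have "(energy_norm l ?Y)\<^sup>2 = (norm (fst ?Y))\<^sup>2 + ((norm (snd ?Y))\<^sup>2 + (norm (weak_deriv l (fst (fst ?Y))))\<^sup>2)"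
    by (simp add: energy_norm_def energy_embed_def norm_prod_def)
  also have "\<dots> \<le> (norm V * \<bar>t\<bar>)\<^sup>2 + (norm V)\<^sup>2"
    using fst_le by (simp add: E power_mono)
  also have "\<dots> \<le> ((\<bar>t\<bar> + 1) * norm V)\<^sup>2"
    by (simp add: power2_eq_square algebra_simps)
  finally show ?thesis by (rule power2_le_imp_le) simp
qed

lemma kick_bound:
  assumes V: "V \<in> LL2 l"
  shows "norm (energy_embed l (S t (0, V))) \<le> (\<bar>t\<bar> + 1) * norm V"
proof -
  obtain W where W: "\<And>n. W n \<in> HH1 l" "W \<longlonglongrightarrow> V" using HH1_approximants[OF V] by blast
  show ?thesis
  proof (rule LIMSEQ_le)
    show "(\<lambda>n. norm (energy_embed l (S t (0, W n)))) \<longlonglongrightarrow> norm (energy_embed l (S t (0, V)))"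
      using W V by (intro tendsto_norm kick_tendsto) (auto intro: HH1_LL2)
    show "(\<lambda>n. (\<bar>t\<bar> + 1) * norm (W n)) \<longlonglongrightarrow> (\<bar>t\<bar> + 1) * norm V" by (intro tendsto_intros W)
    show "\<exists>N. \<forall>n\<ge>N. norm (energy_embed l (S t (0, W n))) \<le> (\<bar>t\<bar> + 1) * norm (W n)"
      using kick_bound_HH1[OF W(1)] by (auto simp: energy_norm_def)
  qed
qed

text \<open>For V and R in \<open>HH1 l\<close>, compare the orbit of (0, V) with the orbit that
  arrives at (0, R) at time t. One displacement vanishes at each end of the time interval, so each
  side of the symplectic identity keeps one term. Both terms are continuous in V and R, and density
  extends the identity.\<close>

lemma kick_adjoint:
  assumes V: "V \<in> LL2 l" and R: "R \<in> LL2 l"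
  shows "fst (S t (0, V)) \<bullet> R = - (V \<bullet> fst (S (- t) (0, R)))"
proof -
  have smooth: "fst (S t (0, V)) \<bullet> R = - (V \<bullet> fst (S (- t) (0, R)))" if "V \<in> HH1 l" "R \<in> HH1 l" for V R
  proof -
    note X = kick_A_dom[OF that(1)] and P = kick_A_dom[OF that(2)]
    have "S t (S (- t) (0, R)) = (0, R)"
      using S_group[of "(0, R)" t "- t"] S_0 A_dom_energy_space[OF P] by simp
    then show ?thesis using symplectic_invariant[OF X A_dom_invariant(1)[OF P, of "- t"], of t] by simp
  qed
  obtain W where W: "\<And>n. W n \<in> HH1 l" "W \<longlonglongrightarrow> V" using HH1_approximants[OF V] by blast
  obtain Q where Q: "\<And>n. Q n \<in> HH1 l" "Q \<longlonglongrightarrow> R" using HH1_approximants[OF R] by blast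
  have lim: "(\<lambda>n. fst (S t (0, W n))) \<longlonglongrightarrow> fst (S t (0, V))" if "\<And>n. W n \<in> HH1 l" "W \<longlonglongrightarrow> V" "V \<in> LL2 l" for t W V
    using tendsto_fst[OF tendsto_fst[OF kick_tendsto[OF that(3) HH1_LL2[OF that(1)] that(2), of t]]]
    by (simp add: fst_embed)
  have "(\<lambda>n. fst (S t (0, W n)) \<bullet> Q n) \<longlonglongrightarrow> fst (S t (0, V)) \<bullet> R"
    by (intro tendsto_inner lim[OF W V] Q)
  moreover have "(\<lambda>n. fst (S t (0, W n)) \<bullet> Q n) \<longlonglongrightarrow> - (V \<bullet> fst (S (- t) (0, R)))"
    unfolding smooth[OF W(1) Q(1)] by (intro tendsto_intros tendsto_inner lim[OF Q R] W)
  ultimately show ?thesis by (rule LIMSEQ_unique)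
qed

text \<open>Cutting off to \<open>(0,l)\<close> makes the solution with data \<open>(0, proj V)\<close> a continuous function of \<open>(t, V)\<close>
  on the whole type, so that the integrand in Duhamel's formula is Borel measurable.\<close>

definition proj :: "triple \<Rightarrow> triple" where
  "proj V = (restrict_L2 {0<..<l} (fst V), snd V)"

lemma proj_LL2: "proj V \<in> LL2 l"
  by (simp add: proj_def LL2_def restrict_L2_in)

lemma proj_id: "V \<in> LL2 l \<Longrightarrow> proj V = V"
  by (auto simp: proj_def LL2_def restrict_L2_id)

lemma bounded_linear_proj: "bounded_linear proj"
  unfolding proj_def
  by (intro bounded_linear_Pair bounded_linear_compose[OF bounded_linear_restrict_L2] bounded_linear_fst bounded_linear_snd) simp

lemma bounded_linear_kick: "bounded_linear (\<lambda>V. energy_embed l (S t (0, proj V)))"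
proof -
  interpret P: bounded_linear proj by (rule bounded_linear_proj)
  obtain K where K: "\<And>V. norm (proj V) \<le> norm V * K" using P.bounded by blast
  show ?thesis
  proof (rule bounded_linear_intro[of _ "(\<bar>t\<bar> + 1) * K"])
    fix V W and c :: real
    have "(0, proj (V + W)) = (0, proj V) + (0::triple, proj W)" by (simp add: P.add)
    then show "energy_embed l (S t (0, proj (V + W))) = energy_embed l (S t (0, proj V)) + energy_embed l (S t (0, proj W))"
      by (simp only: S_add energy_add S_in kick_energy_space proj_LL2)
    have "(0, proj (c *\<^sub>R V)) = c *\<^sub>R (0::triple, proj V)" by (simp add: P.scaleR)
    then show "energy_embed l (S t (0, proj (c *\<^sub>R V))) = c *\<^sub>R energy_embed l (S t (0, proj V))"
      by (simp only: S_scaleR energy_scaleR S_in kick_energy_space proj_LL2)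
    have "norm (energy_embed l (S t (0, proj V))) \<le> (\<bar>t\<bar> + 1) * norm (proj V)"
      by (rule kick_bound[OF proj_LL2])
    also have "\<dots> \<le> (\<bar>t\<bar> + 1) * (norm V * K)" by (intro mult_left_mono K) simp
    finally show "norm (energy_embed l (S t (0, proj V))) \<le> norm V * ((\<bar>t\<bar> + 1) * K)" by (simp add: mult_ac)
  qed
qed

text \<open>Split the increment into a change of V at time t, controlled by
  \<open>kick_bound\<close> with a constant locally bounded in t, and a change of time at fixed V0,
  controlled by \<open>orbit_continuous\<close>.\<close>

lemma continuous_kick: "continuous_on UNIV (\<lambda>z. energy_embed l (S (fst z) (0, proj (snd z))))"
proof -
  let ?k = "\<lambda>t V. energy_embed l (S t (0, proj V))"
  interpret P: bounded_linear proj by (rule bounded_linear_proj)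
  have "((\<lambda>z. ?k (fst z) (snd z)) \<longlongrightarrow> ?k t0 V0) (at (t0, V0))" for t0 V0
  proof (rule LIM_zero_cancel, rule Lim_null_comparison)
    let ?b = "\<lambda>z. (\<bar>fst z\<bar> + 1) * norm (proj (snd z - V0)) + norm (?k (fst z) V0 - ?k t0 V0)"
    have "norm (?k t V - ?k t0 V0) \<le> (\<bar>t\<bar> + 1) * norm (proj (V - V0)) + norm (?k t V0 - ?k t0 V0)" for t V
    proof -
      have "?k t V - ?k t0 V0 = ?k t (V - V0) + (?k t V0 - ?k t0 V0)"
        using bounded_linear.linear[OF bounded_linear_kick, THEN linear_diff, of t V V0] by simp
      then have "norm (?k t V - ?k t0 V0) \<le> norm (?k t (V - V0)) + norm (?k t V0 - ?k t0 V0)"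
        by (simp only: norm_triangle_ineq)
      then show ?thesis using kick_bound[OF proj_LL2, of t "V - V0"] by linarith
    qed
    then show "\<forall>\<^sub>F z in at (t0, V0). norm (?k (fst z) (snd z) - ?k t0 V0) \<le> ?b z" by simp
    have lim: "((\<lambda>z. fst z) \<longlongrightarrow> t0) (at (t0, V0))" "((\<lambda>z. snd z) \<longlongrightarrow> V0) (at (t0, V0))"
      using tendsto_fst[OF tendsto_ident_at[of "(t0, V0)" UNIV]] tendsto_snd[OF tendsto_ident_at[of "(t0, V0)" UNIV]] by simp_all
    moreover have "((\<lambda>z. ?k (fst z) V0) \<longlongrightarrow> ?k t0 V0) (at (t0, V0))"
      by (rule isCont_tendsto_compose[OF orbit_continuous[OF kick_energy_space[OF proj_LL2]] lim(1)])
    ultimately have "(?b \<longlongrightarrow> (\<bar>t0\<bar> + 1) * norm (proj (V0 - V0)) + norm (?k t0 V0 - ?k t0 V0)) (at (t0, V0))"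
      by (intro tendsto_intros P.tendsto)
    then show "(?b \<longlongrightarrow> 0) (at (t0, V0))" by (simp add: P.zero)
  qed
  from this[of "fst z" "snd z" for z] show ?thesis unfolding continuous_on_def by simp
qed

end

subsection \<open>The control-to-state map and its adjoint\<close>

text \<open>By Lindelof every open set is a countable union of balls, whose preimages are sublevel
  sets of distances. For slices of a source these distances are parameter integrals.\<close>

lemma borel_measurable_dist_second_countable:
  fixes f :: "'a \<Rightarrow> 'b::{metric_space, second_countable_topology}"
  assumes dist: "\<And>q. (\<lambda>s. dist (f s) q) \<in> borel_measurable M"
  shows "f \<in> borel_measurable M"
proof (rule borel_measurableI)
  fix U :: "'b set" assume "open U"
  define B where "B = {ball q r | q r. ball q r \<subseteq> U}"
  have "\<Union>B = U"
  proof
    show "U \<subseteq> \<Union>B"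
    proof
      fix x assume "x \<in> U"
      then obtain e where "0 < e" "ball x e \<subseteq> U" using \<open>open U\<close> by (meson openE)
      then have "ball x e \<in> B" "x \<in> ball x e" by (auto simp: B_def)
      then show "x \<in> \<Union>B" by blast
    qed
  qed (auto simp: B_def)
  moreover have "\<And>b. b \<in> B \<Longrightarrow> open b" by (auto simp: B_def)
  ultimately obtain C where C: "C \<subseteq> B" "countable C" "\<Union>C = U" using Lindelof[of B] by metis
  have "f -` b \<inter> space M \<in> sets M" if b: "b \<in> C" for b
  proof -
    obtain q r where "b = ball q r" using C(1) b unfolding B_def by blast
    then have "f -` b \<inter> space M = {s \<in> space M. dist (f s) q < r}" by (auto simp: dist_commute)
    also have "\<dots> \<in> sets M" using dist[of q] by measurable
    finally show ?thesis .
  qed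
  then have "(\<Union>b\<in>C. f -` b \<inter> space M) \<in> sets M" using C(2) by (intro sets.countable_UN') auto
  moreover have "(\<Union>b\<in>C. f -` b \<inter> space M) = f -` U \<inter> space M" using C(3) by blast
  ultimately show "f -` U \<inter> space M \<in> sets M" by simp
qed

section \<open>Slices of a source in time\<close>

lemma to_L2_not_sq_integrable: "\<not> sq_integrable f \<Longrightarrow> to_L2 f = 0"
  by (simp add: zero_L2_def to_L2_def)

context
  fixes l :: real and F :: "(real \<times> real) L2"
begin

lemma rep_pair_measurable [measurable]: "rep_L2 F \<in> borel_measurable (borel \<Otimes>\<^sub>M borel)"
  using rep_L2_measurable[of F] by (simp add: borel_prod)

lemma slice_integrable:
  "integrable (lborel \<Otimes>\<^sub>M lborel) (\<lambda>p. (indicator {0<..<l} (snd p) * rep_L2 F p)\<^sup>2)"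
proof (rule Bochner_Integration.integrable_bound)
  show "integrable (lborel \<Otimes>\<^sub>M lborel) (\<lambda>p. (rep_L2 F p)\<^sup>2)"
    using sq_integrable_rep[of F] by (simp add: sq_integrable_def lborel_prod)
qed (auto simp: indicator_def)

lemma slice_sq_integrable:
  "AE s in lborel. sq_integrable (\<lambda>x. indicator {0<..<l} x * rep_L2 F (s, x))"
  using lborel_pair.AE_integrable_fst'[OF slice_integrable]
  by eventually_elim (simp add: sq_integrable_def)

lemma norm_slice:
  "AE s in lborel. (norm (slice l F s))\<^sup>2 = (LINT x|lborel. (indicator {0<..<l} x * rep_L2 F (s, x))\<^sup>2)"
  using slice_sq_integrable by eventually_elim (simp add: slice_def norm_to_L2)

lemma slice_measurable [measurable]: "slice l F \<in> borel_measurable borel"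
proof (rule borel_measurable_dist_second_countable)
  fix q
  let ?f = "\<lambda>s x. indicator {0<..<l} x * rep_L2 F (s, x)"
  define A where "A = {s. (\<integral>\<^sup>+x. ennreal ((?f s x)\<^sup>2) \<partial>lborel) < \<infinity>}"
  have [measurable]: "A \<in> sets borel"
    unfolding A_def by measurable
  have A: "sq_integrable (?f s) \<longleftrightarrow> s \<in> A" for s
    by (simp add: sq_integrable_def A_def integrable_iff_bounded)
  have "dist (slice l F s) q = (if s \<in> A then sqrt (LINT x|lborel. (?f s x - rep_L2 q x)\<^sup>2) else norm q)" for s
  proof (cases "s \<in> A")
    case True
    then show ?thesis
      using norm_to_L2_diff[of "?f s" q] A[of s] by (simp add: slice_def dist_norm real_sqrt_unique)
  next
    case False
    then show ?thesis using A[of s] by (simp add: slice_def to_L2_not_sq_integrable)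
  qed
  moreover have "(\<lambda>s. if s \<in> A then sqrt (LINT x|lborel. (?f s x - rep_L2 q x)\<^sup>2) else norm q) \<in> borel_measurable borel"
    by measurable
  ultimately show "(\<lambda>s. dist (slice l F s) q) \<in> borel_measurable borel" by simp
qed

lemma sq_integrable_norm_slice: "sq_integrable (\<lambda>s. norm (slice l F s))"
proof -
  have "integrable lborel (\<lambda>s. (norm (slice l F s))\<^sup>2)"
    using lborel_pair.integrable_fst'[OF slice_integrable] norm_slice
    by (subst integrable_cong_AE) auto
  then show ?thesis by (simp add: sq_integrable_def)
qed

lemma norm_norm_slice_le: "norm (to_L2 (\<lambda>s. norm (slice l F s))) \<le> norm F"
proof -
  have "(LINT s|lborel. (norm (slice l F s))\<^sup>2) = (LINT s|lborel. LINT x|lborel. (indicator {0<..<l} x * rep_L2 F (s, x))\<^sup>2)"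
    using norm_slice by (intro integral_cong_AE) auto
  also have "\<dots> = integral\<^sup>L (lborel \<Otimes>\<^sub>M lborel) (\<lambda>p. (indicator {0<..<l} (snd p) * rep_L2 F p)\<^sup>2)"
    using lborel_pair.integral_fst'[OF slice_integrable] by simp
  also have "\<dots> \<le> integral\<^sup>L (lborel \<Otimes>\<^sub>M lborel) (\<lambda>p. (rep_L2 F p)\<^sup>2)"
    using slice_integrable sq_integrable_rep[of F]
    by (intro integral_mono) (auto simp: sq_integrable_def lborel_prod indicator_def)
  also have "\<dots> = (norm F)\<^sup>2" by (simp add: norm_L2_square lborel_prod)
  finally show ?thesis
    unfolding norm_to_L2[OF sq_integrable_norm_slice] by (simp add: real_le_lsqrt)
qed

lemma slice_L2_on: "slice l F s \<in> L2_on {0<..<l}"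
  unfolding slice_def
  by (cases "sq_integrable (\<lambda>x. indicator {0<..<l} x * rep_L2 F (s, x))")
     (auto intro: L2_on_to_L2 simp: to_L2_not_sq_integrable L2_on_0)

end

lemma AE_lborel_pair:
  fixes P :: "'a::euclidean_space \<times> 'b::euclidean_space \<Rightarrow> bool"
  assumes "AE p in lborel. P p"
  shows "AE x in lborel. AE y in lborel. P (x, y)"
  using assms unfolding lborel_prod[symmetric] by (rule lborel_pair.AE_pair)

text \<open>The representatives obey the sum rule off a null set of the plane, which meets almost
  every line in a null set; at exceptional times a slice may have been replaced by 0. Hence only
  almost every s is reached.\<close>

lemma slice_add: "AE s in lborel. slice l (F + G) s = slice l F s + slice l G s"
  using AE_lborel_pair[OF rep_plus[of F G]] slice_sq_integrable[of l F] slice_sq_integrable[of l G]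
    slice_sq_integrable[of l "F + G"]
proof eventually_elim
  case (elim s)
  have "slice l (F + G) s = to_L2 (\<lambda>x. indicator {0<..<l} x * rep_L2 F (s, x) + indicator {0<..<l} x * rep_L2 G (s, x))"
    unfolding slice_def
  proof (rule to_L2_cong_AE[OF elim(4) sq_integrable_add[OF elim(2,3)]])
    show "AE x in lborel. indicator {0<..<l} x * rep_L2 (F + G) (s, x) = indicator {0<..<l} x * rep_L2 F (s, x) + indicator {0<..<l} x * rep_L2 G (s, x)"
      using elim(1) by eventually_elim (simp add: distrib_left)
  qed
  then show ?case using elim by (simp add: slice_def to_L2_add)
qed

lemma slice_scaleR: "AE s in lborel. slice l (c *\<^sub>R F) s = c *\<^sub>R slice l F s"
  using AE_lborel_pair[OF rep_scaleR[of c F]] slice_sq_integrable[of l F] slice_sq_integrable[of l "c *\<^sub>R F"]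
proof eventually_elim
  case (elim s)
  have "slice l (c *\<^sub>R F) s = to_L2 (\<lambda>x. c * (indicator {0<..<l} x * rep_L2 F (s, x)))"
    unfolding slice_def
  proof (rule to_L2_cong_AE[OF elim(3) sq_integrable_cmult[OF elim(2)]])
    show "AE x in lborel. indicator {0<..<l} x * rep_L2 (c *\<^sub>R F) (s, x) = c * (indicator {0<..<l} x * rep_L2 F (s, x))"
      using elim(1) by eventually_elim simp
  qed
  then show ?case using elim by (simp add: slice_def to_L2_cmult)
qed

definition forcing :: "real \<Rightarrow> source \<Rightarrow> real \<Rightarrow> triple" where
  "forcing l W s = (slice l (fst W) s, rep_L2 (snd W) s, 0)"

lemma source_term_eq: "source_term l W s = (0, forcing l W s)"
  by (simp add: source_term_def forcing_def case_prod_beta zero_prod_def)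

lemma forcing_LL2: "forcing l W s \<in> LL2 l"
  by (simp add: forcing_def LL2_def slice_L2_on)

lemma forcing_measurable [measurable]: "forcing l W \<in> borel_measurable borel"
proof -
  have [measurable]: "rep_L2 (snd W) \<in> borel_measurable borel"
    using rep_L2_measurable[of "snd W"] by simp
  show ?thesis unfolding forcing_def by measurable
qed

lemma forcing_add: "AE s in lborel. forcing l (W + W') s = forcing l W s + forcing l W' s"
  using slice_add[of l "fst W" "fst W'"] rep_plus[of "snd W" "snd W'"]
  by eventually_elim (simp add: forcing_def)

lemma forcing_scaleR: "AE s in lborel. forcing l (c *\<^sub>R W) s = c *\<^sub>R forcing l W s"
  using slice_scaleR[of l c "fst W"] rep_scaleR[of c "snd W"]
  by eventually_elim (simp add: forcing_def)

lemma norm_forcing_le: "norm (forcing l W s) \<le> norm (slice l (fst W) s) + \<bar>rep_L2 (snd W) s\<bar>"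
  unfolding forcing_def by (intro order_trans[OF norm_Pair_le] add_left_mono) (simp add: norm_prod_def)

section \<open>Duhamel's integral as a bounded linear map of the source\<close>

context wave
begin

text \<open>Cutting off to (0,T) turns the interval integral into one over the line; the values lie
  in the ambient Banach type, where the Bochner integral is taken.\<close>

definition duhamel :: "real \<Rightarrow> source \<Rightarrow> real \<Rightarrow> state \<times> real L2" where
  "duhamel T W s = indicator {0<..<T} s *\<^sub>R energy_embed l (S (T - s) (0, forcing l W s))"

lemma duhamel_measurable [measurable]: "duhamel T W \<in> borel_measurable borel"
proof -
  have "(\<lambda>s. (T - s, forcing l W s)) \<in> borel_measurable borel" by measurable
  from measurable_compose[OF this borel_measurable_continuous_onI[OF continuous_kick]]
  have "(\<lambda>s. energy_embed l (S (T - s) (0, forcing l W s))) \<in> borel_measurable borel"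
    by (simp add: proj_id forcing_LL2)
  then show ?thesis unfolding duhamel_def by measurable
qed

lemma norm_duhamel_le:
  assumes "0 < T"
  shows "norm (duhamel T W s) \<le> (T + 1) * (indicator {0<..<T} s * norm (slice l (fst W) s) + indicator {0<..<T} s * \<bar>rep_L2 (snd W) s\<bar>)"
proof (cases "s \<in> {0<..<T}")
  case True
  then have "norm (duhamel T W s) \<le> (\<bar>T - s\<bar> + 1) * norm (forcing l W s)"
    using kick_bound[OF forcing_LL2[of l W s], of "T - s"] by (simp add: duhamel_def)
  also have "\<dots> \<le> (T + 1) * (norm (slice l (fst W) s) + \<bar>rep_L2 (snd W) s\<bar>)"
    using True by (intro mult_mono norm_forcing_le) auto
  finally show ?thesis using True by simp
qed (simp add: duhamel_def)

lemma sq_integrable_abs: "sq_integrable f \<Longrightarrow> sq_integrable (\<lambda>x. \<bar>f x\<bar>)"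
  by (auto simp: sq_integrable_def)

lemma integral_indicator_le:
  assumes "0 < T" "sq_integrable f"
  shows "(LINT s|lborel. indicator {0<..<T} s * f s) \<le> sqrt T * norm (to_L2 f)"
proof -
  have sq: "sq_integrable (indicator {0<..<T} :: real \<Rightarrow> real)" by (simp add: sq_integrable_indicator_bounded)
  have "(\<lambda>x. (indicator {0<..<T} x :: real)\<^sup>2) = indicator {0<..<T}" by (auto simp: indicator_def)
  then have "norm (to_L2 (indicator {0<..<T} :: real \<Rightarrow> real)) = sqrt T"
    using assms(1) norm_to_L2[OF sq] by simp
  then show ?thesis
    using norm_cauchy_schwarz[of "to_L2 (indicator {0<..<T} :: real \<Rightarrow> real)" "to_L2 f"]
    by (simp add: inner_to_L2_to_L2[OF sq assms(2)])
qed

lemma duhamel_bound_integrable: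
  "integrable lborel (\<lambda>s. (T + 1) * (indicator {0<..<T} s * norm (slice l (fst W) s) + indicator {0<..<T} s * \<bar>rep_L2 (snd W) s\<bar>))"
  by (intro integrable_mult_right Bochner_Integration.integrable_add sq_integrable_mult
      sq_integrable_indicator_bounded sq_integrable_norm_slice sq_integrable_abs sq_integrable_rep) auto

lemma duhamel_integrable:
  assumes "0 < T"
  shows "integrable lborel (duhamel T W)"
proof (rule Bochner_Integration.integrable_bound[OF duhamel_bound_integrable])
  show "AE s in lborel. norm (duhamel T W s) \<le> norm ((T + 1) * (indicator {0<..<T} s * norm (slice l (fst W) s) + indicator {0<..<T} s * \<bar>rep_L2 (snd W) s\<bar>))"
    using norm_duhamel_le[OF assms] by (auto intro!: AE_I2 order_trans[OF norm_duhamel_le[OF assms]])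
qed measurable

text \<open>The operator \<Lambda> of the overview: the projections discard the derivative
  coordinate and the velocity.\<close>

definition control_map :: "real \<Rightarrow> source \<Rightarrow> triple" where
  "control_map T W = fst (fst (LINT s|lborel. duhamel T W s))"

text \<open>In the constant, T + 1 bounds the kicks at times T - s, sqrt T comes from Cauchy-Schwarz
  on (0,T), and 2 counts the components F and G. Linearity of the forcing almost everywhere is
  enough under the integral.\<close>

lemma bounded_linear_control_map:
  assumes T: "0 < T"
  shows "bounded_linear (control_map T)"
  unfolding control_map_def
proof (intro bounded_linear_compose[OF bounded_linear_fst] bounded_linear_compose[OF bounded_linear_fst]
    bounded_linear_intro[of _ "2 * (T + 1) * sqrt T"])
  fix W W' :: source and c :: real
  have k: "energy_embed l (S t (0, proj (forcing l W s))) = energy_embed l (S t (0, forcing l W s))" for t s W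
    by (simp add: proj_id forcing_LL2)
  note lin = bounded_linear.linear[OF bounded_linear_kick]
  have "(LINT s|lborel. duhamel T (W + W') s) = (LINT s|lborel. duhamel T W s + duhamel T W' s)"
  proof (rule integral_cong_AE)
    show "AE s in lborel. duhamel T (W + W') s = duhamel T W s + duhamel T W' s"
      using forcing_add[of l W W']
    proof eventually_elim
      case (elim s)
      then show ?case
        using linear_add[OF lin, of "T - s" "forcing l W s" "forcing l W' s"] k[of "T - s" "W + W'" s]
        by (simp add: duhamel_def k flip: scaleR_add_right)
    qed
  qed measurable
  then show "(LINT s|lborel. duhamel T (W + W') s) = (LINT s|lborel. duhamel T W s) + (LINT s|lborel. duhamel T W' s)"
    by (simp add: duhamel_integrable[OF T])
  have "(LINT s|lborel. duhamel T (c *\<^sub>R W) s) = (LINT s|lborel. c *\<^sub>R duhamel T W s)"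
  proof (rule integral_cong_AE)
    show "AE s in lborel. duhamel T (c *\<^sub>R W) s = c *\<^sub>R duhamel T W s"
      using forcing_scaleR[of l c W]
    proof eventually_elim
      case (elim s)
      then have "energy_embed l (S (T - s) (0, forcing l (c *\<^sub>R W) s)) = c *\<^sub>R energy_embed l (S (T - s) (0, forcing l W s))"
        using linear_cmul[OF lin, of "T - s" c "forcing l W s"] k[of "T - s" "c *\<^sub>R W" s] k[of "T - s" W s]
        by metis
      then show ?case by (simp add: duhamel_def mult.commute)
    qed
  qed measurable
  then show "(LINT s|lborel. duhamel T (c *\<^sub>R W) s) = c *\<^sub>R (LINT s|lborel. duhamel T W s)" by simp
  have nF: "norm (fst W) \<le> norm W" and nG: "norm (snd W) \<le> norm W"
    using norm_fst_le[of "fst W" "snd W"] norm_snd_le[of "snd W" "fst W"] by simp_all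
  have G: "norm (to_L2 (\<lambda>s. \<bar>rep_L2 (snd W) s\<bar>)) = norm (snd W)"
    using norm_to_L2[OF sq_integrable_abs[OF sq_integrable_rep], of "snd W"] norm_L2_square[of "snd W", symmetric] by simp
  have i: "integrable lborel (\<lambda>s. indicator {0<..<T} s * norm (slice l (fst W) s))"
    "integrable lborel (\<lambda>s. indicator {0<..<T} s * \<bar>rep_L2 (snd W) s\<bar>)"
    by (intro sq_integrable_mult sq_integrable_indicator_bounded sq_integrable_norm_slice sq_integrable_abs sq_integrable_rep; simp)+
  have "norm (LINT s|lborel. duhamel T W s) \<le> (LINT s|lborel. norm (duhamel T W s))"
    by (rule integral_norm_bound)
  also have "\<dots> \<le> (LINT s|lborel. (T + 1) * (indicator {0<..<T} s * norm (slice l (fst W) s) + indicator {0<..<T} s * \<bar>rep_L2 (snd W) s\<bar>))"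
    by (intro integral_mono integrable_norm duhamel_integrable[OF T] duhamel_bound_integrable norm_duhamel_le[OF T])
  also have "\<dots> = (T + 1) * ((LINT s|lborel. indicator {0<..<T} s * norm (slice l (fst W) s)) + (LINT s|lborel. indicator {0<..<T} s * \<bar>rep_L2 (snd W) s\<bar>))"
    using i by simp
  also have "\<dots> \<le> (T + 1) * (sqrt T * norm W + sqrt T * norm W)"
  proof (intro mult_left_mono add_mono)
    show "(LINT s|lborel. indicator {0<..<T} s * norm (slice l (fst W) s)) \<le> sqrt T * norm W"
      using T nF norm_norm_slice_le[of l "fst W"]
      by (intro order_trans[OF integral_indicator_le[OF T sq_integrable_norm_slice]] mult_left_mono) auto
    show "(LINT s|lborel. indicator {0<..<T} s * \<bar>rep_L2 (snd W) s\<bar>) \<le> sqrt T * norm W"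
      using T nG G
      by (intro order_trans[OF integral_indicator_le[OF T sq_integrable_abs[OF sq_integrable_rep]]] mult_left_mono) auto
  qed (use T in simp)
  finally show "norm (LINT s|lborel. duhamel T W s) \<le> norm W * (2 * (T + 1) * sqrt T)"
    by (simp add: algebra_simps)
qed

lemma control_map_functional:
  assumes "0 < T" "bounded_linear f"
  shows "f (control_map T W) = (LINT s|lborel. indicator {0<..<T} s *\<^sub>R f (fst (S (T - s) (0, forcing l W s))))"
proof -
  have "bounded_linear (\<lambda>z :: state \<times> real L2. f (fst (fst z)))"
    by (intro bounded_linear_compose[OF assms(2)] bounded_linear_compose[OF bounded_linear_fst] bounded_linear_fst)
  from integral_bounded_linear[OF this duhamel_integrable[OF assms(1)], of W]
  have "f (control_map T W) = (LINT s|lborel. f (fst (fst (duhamel T W s))))"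
    by (simp add: control_map_def)
  also have "(\<lambda>s. f (fst (fst (duhamel T W s)))) = (\<lambda>s. indicator {0<..<T} s *\<^sub>R f (fst (S (T - s) (0, forcing l W s))))"
    using linear_cmul[OF bounded_linear.linear[OF assms(2)]] by (auto simp: duhamel_def fst_embed)
  finally show ?thesis .
qed

lemma fst_LL2: "X \<in> energy_space l \<Longrightarrow> fst X \<in> LL2 l"
  by (auto simp: energy_space_def HH1_LL2)

text \<open>\<open>proj\<close> fixes the integrand pointwise and commutes with the integral, so it
  fixes the integral as well.\<close>

lemma control_map_LL2:
  assumes "0 < T"
  shows "control_map T W \<in> LL2 l"
proof -
  have "proj (fst (S (T - s) (0, forcing l W s))) = fst (S (T - s) (0, forcing l W s))" for s
    by (intro proj_id fst_LL2 S_in kick_energy_space forcing_LL2)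
  then have "proj (control_map T W) = control_map T W"
    using control_map_functional[OF assms bounded_linear_proj] control_map_functional[OF assms bounded_linear_ident]
    by simp
  then show ?thesis using proj_LL2 by metis
qed

lemma final_state_eq:
  assumes "0 < T"
  shows "final_state T l S X0 W = fst (S T X0) + control_map T W"
proof -
  have "(LBINT s=ereal 0..ereal T. energy_embed l (S (T - s) (source_term l W s))) = (LINT s|lborel. duhamel T W s)"
    using assms by (simp add: interval_lebesgue_integral_le_eq set_lebesgue_integral_def duhamel_def source_term_eq)
  then show ?thesis by (simp add: final_state_def mild_solution_def energy_integral_def control_map_def)
qed

lemma adjoint_state_eq:
  assumes "0 < T"
  shows "adjoint_state T l S X0 Yd W t = S (t - T) (0, - (final_state T l S X0 W - Yd))"
proof -
  \<comment> \<open>The chosen representative of the zero source vanishes only almost everywhere,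
    which the integral does not detect.\<close>
  have "AE s in lborel. forcing l 0 s = 0" using forcing_scaleR[of l 0 0] by simp
  moreover have "S t 0 = 0" for t using S_scaleR[of 0 t 0] kick_energy_space[OF subspace_0[OF subspace_LL2]] by (simp add: zero_prod_def[symmetric])
  moreover have "energy_embed l 0 = 0" using energy_embed_kick[of 0] by (simp add: zero_prod_def[symmetric])
  ultimately have "AE s in lborel. energy_embed l (S (t - s) (source_term l 0 s)) = 0"
    by (auto simp: source_term_eq zero_prod_def[symmetric] elim: eventually_mono)
  \<comment> \<open>An arbitrary set A covers both orientations, t before T and t after T.\<close>
  then have "(LBINT s:A. energy_embed l (S (t - s) (source_term l 0 s))) = 0" for A
    unfolding set_lebesgue_integral_def by (intro integral_eq_zero_AE) (auto elim: eventually_mono)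
  then have "energy_integral l T t (\<lambda>s. S (t - s) (source_term l 0 s)) = 0"
    by (simp add: energy_integral_def interval_lebesgue_integral_def)
  then show ?thesis by (simp add: adjoint_state_def mild_solution_def zero_prod_def)
qed

text \<open>The coordinates (a, g) of the displacement are components of the embedded state, hence
  continuous in time along orbits.\<close>

lemma orbit_h1_triple:
  assumes "X \<in> energy_space l"
  shows "fst X = h1_triple l (fst (snd (fst X))) (snd (energy_embed l X))"
  using assms by (auto simp: energy_space_iff energy_embed_h1_triple) (simp add: h1_triple_def)

end

lemma continuous_on_to_L2_indicator: "continuous_on UNIV (\<lambda>x::real. to_L2 (indicator {0<..<x} :: real \<Rightarrow> real))"
proof -
  have "((\<lambda>x. to_L2 (indicator {0<..<x} :: real \<Rightarrow> real)) \<longlongrightarrow> to_L2 (indicator {0<..<y})) (at y)" for y :: real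
  proof (rule LIM_zero_cancel, rule Lim_null_comparison)
    show "\<forall>\<^sub>F x in at y. norm (to_L2 (indicator {0<..<x} :: real \<Rightarrow> real) - to_L2 (indicator {0<..<y})) \<le> sqrt \<bar>x - y\<bar>"
      using norm_indicator_diff_le by simp
    have "((\<lambda>x. sqrt \<bar>x - y\<bar>) \<longlongrightarrow> sqrt \<bar>y - y\<bar>) (at y)" by (intro tendsto_intros)
    then show "((\<lambda>x. sqrt \<bar>x - y\<bar>) \<longlongrightarrow> 0) (at y)" by simp
  qed
  then show ?thesis by (simp add: continuous_on_def)
qed

section \<open>The adjoint of the control map\<close>

context wave
begin

text \<open>\<open>kick_adjoint\<close> at time T - s transposes the integrand, and the terminal
  velocity -Z absorbs its minus sign. The third component of the forcing is 0, so of the two traces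
  only the one at x = 0 is paired with the source.\<close>

lemma control_map_adjoint:
  fixes T :: real and Z :: triple
  assumes T: "0 < T" and Z: "Z \<in> LL2 l"
  defines "\<phi> \<equiv> \<lambda>t. cont_rep l (fst (fst (S (t - T) (0, - Z))))"
  defines "\<Phi> \<equiv> zero_ext ({0<..<T} \<times> {0<..<l}) (\<lambda>(t, x). \<phi> t x)"
    and "\<Phi>0 \<equiv> zero_ext {0<..<T} (\<lambda>t. \<phi> t 0)"
  shows "sq_integrable \<Phi>" "sq_integrable \<Phi>0"
    and "Z \<bullet> control_map T W = (to_L2 \<Phi>, to_L2 \<Phi>0) \<bullet> W"
proof -
  have mZ: "- Z \<in> LL2 l" using subspace_neg[OF subspace_LL2 Z] .
  define P where "P t = S (t - T) (0, - Z)" for t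
  have P: "P t \<in> energy_space l" for t unfolding P_def by (intro S_in kick_energy_space mZ)
  define \<alpha> where "\<alpha> t = fst (snd (fst (P t)))" for t
  define \<gamma> where "\<gamma> t = snd (energy_embed l (P t))" for t
  have PE: "fst (P t) = h1_triple l (\<alpha> t) (\<gamma> t)" for t
    using orbit_h1_triple[OF P] by (simp add: \<alpha>_def \<gamma>_def)
  have cont: "continuous_on UNIV (\<lambda>t. energy_embed l (P t))"
  proof (intro continuous_at_imp_continuous_on ballI)
    fix t
    have "isCont (\<lambda>t. energy_embed l (S t (0, - Z))) (t - T)"
      by (intro orbit_continuous kick_energy_space mZ)
    then show "isCont (\<lambda>t. energy_embed l (P t)) t"
      unfolding P_def
      by (rule isCont_o2[where f = "\<lambda>t. t - T" and g = "\<lambda>t. energy_embed l (S t (0, - Z))", rotated]) simp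
  qed
  have \<gamma>c: "continuous_on UNIV \<gamma>" unfolding \<gamma>_def by (intro continuous_on_snd cont)
  have "\<alpha> = (\<lambda>t. fst (snd (fst (fst (energy_embed l (P t))))))" by (simp add: \<alpha>_def fst_embed fun_eq_iff)
  then have \<alpha>c: "continuous_on UNIV \<alpha>" by (simp only:) (intro continuous_on_snd continuous_on_fst cont)
  \<comment> \<open>A jointly continuous function on the plane that agrees with \<phi> for x in
    [0,l], where alone the values of \<open>cont_rep\<close> are determined. Continuity on the
    compact rectangle gives square integrability.\<close>
  define \<Psi> where "\<Psi> p = \<alpha> (fst p) + primitive (\<gamma> (fst p)) (snd p)" for p
  have \<Psi>c: "continuous_on UNIV \<Psi>"
    unfolding \<Psi>_def primitive_def
    by (intro continuous_intros continuous_on_compose2[OF \<alpha>c] continuous_on_compose2[OF \<gamma>c]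
      continuous_on_compose2[OF continuous_on_to_L2_indicator]) auto
  have \<phi>: "\<phi> t x = \<Psi> (t, x)" if "x \<in> {0..l}" for t x
    using PE[of t] that cont_rep_h1_fun[OF l_pos that] by (simp add: \<phi>_def P_def \<Psi>_def h1_triple_def)
  have \<Phi>: "\<Phi> = (\<lambda>p. indicator ({0<..<T} \<times> {0<..<l}) p * \<Psi> p)"
    by (auto simp: \<Phi>_def zero_ext_def fun_eq_iff indicator_def \<phi>)
  have \<Phi>0: "\<Phi>0 = (\<lambda>t. indicator {0<..<T} t * \<alpha> t)"
    using l_pos by (auto simp: \<Phi>0_def zero_ext_def fun_eq_iff indicator_def \<phi> \<Psi>_def)
  show sq\<Phi>: "sq_integrable \<Phi>"
    unfolding \<Phi>
  proof (rule sq_integrable_indicator_continuous[of "{0..T} \<times> {0..l}"])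
    have "open ({0<..<T} \<times> {0<..<l})" by (intro open_Times) auto
    then show "{0<..<T} \<times> {0<..<l} \<in> sets borel" by (rule borel_open)
  qed (auto intro!: compact_Times continuous_on_subset[OF \<Psi>c])
  show sq\<Phi>0: "sq_integrable \<Phi>0"
    unfolding \<Phi>0 by (intro sq_integrable_indicator_continuous_Ioo continuous_on_subset[OF \<alpha>c]) auto
  have F_int: "integrable (lborel \<Otimes>\<^sub>M lborel) (\<lambda>p. \<Phi> p * rep_L2 (fst W) p)"
    using sq_integrable_mult[OF sq\<Phi> sq_integrable_rep] by (simp add: lborel_prod)
  have G_int: "integrable lborel (\<lambda>s. \<Phi>0 s * rep_L2 (snd W) s)"
    using sq_integrable_mult[OF sq\<Phi>0 sq_integrable_rep] .
  have "Z \<bullet> control_map T W = (LINT s|lborel. indicator {0<..<T} s *\<^sub>R (Z \<bullet> fst (S (T - s) (0, forcing l W s))))"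
    by (rule control_map_functional[OF T bounded_linear_inner_right])
  also have "\<dots> = (LINT s|lborel. indicator {0<..<T} s * (forcing l W s \<bullet> fst (P s)))"
  proof (rule Bochner_Integration.integral_cong)
    fix s
    have "S (s - T) (0, - Z) = - S (s - T) (0, Z)"
      using S_scaleR[OF kick_energy_space[OF Z], of "s - T" "-1"] by simp
    then show "indicator {0<..<T} s *\<^sub>R (Z \<bullet> fst (S (T - s) (0, forcing l W s))) = indicator {0<..<T} s * (forcing l W s \<bullet> fst (P s))"
      using kick_adjoint[OF forcing_LL2 Z, of "T - s" W s] by (simp add: P_def inner_commute)
  qed simp
  also have "\<dots> = (LINT s|lborel. (LINT x|lborel. \<Phi> (s, x) * rep_L2 (fst W) (s, x)) + \<Phi>0 s * rep_L2 (snd W) s)"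
  proof (rule integral_cong_AE)
    show "AE s in lborel. indicator {0<..<T} s * (forcing l W s \<bullet> fst (P s))
      = (LINT x|lborel. \<Phi> (s, x) * rep_L2 (fst W) (s, x)) + \<Phi>0 s * rep_L2 (snd W) s"
      using slice_sq_integrable[of l "fst W"]
    proof eventually_elim
      case (elim s)
      have "h1_fun l (\<alpha> s) (\<gamma> s) \<bullet> slice l (fst W) s
          = (LINT x|lborel. (indicator {0<..<l} x * (\<alpha> s + primitive (\<gamma> s) x)) * (indicator {0<..<l} x * rep_L2 (fst W) (s, x)))"
        unfolding h1_fun_def slice_def by (rule inner_to_L2_to_L2[OF sq_integrable_h1_fun elim])
      then have "indicator {0<..<T} s * (h1_fun l (\<alpha> s) (\<gamma> s) \<bullet> slice l (fst W) s)
          = (LINT x|lborel. indicator {0<..<T} s * ((indicator {0<..<l} x * (\<alpha> s + primitive (\<gamma> s) x)) * (indicator {0<..<l} x * rep_L2 (fst W) (s, x))))"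
        by simp
      also have "\<dots> = (LINT x|lborel. \<Phi> (s, x) * rep_L2 (fst W) (s, x))"
        by (intro Bochner_Integration.integral_cong) (auto simp: \<Phi> \<Psi>_def indicator_def)
      finally show ?case
        by (simp add: PE h1_triple_def forcing_def inner_prod_def distrib_left \<Phi>0 inner_commute mult_ac)
    qed
    have "(\<lambda>s. fst (fst (energy_embed l (P s)))) \<in> borel_measurable borel"
      by (intro borel_measurable_continuous_onI continuous_on_fst cont)
    then have [measurable]: "(\<lambda>s. fst (P s)) \<in> borel_measurable borel" by (simp add: fst_embed)
    show "(\<lambda>s. indicator {0<..<T} s * (forcing l W s \<bullet> fst (P s))) \<in> borel_measurable lborel"
      unfolding measurable_lborel1 by measurable
    show "(\<lambda>s. (LINT x|lborel. \<Phi> (s, x) * rep_L2 (fst W) (s, x)) + \<Phi>0 s * rep_L2 (snd W) s) \<in> borel_measurable lborel"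
      using lborel_pair.integrable_fst'[OF F_int] G_int by (intro borel_measurable_add) auto
  qed
  also have "\<dots> = (LINT s|lborel. LINT x|lborel. \<Phi> (s, x) * rep_L2 (fst W) (s, x)) + (LINT s|lborel. \<Phi>0 s * rep_L2 (snd W) s)"
    using lborel_pair.integrable_fst'[OF F_int] G_int by (intro Bochner_Integration.integral_add)
  also have "\<dots> = (to_L2 \<Phi>, to_L2 \<Phi>0) \<bullet> W"
    using lborel_pair.integral_fst'[OF F_int]
    by (simp add: inner_prod_def inner_to_L2[OF sq\<Phi>] inner_to_L2[OF sq\<Phi>0] lborel_prod)
  finally show "Z \<bullet> control_map T W = (to_L2 \<Phi>, to_L2 \<Phi>0) \<bullet> W" .
qed

end

section \<open>The gradient of the quadratic cost\<close>

theorem proposition3p3: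
  fixes T l Fmin Fmax Gmin Gmax :: real
    and S :: "real \<Rightarrow> state \<Rightarrow> state"
    and X0 :: state and Yd :: triple and W :: source
  assumes "0 < T" and "0 < l"
    and "Fmin \<le> Fmax" and "Gmin \<le> Gmax"
    and "wave_group l S"
    and "X0 \<in> energy_space l"
    and "Yd \<in> LL2 l"
    and "W \<in> U_ad T l Fmin Fmax Gmin Gmax"
  shows "let \<phi> = adjoint_fun T l S X0 Yd W;
             \<Phi> = zero_ext ({0<..<T} \<times> {0<..<l}) (\<lambda>(t, x). \<phi> t x);
             \<Phi>0 = zero_ext {0<..<T} (\<lambda>t. \<phi> t 0)
         in sq_integrable \<Phi> \<and> sq_integrable \<Phi>0 \<and>
            (cost T l S X0 Yd has_derivative (\<lambda>\<delta>W. inner (to_L2 \<Phi>, to_L2 \<Phi>0) \<delta>W))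
              (at W within U_ad T l Fmin Fmax Gmin Gmax)"
proof -
  interpret wave l S using assms(2,5) by unfold_locales
  define R where "R = final_state T l S X0 W - Yd"
  have "R \<in> LL2 l"
    unfolding R_def final_state_eq[OF assms(1)]
    by (intro subspace_diff[OF subspace_LL2] subspace_add[OF subspace_LL2] fst_LL2 S_in control_map_LL2 assms)
  note adj = control_map_adjoint[OF assms(1) this]
  have \<phi>: "adjoint_fun T l S X0 Yd W = (\<lambda>t. cont_rep l (fst (fst (S (t - T) (0, - R)))))"
    by (simp add: adjoint_fun_def adjoint_state_eq[OF assms(1)] R_def fun_eq_iff)
  have cost: "cost T l S X0 Yd
      = (\<lambda>W. 1 / 2 * ((fst (S T X0) + control_map T W - Yd) \<bullet> (fst (S T X0) + control_map T W - Yd)))"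
    by (simp add: cost_def final_state_eq[OF assms(1)] power2_norm_eq_inner fun_eq_iff)
  \<comment> \<open>The quadratic formula for the cost holds on the whole source type, so the
    derivative exists within every set A, in particular within the admissible set.\<close>
  have "(cost T l S X0 Yd has_derivative (\<lambda>\<delta>W. R \<bullet> control_map T \<delta>W)) (at W within A)" for A
    unfolding cost
    by (rule has_derivative_eq_rhs, (rule derivative_intros bounded_linear.has_derivative[OF bounded_linear_control_map[OF assms(1)]])+)
      (simp add: R_def final_state_eq[OF assms(1)] inner_commute fun_eq_iff)
  then show ?thesis
    unfolding Let_def \<phi> using adj by simp
qed

end
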